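(* Let $m\ge1$ be an integer. Let $z^{\ast}$ be an $m$-equivariant function on $\mathbb{R}^2$ such that the $-(m+2)$-equivariant function $\tilde z^{\ast}:=e^{-i(2m+2)\theta}z^{\ast}$ satisfies $\|\tilde z^{\ast}\|_{H^{k}_{-(m+2)}}<\alpha^{\ast}$ for some fixed $k=k(m)>m+3$, with $\alpha^\ast>0$ sufficiently small. Let $\{u^{(\eta)}\}_{\eta\in[0,\eta^\ast]}$ be the one-parameter family of solutions to (CSS) described in the context, and let $\mathcal{C}$ be the pseudoconformal transformation $$[\mathcal{C}v](t,x)=\frac1te^{i\frac{|x|^2}{4t}}v\Big(-\frac1t,\frac xt\Big),\qquad t>0.$$ Then: 1. $\mathcal{C}u^{(0)}-Q$ scatters forward in time. 2. For every $\eta\in(0,\eta^\ast]$, $\mathcal{C}u^{(\eta)}$ scatters forward in time.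
   Context: Write $x=(x_1,x_2)\in\mathbb{R}^2$ and $x_1+ix_2=re^{i\theta}$. For $\ell\in\mathbb{Z}$, a function on $\mathbb{R}^2$ is $\ell$-equivariant if it has the form $g(r)e^{i\ell\theta}$; such a function is identified with its radial part $g$ when convenient. $L^2_\ell$ and $H^s_\ell$ denote the $\ell$-equivariant functions in $L^2(\mathbb{R}^2)$ and $H^s(\mathbb{R}^2)$ with the inherited norms, and $\|f\|_{\dot H^1_\ell}^2=\|\partial_r f\|_{L^2}^2+\ell^2\|r^{-1}f\|_{L^2}^2$. Implicit constants depend only on $m$. For a radial part $u$, set $A_\theta[u](r)=-\frac12\int_0^r|u|^2r'\,dr'$. For $\ell\in\mathbb{Z}$ the $\ell$-equivariant (self-dual, Coulomb gauge) Chern-Simons-Schr\"odinger equation for the radial part $u(t,r)$ is $$i\partial_tu+\Big(\partial_{rr}+\tfrac1r\partial_r-\tfrac{\ell^2}{r^2}\Big)u=-|u|^2u+\tfrac{2\ell}{r^2}A_\theta[u]u+\tfrac{A_\theta[u]^2}{r^2}u+A_0^{(\ell)}[u]u,\quad A_0^{(\ell)}[u](r)=-\int_r^\infty(\ell+A_\theta[u])|u|^2\tfrac{dr'}{r'}.$$ (CSS) denotes this equation with $\ell=m$; solutions are understood in the Duhamel sense. A time-dependent $m$-equivariant function $v$ scatters forward (backward) in time if there is $\phi_\pm\in L^2_m$ with $\|v(t)-e^{it\Delta}\phi_\pm\|_{L^2}\to0$ as $t\to+\infty$ ($-\infty$). $Q(r)=\sqrt8\,(m+1)\dfrac{r^m}{1+r^{2(m+1)}}$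 (also denoting its $m$-equivariant extension $Q(r)e^{im\theta}$), and for a function $f$ of $y$ and $b\in\mathbb{R}$, $f_b(y)=f(y)e^{-ib|y|^2/4}$. For small $\eta\ge0$, $Q^{(\eta)}$ is the smooth real-valued function on $(0,\infty)$ solving $\partial_rQ^{(\eta)}-\frac{m+A_\theta[Q^{(\eta)}]}{r}Q^{(\eta)}=-\frac\eta2rQ^{(\eta)}$ with $Q^{(\eta)}(r)/Q(r)\to1$ as $r\to0^+$. Given $z^\ast$, let $\tilde z$ be the global $-(m+2)$-equivariant solution of the $-(m+2)$-equivariant Chern-Simons-Schr\"odinger equation with $\tilde z(0)=\tilde z^\ast$, let $z=e^{i(2m+2)\theta}\tilde z$, and let $\gamma_{\mathrm{cor}}(t)=-\int_0^t\theta_{\mathrm{cor}}\,dt'$, $\theta_{\mathrm{cor}}(t)=-\int_0^\infty(-m-2+A_\theta[z(t)])|z(t,r)|^2\frac{dr}{r}$. The family $\{u^{(\eta)}\}_{\eta\in[0,\eta^\ast]}$ consists of $H^1_m$-solutions to (CSS) such that: (i) $u^{(0)}$ is the solution on $(-\infty,0)$ satisfying, for $t<0$ near $0$, $\|u^{(0)}(t)-\frac{1}{|t|}Q_{|t|}(\frac{r}{|t|})e^{i\gamma_{\mathrm{cor}}(t)}-z(t)\|_{\dot H^1_m}\lesssim\alpha^\ast|t|^m$ and $\|u^{(0)}(t)-\frac{1}{|t|}Q_{|t|}(\frac{r}{|t|})e^{i\gamma_{\mathrm{cor}}(t)}-z(t)\|_{L^2_m}\lesssim\alpha^\ast|t|^{m+1}$;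 (ii) for $\eta>0$, $u^{(\eta)}$ is global and scatters both forward and backward in time; (iii) $\eta\mapsto u^{(\eta)}$ is continuous into $C(J;H^s)$ for every compact $J\subset(-\infty,0)$ and $s<1$; (iv) for $t$ near $0$ ($t<0$ if $\eta=0$), with $\langle t\rangle=(t^2+\eta^2)^{1/2}$, $u^{(\eta)}(t,x)=\frac{e^{im(\theta+\gamma^{(\eta)}(t))}}{\langle t\rangle}Q^{(\eta)}_{-t}(\frac{r}{\langle t\rangle})+O_{H^1_m}(\alpha^\ast)$, where $|\gamma^{(0)}(-\tau)|\lesssim\alpha^\ast\tau$ and $\limsup_{\eta\to0^+}|\gamma^{(\eta)}(\tau)-\gamma^{(\eta)}(-\tau)-\frac{m+1}{m}\pi|\lesssim\alpha^\ast\tau$ for all small $\tau>0$. *)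

theory Defs
  imports "HOL-Analysis.Analysis" "HOL-Library.Liminf_Limsup"
begin

text \<open>
  The plane is the type \<^typ>\<open>complex\<close>, a point being \<open>x = x\<^sub>1 + i x\<^sub>2 = r e\<^sup>i\<^sup>\<theta>\<close>.  Thus
  \<open>r = cmod x\<close>, \<open>e\<^sup>i\<^sup>\<theta> = sgn x\<close> for \<open>x \<noteq> 0\<close>, \<open>x \<bullet> y\<close> is the Euclidean inner product and
  \<^term>\<open>lborel :: complex measure\<close> is two-dimensional Lebesgue measure.
  Elements of \<open>L\<^sup>2\<close> are given by Borel representatives.
\<close>

section \<open>Square integrable functions, Fourier transform and Sobolev norms\<close>

definition in_L2 :: "(complex \<Rightarrow> complex) \<Rightarrow> bool" where
  "in_L2 f \<longleftrightarrow> f \<in> borel_measurable borel \<and> integrable lborel (\<lambda>x. (cmod (f x))\<^sup>2)"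

definition L2_norm :: "(complex \<Rightarrow> complex) \<Rightarrow> real" where
  "L2_norm f = sqrt (LINT x|lborel. (cmod (f x))\<^sup>2)"

definition L2_inner :: "(complex \<Rightarrow> complex) \<Rightarrow> (complex \<Rightarrow> complex) \<Rightarrow> complex" where
  "L2_inner f g = (LINT x|lborel. f x * cnj (g x))"

text \<open>
  The unitary Fourier transform on \<open>L\<^sup>2\<close>, as the \<open>L\<^sup>2\<close> limit of the transforms of the truncations
  to balls.  It is only determined almost everywhere, and is only used where this does not matter.
\<close>

definition has_fourier :: "(complex \<Rightarrow> complex) \<Rightarrow> (complex \<Rightarrow> complex) \<Rightarrow> bool" where
  "has_fourier f F \<longleftrightarrow> in_L2 f \<and> in_L2 F \<and>
     ((\<lambda>R::real. L2_norm (\<lambda>\<xi>. F \<xi> -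
          (LINT x:cball 0 R|lborel. cis (- (x \<bullet> \<xi>)) * f x) / of_real (2 * pi))) \<longlongrightarrow> 0) at_top"

definition fourier :: "(complex \<Rightarrow> complex) \<Rightarrow> complex \<Rightarrow> complex" where
  "fourier f = (SOME F. has_fourier f F)"

text \<open>\<open>H\<^sup>s \<inter> L\<^sup>2\<close>; all functions below are in \<open>L\<^sup>2\<close>, also when \<open>s < 0\<close>.\<close>

definition in_Hs :: "real \<Rightarrow> (complex \<Rightarrow> complex) \<Rightarrow> bool" where
  "in_Hs s f \<longleftrightarrow> in_L2 f \<and>
     integrable lborel (\<lambda>\<xi>. (1 + (cmod \<xi>)\<^sup>2) powr s * (cmod (fourier f \<xi>))\<^sup>2)"

definition Hs_norm :: "real \<Rightarrow> (complex \<Rightarrow> complex) \<Rightarrow> real" where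
  "Hs_norm s f = sqrt (LINT \<xi>|lborel. (1 + (cmod \<xi>)\<^sup>2) powr s * (cmod (fourier f \<xi>))\<^sup>2)"

text \<open>The free evolution \<open>e\<^sup>i\<^sup>t\<^sup>\<Delta>\<close> on \<open>L\<^sup>2\<close>, i.e. the Fourier multiplier \<open>exp(-it|\<xi>|\<^sup>2)\<close>.\<close>

definition free_evol :: "real \<Rightarrow> (complex \<Rightarrow> complex) \<Rightarrow> complex \<Rightarrow> complex" where
  "free_evol t f = (SOME g. in_L2 g \<and>
     (AE \<xi> in lborel. fourier g \<xi> = cis (- t * (cmod \<xi>)\<^sup>2) * fourier f \<xi>))"

section \<open>Equivariant functions\<close>

text \<open>The factor \<open>e\<^sup>i\<^sup>l\<^sup>\<theta>\<close>; the value at the origin is irrelevant.\<close>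

definition ang :: "int \<Rightarrow> complex \<Rightarrow> complex" where
  "ang l x = sgn x powi l"

definition equivariant :: "int \<Rightarrow> (complex \<Rightarrow> complex) \<Rightarrow> bool" where
  "equivariant l f \<longleftrightarrow> (\<exists>g :: real \<Rightarrow> complex. \<forall>x. x \<noteq> 0 \<longrightarrow> f x = g (cmod x) * ang l x)"

text \<open>For equivariant \<open>f\<close> the radial part on \<open>r > 0\<close> is the restriction of \<open>f\<close> to the ray \<open>\<theta> = 0\<close>.\<close>

definition radial :: "(complex \<Rightarrow> complex) \<Rightarrow> real \<Rightarrow> complex" where
  "radial f r = f (of_real r)"

definition extend :: "int \<Rightarrow> (real \<Rightarrow> complex) \<Rightarrow> complex \<Rightarrow> complex" where
  "extend l g x = g (cmod x) * ang l x"

definition L2_equiv :: "int \<Rightarrow> (complex \<Rightarrow> complex) \<Rightarrow> bool" where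
  "L2_equiv l f \<longleftrightarrow> equivariant l f \<and> in_L2 f"

definition Hs_equiv :: "real \<Rightarrow> int \<Rightarrow> (complex \<Rightarrow> complex) \<Rightarrow> bool" where
  "Hs_equiv s l f \<longleftrightarrow> equivariant l f \<and> in_Hs s f"

definition smooth_on :: "real set \<Rightarrow> (real \<Rightarrow> real) \<Rightarrow> bool" where
  "smooth_on S f \<longleftrightarrow> (\<forall>n. \<forall>x\<in>S. ((deriv ^^ n) f) differentiable (at x))"

definition test_function_pos :: "(real \<Rightarrow> real) \<Rightarrow> bool" where
  "test_function_pos \<psi> \<longleftrightarrow> smooth_on UNIV \<psi> \<and>
     (\<exists>a b. 0 < a \<and> a < b \<and> (\<forall>r. r \<notin> {a..b} \<longrightarrow> \<psi> r = 0))"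

definition locally_integrable_pos :: "(real \<Rightarrow> complex) \<Rightarrow> bool" where
  "locally_integrable_pos g \<longleftrightarrow> (\<forall>a b. 0 < a \<and> a < b \<longrightarrow> set_integrable lborel {a..b} g)"

text \<open>\<open>h\<close> is the weak derivative of \<open>g\<close> on \<open>(0, \<infinity>)\<close>.\<close>

definition has_weak_deriv_pos :: "(real \<Rightarrow> complex) \<Rightarrow> (real \<Rightarrow> complex) \<Rightarrow> bool" where
  "has_weak_deriv_pos g h \<longleftrightarrow>
     g \<in> borel_measurable borel \<and> h \<in> borel_measurable borel \<and>
     locally_integrable_pos g \<and> locally_integrable_pos h \<and>
     (\<forall>\<psi>. test_function_pos \<psi> \<longrightarrow>
        (LINT r:{0<..}|lborel. of_real (deriv \<psi> r) * g r) =
        - (LINT r:{0<..}|lborel. of_real (\<psi> r) * h r))"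

definition radial_deriv :: "(complex \<Rightarrow> complex) \<Rightarrow> complex \<Rightarrow> complex" where
  "radial_deriv f x = (SOME h. has_weak_deriv_pos (radial f) h) (cmod x)"

definition Hdot1_equiv :: "int \<Rightarrow> (complex \<Rightarrow> complex) \<Rightarrow> bool" where
  "Hdot1_equiv l f \<longleftrightarrow> equivariant l f \<and> f \<in> borel_measurable borel \<and>
     (\<exists>h. has_weak_deriv_pos (radial f) h) \<and> in_L2 (radial_deriv f) \<and>
     (l \<noteq> 0 \<longrightarrow> in_L2 (\<lambda>x. f x / of_real (cmod x)))"

text \<open>
  Only the modulus of \<open>\<partial>\<^sub>r f\<close> enters the norm, so the phase \<open>e\<^sup>i\<^sup>l\<^sup>\<theta>\<close> is omitted in
  \<^const>\<open>radial_deriv\<close>.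
\<close>

definition Hdot1_norm :: "int \<Rightarrow> (complex \<Rightarrow> complex) \<Rightarrow> real" where
  "Hdot1_norm l f = sqrt ((L2_norm (radial_deriv f))\<^sup>2 +
     (of_int l)\<^sup>2 * (L2_norm (\<lambda>x. f x / of_real (cmod x)))\<^sup>2)"

section \<open>The Chern--Simons--Schroedinger equation\<close>

definition A_theta :: "(real \<Rightarrow> 'a::real_normed_vector) \<Rightarrow> real \<Rightarrow> real" where
  "A_theta g r = - (1/2) * (LINT s:{0..r}|lborel. (norm (g s))\<^sup>2 * s)"

definition A_0 :: "int \<Rightarrow> (real \<Rightarrow> complex) \<Rightarrow> real \<Rightarrow> real" where
  "A_0 l g r = - (LINT s:{r..}|lborel. (of_int l + A_theta g s) * (cmod (g s))\<^sup>2 / s)"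

text \<open>
  On \<open>l\<close>-equivariant functions \<open>\<partial>\<^sub>r\<^sub>r + \<partial>\<^sub>r/r - l\<^sup>2/r\<^sup>2\<close> is the Laplacian of the plane, so the equation
  is \<open>i \<partial>\<^sub>t u + \<Delta> u = CSS_nonlin l u\<close>.
\<close>

definition CSS_nonlin :: "int \<Rightarrow> (complex \<Rightarrow> complex) \<Rightarrow> complex \<Rightarrow> complex" where
  "CSS_nonlin l u x = (let r = cmod x; A = A_theta (radial u) r in
     of_real (- (cmod (u x))\<^sup>2 + 2 * of_int l / r\<^sup>2 * A + A\<^sup>2 / r\<^sup>2 + A_0 l (radial u) r) * u x)"

text \<open>
  \<open>G\<close> is the \<open>L\<^sup>2\<close>-valued integral of \<open>F\<close> from \<open>a\<close> to \<open>b\<close> (oriented, also for \<open>b < a\<close>), tested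
  against all elements of \<open>L\<^sup>2\<close>.  For continuous \<open>L\<^sup>2\<close>-valued integrands, such as the ones in
  the Duhamel formula of an \<open>H\<^sup>1\<close> solution, this is the Riemann or Bochner integral.
\<close>

definition has_L2_integral ::
    "(real \<Rightarrow> complex \<Rightarrow> complex) \<Rightarrow> real \<Rightarrow> real \<Rightarrow> (complex \<Rightarrow> complex) \<Rightarrow> bool" where
  "has_L2_integral F a b G \<longleftrightarrow>
     (\<forall>s\<in>closed_segment a b. in_L2 (F s)) \<and> in_L2 G \<and>
     (\<forall>\<psi>. in_L2 \<psi> \<longrightarrow>
        interval_lebesgue_integrable lborel (ereal a) (ereal b) (\<lambda>s. L2_inner (F s) \<psi>) \<and>
        L2_inner G \<psi> = (LBINT s=ereal a..ereal b. L2_inner (F s) \<psi>))"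

text \<open>\<open>H\<^sup>1\<close> solutions on an interval \<open>I\<close>: elements of \<open>C(I; H\<^sup>1\<^sub>l)\<close> satisfying the Duhamel formula.\<close>

definition CSS_solution :: "int \<Rightarrow> real set \<Rightarrow> (real \<Rightarrow> complex \<Rightarrow> complex) \<Rightarrow> bool" where
  "CSS_solution l I u \<longleftrightarrow>
     (\<forall>t\<in>I. Hs_equiv 1 l (u t)) \<and>
     (\<forall>t\<^sub>0\<in>I. ((\<lambda>t. Hs_norm 1 (\<lambda>x. u t x - u t\<^sub>0 x)) \<longlongrightarrow> 0) (at t\<^sub>0 within I)) \<and>
     (\<forall>t\<^sub>0\<in>I. \<forall>t\<in>I. \<exists>G.
        has_L2_integral (\<lambda>s. free_evol (t - s) (CSS_nonlin l (u s))) t\<^sub>0 t G \<and>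
        (AE x in lborel. u t x = free_evol (t - t\<^sub>0) (u t\<^sub>0) x - \<i> * G x))"

definition scatters :: "real filter \<Rightarrow> int \<Rightarrow> (real \<Rightarrow> complex \<Rightarrow> complex) \<Rightarrow> bool" where
  "scatters \<F> l v \<longleftrightarrow> (\<forall>\<^sub>F t in \<F>. L2_equiv l (v t)) \<and>
     (\<exists>\<phi>. L2_equiv l \<phi> \<and> ((\<lambda>t. L2_norm (\<lambda>x. v t x - free_evol t \<phi> x)) \<longlongrightarrow> 0) \<F>)"

abbreviation scatters_forward :: "int \<Rightarrow> (real \<Rightarrow> complex \<Rightarrow> complex) \<Rightarrow> bool" where
  "scatters_forward \<equiv> scatters at_top"

abbreviation scatters_backward :: "int \<Rightarrow> (real \<Rightarrow> complex \<Rightarrow> complex) \<Rightarrow> bool" where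
  "scatters_backward \<equiv> scatters at_bot"

text \<open>Meaningful for \<open>t > 0\<close> only.\<close>

definition pseudoconf :: "(real \<Rightarrow> complex \<Rightarrow> complex) \<Rightarrow> real \<Rightarrow> complex \<Rightarrow> complex" where
  "pseudoconf v t x = of_real (1 / t) * cis ((cmod x)\<^sup>2 / (4 * t)) * v (- 1 / t) (x / of_real t)"

section \<open>The soliton and its modified profiles\<close>

definition Q_rad :: "nat \<Rightarrow> real \<Rightarrow> real" where
  "Q_rad m r = sqrt 8 * (real m + 1) * (r ^ m / (1 + r ^ (2 * (m + 1))))"

definition Q :: "nat \<Rightarrow> complex \<Rightarrow> complex" where
  "Q m = extend (int m) (\<lambda>r. of_real (Q_rad m r))"

text \<open>\<open>q\<close> restricted to \<open>(0, \<infinity>)\<close> is the profile \<open>Q\<^sup>(\<^sup>\<eta>\<^sup>)\<close>.\<close>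

definition is_Q_eta :: "nat \<Rightarrow> real \<Rightarrow> (real \<Rightarrow> real) \<Rightarrow> bool" where
  "is_Q_eta m \<eta> q \<longleftrightarrow> smooth_on {0<..} q \<and>
     (\<forall>r>0. deriv q r - (real m + A_theta q r) / r * q r = - (\<eta> / 2) * r * q r) \<and>
     ((\<lambda>r. q r / Q_rad m r) \<longlongrightarrow> 1) (at_right 0)"

text \<open>The function \<open>f\<^sub>b(y) = f(y) exp(-ib|y|\<^sup>2/4)\<close>.\<close>

definition pc_phase :: "real \<Rightarrow> (complex \<Rightarrow> complex) \<Rightarrow> complex \<Rightarrow> complex" where
  "pc_phase b f y = f y * cis (- b * (cmod y)\<^sup>2 / 4)"

definition theta_cor :: "nat \<Rightarrow> (real \<Rightarrow> complex \<Rightarrow> complex) \<Rightarrow> real \<Rightarrow> real" where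
  "theta_cor m z t = - (LINT r:{0<..}|lborel.
     (- real m - 2 + A_theta (radial (z t)) r) * (cmod (radial (z t) r))\<^sup>2 / r)"

definition gamma_cor :: "nat \<Rightarrow> (real \<Rightarrow> complex \<Rightarrow> complex) \<Rightarrow> real \<Rightarrow> real" where
  "gamma_cor m z t = - (LBINT s=ereal 0..ereal t. theta_cor m z s)"

section \<open>The one-parameter family of solutions\<close>

text \<open>
  \<open>u - |t|\<^sup>-\<^sup>1 Q\<^sub>|\<^sub>t\<^sub>|(x/|t|) exp(i \<gamma>\<^sub>c\<^sub>o\<^sub>r) - z\<close> at time \<open>t\<close>.
\<close>

definition blowup_remainder ::
    "nat \<Rightarrow> (real \<Rightarrow> complex \<Rightarrow> complex) \<Rightarrow> (real \<Rightarrow> complex \<Rightarrow> complex) \<Rightarrow>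
     real \<Rightarrow> complex \<Rightarrow> complex" where
  "blowup_remainder m z u t x = u t x
     - of_real (1 / \<bar>t\<bar>) * pc_phase \<bar>t\<bar> (Q m) (x / of_real \<bar>t\<bar>) * cis (gamma_cor m z t)
     - z t x"

text \<open>\<open>u - \<langle>t\<rangle>\<^sup>-\<^sup>1 exp(im(\<theta> + \<gamma>)) q\<^sub>-\<^sub>t(r/\<langle>t\<rangle>)\<close> at time \<open>t\<close>, where \<open>\<langle>t\<rangle> = (t\<^sup>2 + \<eta>\<^sup>2)\<^sup>1\<^sup>/\<^sup>2\<close>.\<close>

definition rotation_remainder ::
    "nat \<Rightarrow> real \<Rightarrow> (real \<Rightarrow> real) \<Rightarrow> (real \<Rightarrow> real) \<Rightarrow> (real \<Rightarrow> complex \<Rightarrow> complex) \<Rightarrow>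
     real \<Rightarrow> complex \<Rightarrow> complex" where
  "rotation_remainder m \<eta> q \<gamma> u t x = (let d = sqrt (t\<^sup>2 + \<eta>\<^sup>2) in u t x
     - cis (real m * \<gamma> t) / of_real d *
       pc_phase (- t) (extend (int m) (\<lambda>r. of_real (q r))) (x / of_real d))"

text \<open>
  \<open>C\<close> is the implicit constant in all the bounds, \<open>\<alpha>\<close> the smallness parameter, \<open>\<eta>s\<close> the upper end
  of the parameter interval.
\<close>

definition CSS_family ::
    "nat \<Rightarrow> real \<Rightarrow> real \<Rightarrow> real \<Rightarrow> (real \<Rightarrow> complex \<Rightarrow> complex) \<Rightarrow>
     (real \<Rightarrow> real \<Rightarrow> complex \<Rightarrow> complex) \<Rightarrow> bool" where
  "CSS_family m C \<alpha> \<eta>s z u \<longleftrightarrow>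
     \<comment> \<open>the blow-up solution\<close>
     CSS_solution (int m) {..<0} (u 0) \<and>
     (\<forall>\<^sub>F t in at_left 0.
        Hdot1_equiv (int m) (blowup_remainder m z (u 0) t) \<and>
        Hdot1_norm (int m) (blowup_remainder m z (u 0) t) \<le> C * \<alpha> * \<bar>t\<bar> ^ m \<and>
        L2_equiv (int m) (blowup_remainder m z (u 0) t) \<and>
        L2_norm (blowup_remainder m z (u 0) t) \<le> C * \<alpha> * \<bar>t\<bar> ^ (m + 1)) \<and>
     \<comment> \<open>the global scattering solutions\<close>
     (\<forall>\<eta>\<in>{0<..\<eta>s}. CSS_solution (int m) UNIV (u \<eta>) \<and>
        scatters_forward (int m) (u \<eta>) \<and> scatters_backward (int m) (u \<eta>)) \<and>
     \<comment> \<open>continuity into \<open>C(J; H\<^sup>s)\<close>\<close>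
     (\<forall>J s. compact J \<and> J \<subseteq> {..<0} \<and> s < 1 \<longrightarrow>
        (\<forall>\<eta>\<^sub>0\<in>{0..\<eta>s}. \<forall>\<epsilon>>0. \<exists>\<delta>>0. \<forall>\<eta>\<in>{0..\<eta>s}. \<bar>\<eta> - \<eta>\<^sub>0\<bar> < \<delta> \<longrightarrow>
           (\<forall>t\<in>J. Hs_norm s (\<lambda>x. u \<eta> t x - u \<eta>\<^sub>0 t x) < \<epsilon>))) \<and>
     \<comment> \<open>rotation near time \<open>0\<close>; the neighbourhood of \<open>0\<close> is the same for all \<open>\<eta>\<close>\<close>
     (\<exists>q \<gamma>. (\<forall>\<eta>\<in>{0..\<eta>s}. is_Q_eta m \<eta> (q \<eta>)) \<and>
        (\<exists>\<tau>\<^sub>0>0. \<forall>\<eta>\<in>{0..\<eta>s}. \<forall>t. \<bar>t\<bar> < \<tau>\<^sub>0 \<and> (\<eta> = 0 \<longrightarrow> t < 0) \<longrightarrow>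
           Hs_equiv 1 (int m) (rotation_remainder m \<eta> (q \<eta>) (\<gamma> \<eta>) (u \<eta>) t) \<and>
           Hs_norm 1 (rotation_remainder m \<eta> (q \<eta>) (\<gamma> \<eta>) (u \<eta>) t) \<le> C * \<alpha>) \<and>
        (\<forall>\<^sub>F \<tau> in at_right 0. \<bar>\<gamma> 0 (- \<tau>)\<bar> \<le> C * \<alpha> * \<tau>) \<and>
        (\<forall>\<^sub>F \<tau> in at_right 0.
           Limsup (at_right 0)
             (\<lambda>\<eta>. ereal \<bar>\<gamma> \<eta> \<tau> - \<gamma> \<eta> (- \<tau>) - (real m + 1) / real m * pi\<bar>)
           \<le> ereal (C * \<alpha> * \<tau>)))"

end

theory Submission
  imports Defs "HOL-Probability.Sinc_Integral"
begin

text \<open>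
  The pseudoconformal transformation turns the behaviour as \<open>t \<rightarrow> \<infinity>\<close> into the behaviour as
  \<open>s = -1/t\<close> tends to \<open>0\<close> from the left, and it is an isometry of \<open>L\<^sup>2\<close> at each time.  The solutions
  \<open>u\<^sup>(\<^sup>\<eta>\<^sup>)\<close>, \<open>\<eta> > 0\<close>, and \<open>z\<close> are continuous at \<open>s = 0\<close>, and the bubble of \<open>u\<^sup>(\<^sup>0\<^sup>)\<close> is mapped to
  \<open>Q exp(i \<gamma>\<^sub>c\<^sub>o\<^sub>r)\<close>, which tends to \<open>Q\<close>.  So both claims reduce to the fact that the transform of a
  profile \<open>w\<close> that does not depend on time is asymptotic in \<open>L\<^sup>2\<close> to a free wave.  On the Fourier side
  the transform of \<open>w\<close>, divided by the free phase \<open>exp(-it|\<xi>|\<^sup>2)\<close>, is the convolution of \<open>w\<close> with a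
  rapidly oscillating Gaussian chirp evaluated at \<open>2\<xi>\<close>; for the indicator of a box it is a product of Fresnel
  integrals, which converges to a constant multiple of the indicator by dominated convergence, and
  Plancherel's theorem together with the density of step functions gives the general case.
  Plancherel's theorem itself is checked on indicators of boxes, where it comes down to
  \<open>\<integral>(1 - cos(ax))/x\<^sup>2 dx = \<pi>|a|\<close>.
\<close>

section \<open>The space of square integrable functions\<close>

text \<open>\<open>fourier\<close> and \<open>free_evol\<close> are values of \<open>SOME\<close>,
  so nothing can be said about them before existence and almost everywhere uniqueness are known; for
  the free evolution, existence amounts to surjectivity of the transform, hence to inversion. A
  second constraint is that the scattering datum has to be \<open>equivariant\<close>, a condition
  at every nonzero point. Representatives are therefore built so that it holds exactly: it is
  carried through L^2 limits, through the transform (by rotation invariance of Lebesgue measure) and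
  through the inverse transform. The point \<open>2\<xi>\<close> comes from completing the square:
  with x = t y, -(x . \<xi>) + |x|^2/(4t) = (t/4)|y - 2\<xi>|^2 - t|\<xi>|^2. The exponent splits
  into coordinates, which makes boxes the natural sets: Plancherel's identity and the chirp
  asymptotics both become products of one-dimensional statements. Density then suffices because all
  maps involved are bounded on L^2 uniformly in t.\<close>

lemma in_L2_measurable [measurable_dest]: "in_L2 f \<Longrightarrow> f \<in> borel_measurable borel"
  by (simp add: in_L2_def)

lemma in_L2_integrable: "in_L2 f \<Longrightarrow> integrable lborel (\<lambda>x. (cmod (f x))\<^sup>2)"
  by (simp add: in_L2_def)

lemma L2_norm_nonneg [simp]: "L2_norm f \<ge> 0"
  by (simp add: L2_norm_def)

lemma L2_norm_sq: "(L2_norm f)\<^sup>2 = (LINT x|lborel. (cmod (f x))\<^sup>2)"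
  by (simp add: L2_norm_def)

lemma in_L2_dominated:
  assumes "in_L2 g" "f \<in> borel_measurable borel" "AE x in lborel. cmod (f x) \<le> B * cmod (g x)"
  shows "in_L2 f"
  unfolding in_L2_def
proof (rule conjI[OF assms(2)], rule Bochner_Integration.integrable_bound)
  show "integrable lborel (\<lambda>x. B\<^sup>2 * (cmod (g x))\<^sup>2)"
    using in_L2_integrable[OF assms(1)] by simp
  show "AE x in lborel. norm ((cmod (f x))\<^sup>2) \<le> norm (B\<^sup>2 * (cmod (g x))\<^sup>2)"
    using assms(3)
  proof eventually_elim
    case (elim x)
    then show ?case using power_mono[OF elim norm_ge_zero, of 2] by (simp add: power_mult_distrib)
  qed
qed (use assms(2) in measurable)

lemma in_L2_add: 
  assumes "in_L2 f" "in_L2 g" shows "in_L2 (\<lambda>x. f x + g x)"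
  unfolding in_L2_def
proof (rule conjI, goal_cases)
  case 1
  show ?case using assms[THEN in_L2_measurable] by measurable
next
  case 2
  show ?case
  proof (rule Bochner_Integration.integrable_bound)
  note [measurable] = in_L2_measurable[OF assms(1)] in_L2_measurable[OF assms(2)]
  show "(\<lambda>x. (cmod (f x + g x))\<^sup>2) \<in> borel_measurable lborel" by measurable
  show "integrable lborel (\<lambda>x. 2 * (cmod (f x))\<^sup>2 + 2 * (cmod (g x))\<^sup>2)"
    using assms[THEN in_L2_integrable] by simp
  have "(cmod (f x + g x))\<^sup>2 \<le> 2 * (cmod (f x))\<^sup>2 + 2 * (cmod (g x))\<^sup>2" for x
  proof -
    have "(cmod (f x + g x))\<^sup>2 \<le> (cmod (f x) + cmod (g x))\<^sup>2"
      by (intro power_mono norm_triangle_ineq) auto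
    also have "\<dots> \<le> 2 * (cmod (f x))\<^sup>2 + 2 * (cmod (g x))\<^sup>2"
      using sum_squares_bound[of "cmod (f x)" "cmod (g x)"] by (simp add: power2_sum)
    finally show ?thesis .
  qed
  then show "AE x in lborel. norm ((cmod (f x + g x))\<^sup>2) \<le> norm (2 * (cmod (f x))\<^sup>2 + 2 * (cmod (g x))\<^sup>2)"
    by simp
qed
qed

lemma in_L2_mult_bounded:
  assumes "in_L2 f" "h \<in> borel_measurable borel" "\<And>x. cmod (h x) \<le> B"
  shows "in_L2 (\<lambda>x. h x * f x)"
  by (rule in_L2_dominated[OF assms(1), where B = B])
    (use assms in_L2_measurable[OF assms(1)] in \<open>auto simp: norm_mult intro!: mult_right_mono\<close>)

lemma in_L2_cmult: "in_L2 f \<Longrightarrow> in_L2 (\<lambda>x. c * f x)"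
  by (rule in_L2_mult_bounded[where B = "cmod c"]) auto

lemma in_L2_diff: "in_L2 f \<Longrightarrow> in_L2 g \<Longrightarrow> in_L2 (\<lambda>x. f x - g x)"
  using in_L2_add[of f "\<lambda>x. (-1) * g x"] in_L2_cmult[of g "-1"] by simp

lemma borel_measurable_cnj [measurable]: "cnj \<in> borel_measurable borel"
  by (intro borel_measurable_continuous_onI continuous_intros)

lemma in_L2_cnj: "in_L2 f \<Longrightarrow> in_L2 (\<lambda>x. cnj (f x))"
  by (rule in_L2_dominated[where B = 1]) (auto dest: in_L2_measurable)

lemma in_L2_zero [simp]: "in_L2 (\<lambda>x. 0)"
  by (simp add: in_L2_def)

lemma in_L2_cong_AE:
  assumes "in_L2 f" "g \<in> borel_measurable borel" "AE x in lborel. f x = g x"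
  shows "in_L2 g"
  by (rule in_L2_dominated[OF assms(1,2), where B = 1]) (use assms(3) in auto)

lemma L2_norm_cong_AE:
  assumes "f \<in> borel_measurable borel" "g \<in> borel_measurable borel" "AE x in lborel. cmod (f x) = cmod (g x)"
  shows "L2_norm f = L2_norm g"
  unfolding L2_norm_def
  by (rule arg_cong[of _ _ sqrt], rule integral_cong_AE) (use assms in auto)

lemma L2_norm_cong: "(\<And>x. cmod (f x) = cmod (g x)) \<Longrightarrow> L2_norm f = L2_norm g"
  by (simp add: L2_norm_def)

lemma L2_norm_cmult: "L2_norm (\<lambda>x. c * f x) = cmod c * L2_norm f"
  by (simp add: L2_norm_def norm_mult power_mult_distrib real_sqrt_mult)

lemma L2_norm_commute: "L2_norm (\<lambda>x. f x - g x) = L2_norm (\<lambda>x. g x - f x)"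
  by (rule L2_norm_cong) (rule norm_minus_commute)

lemma L2_norm_zero [simp]: "L2_norm (\<lambda>x. 0) = 0"
  by (simp add: L2_norm_def)

lemma L2_norm_mono_AE:
  assumes "in_L2 g" "f \<in> borel_measurable borel" "AE x in lborel. cmod (f x) \<le> cmod (g x)"
  shows "L2_norm f \<le> L2_norm g"
proof -
  have "in_L2 f" using in_L2_dominated[OF assms(1,2), where B = 1] assms(3) by simp
  show ?thesis unfolding L2_norm_def
    by (intro real_sqrt_le_mono integral_mono_AE in_L2_integrable \<open>in_L2 f\<close> assms(1))
      (use assms(3) in \<open>eventually_elim, auto intro: power_mono\<close>)
qed

lemma L2_norm_0_imp_AE:
  assumes "in_L2 f" "L2_norm f = 0" shows "AE x in lborel. f x = 0"
proof -
  have "(LINT x|lborel. (cmod (f x))\<^sup>2) = 0" using assms(2) L2_norm_sq[of f] by simp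
  then have "AE x in lborel. (cmod (f x))\<^sup>2 = 0"
    using integral_nonneg_eq_0_iff_AE[OF in_L2_integrable[OF assms(1)]] by simp
  then show ?thesis by simp
qed

lemma ennreal_L2_norm_sq:
  assumes "in_L2 f" shows "(\<integral>\<^sup>+x. ennreal ((cmod (f x))\<^sup>2) \<partial>lborel) = ennreal ((L2_norm f)\<^sup>2)"
  unfolding L2_norm_sq by (rule nn_integral_eq_integral[OF in_L2_integrable[OF assms]]) simp

lemma in_L2_iff_nn:
  "in_L2 f \<longleftrightarrow> f \<in> borel_measurable borel \<and> (\<integral>\<^sup>+x. ennreal ((cmod (f x))\<^sup>2) \<partial>lborel) < \<infinity>"
  unfolding in_L2_def integrable_iff_bounded by auto

section \<open>Cauchy-Schwarz, the triangle inequality and limits in L^2\<close>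

lemma L2_mult_integrable:
  assumes "in_L2 f" "in_L2 g" shows "integrable lborel (\<lambda>x. f x * g x)"
proof (rule Bochner_Integration.integrable_bound)
  note [measurable] = in_L2_measurable[OF assms(1)] in_L2_measurable[OF assms(2)]
  show "integrable lborel (\<lambda>x. (cmod (f x))\<^sup>2 + (cmod (g x))\<^sup>2)"
    using assms[THEN in_L2_integrable] by simp
  show "AE x in lborel. norm (f x * g x) \<le> norm ((cmod (f x))\<^sup>2 + (cmod (g x))\<^sup>2)"
  proof (rule AE_I2)
    fix x
    have "2 * cmod (f x) * cmod (g x) \<le> (cmod (f x))\<^sup>2 + (cmod (g x))\<^sup>2" "0 \<le> cmod (f x) * cmod (g x)"
      using sum_squares_bound[of "cmod (f x)" "cmod (g x)"] by auto
    then have "cmod (f x) * cmod (g x) \<le> (cmod (f x))\<^sup>2 + (cmod (g x))\<^sup>2" by linarith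
    then show "norm (f x * g x) \<le> norm ((cmod (f x))\<^sup>2 + (cmod (g x))\<^sup>2)" by (simp add: norm_mult)
  qed
qed (use assms[THEN in_L2_measurable] in simp)

lemma L2_cauchy_schwarz:
  assumes "in_L2 f" "in_L2 g"
  shows "(LINT x|lborel. cmod (f x) * cmod (g x)) \<le> L2_norm f * L2_norm g"
proof -
  note [measurable] = in_L2_measurable[OF assms(1)] in_L2_measurable[OF assms(2)]
  have int: "integrable lborel (\<lambda>x. cmod (f x) * cmod (g x))"
    using integrable_norm[OF L2_mult_integrable[OF assms]] by (simp add: norm_mult)
  define I where "I = (LINT x|lborel. cmod (f x) * cmod (g x))"
  have I0: "I \<ge> 0" unfolding I_def by simp
  have "(\<integral>\<^sup>+x. ennreal (cmod (f x)) * ennreal (cmod (g x)) \<partial>lborel) = ennreal I"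
    unfolding I_def by (subst nn_integral_eq_integral[OF int, symmetric]) (auto simp: ennreal_mult)
  then have "(ennreal I)\<^sup>2 \<le> ennreal ((L2_norm f)\<^sup>2) * ennreal ((L2_norm g)\<^sup>2)"
    using Cauchy_Schwarz_nn_integral[of "\<lambda>x. ennreal (cmod (f x))" lborel "\<lambda>x. ennreal (cmod (g x))"]
    by (simp add: ennreal_power ennreal_L2_norm_sq[OF assms(1)] ennreal_L2_norm_sq[OF assms(2)])
  then have "I\<^sup>2 \<le> (L2_norm f * L2_norm g)\<^sup>2"
    using I0 by (simp add: ennreal_power ennreal_mult[symmetric] power_mult_distrib)
  then show ?thesis unfolding I_def[symmetric]
    by (rule power2_le_imp_le) simp
qed

lemma L2_integral_bound:
  assumes "in_L2 f" "in_L2 g"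
  shows "cmod (LINT x|lborel. f x * g x) \<le> L2_norm f * L2_norm g"
  using integral_norm_bound[of lborel "\<lambda>x. f x * g x"] L2_cauchy_schwarz[OF assms]
  by (simp add: norm_mult)

lemma L2_norm_triangle:
  assumes "in_L2 f" "in_L2 g"
  shows "L2_norm (\<lambda>x. f x + g x) \<le> L2_norm f + L2_norm g"
proof (rule power2_le_imp_le)
  have int: "integrable lborel (\<lambda>x. cmod (f x) * cmod (g x))"
    using integrable_norm[OF L2_mult_integrable[OF assms]] by (simp add: norm_mult)
  have "(L2_norm (\<lambda>x. f x + g x))\<^sup>2 \<le>
     (LINT x|lborel. (cmod (f x))\<^sup>2 + (cmod (g x))\<^sup>2 + 2 * (cmod (f x) * cmod (g x)))"
    unfolding L2_norm_sq
  proof (rule integral_mono)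
    show "integrable lborel (\<lambda>x. (cmod (f x + g x))\<^sup>2)"
      by (rule in_L2_integrable[OF in_L2_add[OF assms]])
    show "integrable lborel (\<lambda>x. (cmod (f x))\<^sup>2 + (cmod (g x))\<^sup>2 + 2 * (cmod (f x) * cmod (g x)))"
      using int assms[THEN in_L2_integrable] by simp
    show "(cmod (f x + g x))\<^sup>2 \<le> (cmod (f x))\<^sup>2 + (cmod (g x))\<^sup>2 + 2 * (cmod (f x) * cmod (g x))" for x
      using power_mono[OF norm_triangle_ineq[of "f x" "g x"], of 2] by (simp add: power2_sum algebra_simps)
  qed
  also have "\<dots> = (L2_norm f)\<^sup>2 + (L2_norm g)\<^sup>2 + 2 * (LINT x|lborel. cmod (f x) * cmod (g x))"
    using int assms[THEN in_L2_integrable] by (simp add: L2_norm_sq)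
  also have "\<dots> \<le> (L2_norm f + L2_norm g)\<^sup>2"
    using L2_cauchy_schwarz[OF assms] by (simp add: power2_sum)
  finally show "(L2_norm (\<lambda>x. f x + g x))\<^sup>2 \<le> (L2_norm f + L2_norm g)\<^sup>2" .
qed simp

lemma L2_norm_triangle_diff:
  assumes "in_L2 f" "in_L2 g" "in_L2 h"
  shows "L2_norm (\<lambda>x. f x - h x) \<le> L2_norm (\<lambda>x. f x - g x) + L2_norm (\<lambda>x. g x - h x)"
  using L2_norm_triangle[OF in_L2_diff[OF assms(1,2)] in_L2_diff[OF assms(2,3)]] by simp

lemma L2_norm_le_diff:
  assumes "in_L2 f" "in_L2 g"
  shows "L2_norm f \<le> L2_norm (\<lambda>x. f x - g x) + L2_norm g"
  using L2_norm_triangle_diff[OF assms in_L2_zero] by simp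

lemma L2_norm_tendsto:
  assumes "\<forall>\<^sub>F n in F. in_L2 (f n)" "in_L2 g" "((\<lambda>n. L2_norm (\<lambda>x. f n x - g x)) \<longlongrightarrow> 0) F"
  shows "((\<lambda>n. L2_norm (f n)) \<longlongrightarrow> L2_norm g) F"
proof -
  have "((\<lambda>n. L2_norm (f n) - L2_norm g) \<longlongrightarrow> 0) F"
  proof (rule Lim_null_comparison[OF _ assms(3)])
    show "\<forall>\<^sub>F n in F. norm (L2_norm (f n) - L2_norm g) \<le> L2_norm (\<lambda>x. f n x - g x)"
      using assms(1)
    proof eventually_elim
      case (elim n)
      then show ?case using L2_norm_le_diff[OF elim assms(2)] L2_norm_le_diff[OF assms(2) elim]
        by (simp add: L2_norm_commute[of g] abs_le_iff)
    qed
  qed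
  then show ?thesis by (simp add: LIM_zero_iff)
qed

lemma L2_tendsto_unique:
  assumes "F \<noteq> bot" "\<forall>\<^sub>F n in F. in_L2 (f n)" "in_L2 g" "in_L2 h"
    and "((\<lambda>n. L2_norm (\<lambda>x. f n x - g x)) \<longlongrightarrow> 0) F" "((\<lambda>n. L2_norm (\<lambda>x. f n x - h x)) \<longlongrightarrow> 0) F"
  shows "AE x in lborel. g x = h x"
proof -
  have "((\<lambda>n. L2_norm (\<lambda>x. f n x - g x) + L2_norm (\<lambda>x. f n x - h x)) \<longlongrightarrow> 0 + 0) F"
    by (intro tendsto_add assms)
  moreover have "\<forall>\<^sub>F n in F. L2_norm (\<lambda>x. g x - h x) \<le> L2_norm (\<lambda>x. f n x - g x) + L2_norm (\<lambda>x. f n x - h x)"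
    using assms(2)
  proof eventually_elim
    case (elim n)
    then show ?case
      using L2_norm_triangle_diff[OF assms(3) elim assms(4)] by (simp add: L2_norm_commute[of g])
  qed
  ultimately have "L2_norm (\<lambda>x. g x - h x) \<le> 0"
    using tendsto_le[OF assms(1) _ tendsto_const] by fastforce
  then have "L2_norm (\<lambda>x. g x - h x) = 0" using L2_norm_nonneg[of "\<lambda>x. g x - h x"] by linarith
  from L2_norm_0_imp_AE[OF in_L2_diff[OF assms(3,4)] this] show ?thesis by simp
qed

text \<open>Serves to turn a Cauchy estimate into an estimate against a pointwise limit, at a stage
  where that limit is not yet known to be square integrable.\<close>

lemma L2_Fatou:
  assumes "\<And>n. in_L2 (f n)" "g \<in> borel_measurable borel" "AE x in lborel. (\<lambda>n. f n x) \<longlonglongrightarrow> g x"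
    and "\<forall>\<^sub>F n in sequentially. L2_norm (f n) \<le> B"
  shows "in_L2 g" "L2_norm g \<le> B"
proof -
  note [measurable] = in_L2_measurable[OF assms(1)] assms(2)
  have B: "B \<ge> 0" using eventually_happens[OF assms(4)] order_trans[OF L2_norm_nonneg] by auto
  have "(\<integral>\<^sup>+x. ennreal ((cmod (g x))\<^sup>2) \<partial>lborel) = (\<integral>\<^sup>+x. liminf (\<lambda>n. ennreal ((cmod (f n x))\<^sup>2)) \<partial>lborel)"
  proof (rule nn_integral_cong_AE)
    show "AE x in lborel. ennreal ((cmod (g x))\<^sup>2) = liminf (\<lambda>n. ennreal ((cmod (f n x))\<^sup>2))"
      using assms(3)
    proof eventually_elim
      case (elim x)
      have "(\<lambda>n. ennreal ((cmod (f n x))\<^sup>2)) \<longlonglongrightarrow> ennreal ((cmod (g x))\<^sup>2)"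
        by (intro tendsto_ennrealI tendsto_intros elim)
      then show ?case using lim_imp_Liminf by (metis sequentially_bot)
    qed
  qed
  also have "\<dots> \<le> liminf (\<lambda>n. \<integral>\<^sup>+x. ennreal ((cmod (f n x))\<^sup>2) \<partial>lborel)"
    by (rule nn_integral_liminf) measurable
  also have "\<dots> \<le> liminf (\<lambda>n::nat. ennreal (B\<^sup>2))"
  proof (rule Liminf_mono)
    show "\<forall>\<^sub>F n in sequentially. (\<integral>\<^sup>+x. ennreal ((cmod (f n x))\<^sup>2) \<partial>lborel) \<le> ennreal (B\<^sup>2)"
      using assms(4) by eventually_elim
        (simp add: ennreal_L2_norm_sq[OF assms(1)] ennreal_leI power_mono)
  qed
  also have "\<dots> = ennreal (B\<^sup>2)" by (simp add: Liminf_const)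
  finally have le: "(\<integral>\<^sup>+x. ennreal ((cmod (g x))\<^sup>2) \<partial>lborel) \<le> ennreal (B\<^sup>2)" .
  then show g: "in_L2 g" unfolding in_L2_iff_nn using assms(2) by (simp add: order_le_less_trans)
  show "L2_norm g \<le> B"
    using le B by (simp add: ennreal_L2_norm_sq[OF g] power_mono_iff)
qed

lemma L2_dominated_convergence:
  fixes f :: "nat \<Rightarrow> complex \<Rightarrow> complex"
  assumes "\<And>n. f n \<in> borel_measurable borel" "g \<in> borel_measurable borel" "in_L2 h"
    and "AE x in lborel. (\<lambda>n. f n x) \<longlonglongrightarrow> g x" "\<And>n. AE x in lborel. cmod (f n x) \<le> cmod (h x)"
  shows "(\<lambda>n. L2_norm (\<lambda>x. f n x - g x)) \<longlonglongrightarrow> 0"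
proof -
  note [measurable] = assms(1,2) in_L2_measurable[OF assms(3)]
  have g: "AE x in lborel. cmod (g x) \<le> cmod (h x)"
  proof -
    have "AE x in lborel. \<forall>n. cmod (f n x) \<le> cmod (h x)" using assms(5) by (simp add: AE_all_countable)
    with assms(4) show ?thesis
    proof eventually_elim
      case (elim x)
      then show ?case by (intro Lim_bounded[OF tendsto_norm[OF elim(1)], where M = 0]) auto
    qed
  qed
  have "(\<lambda>n. LINT x|lborel. (cmod (f n x - g x))\<^sup>2) \<longlonglongrightarrow> (LINT x::complex|lborel. 0)"
  proof (rule integral_dominated_convergence)
    \<comment> \<open>The limit g obeys the same bound |h| as the sequence, so |f_n - g|^2 is at
      most (2|h|)^2.\<close>
    show "integrable lborel (\<lambda>x. 4 * (cmod (h x))\<^sup>2)" using in_L2_integrable[OF assms(3)] by simp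
    show "AE x in lborel. (\<lambda>n. (cmod (f n x - g x))\<^sup>2) \<longlonglongrightarrow> 0"
      using assms(4)
    proof eventually_elim
      case (elim x)
      have "(\<lambda>n. (cmod (f n x - g x))\<^sup>2) \<longlonglongrightarrow> (cmod (g x - g x))\<^sup>2" by (intro tendsto_intros elim)
      then show ?case by simp
    qed
    show "AE x in lborel. norm ((cmod (f n x - g x))\<^sup>2) \<le> 4 * (cmod (h x))\<^sup>2" for n
      using assms(5)[of n] g
    proof eventually_elim
      case (elim x)
      have "cmod (f n x - g x) \<le> 2 * cmod (h x)"
        using elim norm_triangle_ineq4[of "f n x" "g x"] by linarith
      from power_mono[OF this, of 2] show ?case by (simp add: power_mult_distrib)
    qed
  qed measurable
  then have "(\<lambda>n. sqrt (LINT x|lborel. (cmod (f n x - g x))\<^sup>2)) \<longlonglongrightarrow> sqrt 0"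
    by (intro tendsto_real_sqrt) simp
  then show ?thesis by (simp add: L2_norm_def)
qed

section \<open>Angular factors and completeness\<close>

lemma sgn_complex_of_real_pos [simp]: "r > 0 \<Longrightarrow> sgn (complex_of_real r) = 1"
  by (simp add: sgn_eq)

lemma ang_of_cmod [simp]: "x \<noteq> 0 \<Longrightarrow> ang l (complex_of_real (cmod x)) = 1"
  by (simp add: ang_def)

lemma cmod_ang: "x \<noteq> 0 \<Longrightarrow> cmod (ang l x) = 1"
  by (simp add: ang_def norm_power_int norm_sgn)

lemma ang_nonzero: "x \<noteq> 0 \<Longrightarrow> ang l x \<noteq> 0"
  using cmod_ang[of x l] by auto

lemma equivariant_iff: "equivariant l f \<longleftrightarrow> (\<forall>x. x \<noteq> 0 \<longrightarrow> f x = f (of_real (cmod x)) * ang l x)"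
proof
  assume "equivariant l f"
  then obtain g where g: "\<And>x. x \<noteq> 0 \<Longrightarrow> f x = g (cmod x) * ang l x" unfolding equivariant_def by blast
  show "\<forall>x. x \<noteq> 0 \<longrightarrow> f x = f (of_real (cmod x)) * ang l x"
  proof (intro allI impI)
    fix x :: complex assume "x \<noteq> 0"
    then show "f x = f (of_real (cmod x)) * ang l x"
      using g[of x] g[of "of_real (cmod x)"] by simp
  qed
qed (unfold equivariant_def, rule exI[of _ "\<lambda>r. f (of_real r)"])

text \<open>A subsequence with geometrically small increments converges almost everywhere, and Fatou
  compares its limit with the whole sequence. Equivariance survives because the limit is taken
  pointwise, with value 0 where the subsequence diverges: for equivariant terms, convergence at x
  and at |x| are equivalent.\<close>

lemma L2_complete:
  assumes f: "\<And>n. in_L2 (f n)"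
    and Cauchy: "\<And>\<epsilon>. \<epsilon> > 0 \<Longrightarrow> \<exists>N. \<forall>m\<ge>N. \<forall>n\<ge>N. L2_norm (\<lambda>x. f m x - f n x) < \<epsilon>"
  obtains g where "in_L2 g" "(\<lambda>n. L2_norm (\<lambda>x. f n x - g x)) \<longlonglongrightarrow> 0"
    "\<And>l. (\<And>n. equivariant l (f n)) \<Longrightarrow> equivariant l g"
proof -
  note [measurable] = in_L2_measurable[OF f]
  \<comment> \<open>The rate 1/4 leaves room for a weight: \<open>4^k\<close> times the squared norm
    of the k-th increment is at most \<open>(1/4)^k\<close>, still summable, and finiteness of the
    weighted sum of squares at a point bounds the increments there by a multiple of
    \<open>(1/2)^k\<close>.\<close>
  have "\<exists>r. \<forall>k. (\<forall>m\<ge>r k. \<forall>n\<ge>r k. L2_norm (\<lambda>x. f m x - f n x) < (1/4)^k) \<and> r k < r (Suc k)"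
  proof (rule dependent_nat_choice)
    show "\<exists>N. \<forall>m\<ge>N. \<forall>n\<ge>N. L2_norm (\<lambda>x. f m x - f n x) < (1/4)^0"
      using Cauchy[of 1] by simp
    fix N k
    obtain N' where N': "\<forall>m\<ge>N'. \<forall>n\<ge>N'. L2_norm (\<lambda>x. f m x - f n x) < (1/4)^(Suc k)"
      using Cauchy[of "(1/4)^(Suc k)"] by auto
    show "\<exists>y. (\<forall>m\<ge>y. \<forall>n\<ge>y. L2_norm (\<lambda>x. f m x - f n x) < (1/4)^(Suc k)) \<and> N < y"
      by (rule exI[of _ "max N' (Suc N)"]) (use N' in auto)
  qed
  then obtain r where r: "\<And>k m n. m \<ge> r k \<Longrightarrow> n \<ge> r k \<Longrightarrow> L2_norm (\<lambda>x. f m x - f n x) < (1/4)^k"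
    and "\<And>k. r k < r (Suc k)" by blast
  then have sm: "strict_mono r" by (simp add: strict_mono_Suc_iff)
  define d where "d k x = f (r (Suc k)) x - f (r k) x" for k x
  have d: "in_L2 (d k)" for k unfolding d_def by (intro in_L2_diff f)
  have dk: "L2_norm (d k) \<le> (1/4)^k" for k
    unfolding d_def using r[where k = k and m = "r (Suc k)" and n = "r k"] sm by (auto simp: strict_mono_Suc_iff less_imp_le)
  note [measurable] = in_L2_measurable[OF d]
  have "(\<integral>\<^sup>+x. (\<Sum>k. ennreal (4^k * (cmod (d k x))\<^sup>2)) \<partial>lborel) = (\<Sum>k. \<integral>\<^sup>+x. ennreal (4^k * (cmod (d k x))\<^sup>2) \<partial>lborel)"
    by (rule nn_integral_suminf) measurable
  also have "\<dots> = (\<Sum>k. ennreal (4^k * (L2_norm (d k))\<^sup>2))"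
    by (simp add: ennreal_mult nn_integral_cmult ennreal_L2_norm_sq[OF d])
  also have "\<dots> \<le> (\<Sum>k. ennreal ((1/4)^k))"
  proof (intro suminf_le ennreal_leI)
    fix k
    have "4^k * (L2_norm (d k))\<^sup>2 \<le> 4^k * ((1/4)^k)\<^sup>2"
      by (intro mult_left_mono power_mono dk) auto
    also have "\<dots> = (1/4::real)^k" by (simp add: power2_eq_square power_divide)
    finally show "4^k * (L2_norm (d k))\<^sup>2 \<le> (1/4)^k" .
  qed auto
  also have "\<dots> < \<infinity>"
    by (subst suminf_ennreal2) (auto intro: summable_geometric)
  finally have "AE x in lborel. (\<Sum>k. ennreal (4^k * (cmod (d k x))\<^sup>2)) \<noteq> \<infinity>"
    by (intro nn_integral_noteq_infinite) auto
  then have conv: "AE x in lborel. convergent (\<lambda>k. f (r k) x)"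
  proof eventually_elim
    case (elim x)
    have "\<exists>M\<ge>0. S = ennreal M" if "S \<noteq> \<infinity>" for S :: ennreal
      using that by (cases S) auto
    from this[OF elim] obtain M where M: "(\<Sum>k. ennreal (4^k * (cmod (d k x))\<^sup>2)) = ennreal M" "M \<ge> 0"
      by blast
    have bd: "cmod (d k x) \<le> sqrt M * (1/2)^k" for k
    proof (rule power2_le_imp_le)
      have "ennreal (4^k * (cmod (d k x))\<^sup>2) \<le> ennreal M"
        using sum_le_suminf[of "\<lambda>k. ennreal (4^k * (cmod (d k x))\<^sup>2)" "{k}"]
        unfolding M(1) by simp
      then have "4^k * (cmod (d k x))\<^sup>2 \<le> M" using M(2) by simp
      then show "(cmod (d k x))\<^sup>2 \<le> (sqrt M * (1/2)^k)\<^sup>2"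
        using M(2) power_mult[of "2::real" 2 k] power_mult[of "2::real" k 2]
        by (simp add: power_mult_distrib power_divide field_simps)
    qed (use M in auto)
    have "summable (\<lambda>k. d k x)"
      by (rule summable_comparison_test'[where N = 0 and g = "\<lambda>k. sqrt M * (1/2)^k"])
        (auto intro!: summable_mult summable_geometric bd)
    then have "convergent (\<lambda>n. \<Sum>k<n. d k x)" by (simp add: summable_iff_convergent)
    then have "convergent (\<lambda>n. (f (r n) x - f (r 0) x) + f (r 0) x)"
      unfolding d_def sum_lessThan_telescope[where f = "\<lambda>k. f (r k) x"]
      by (intro convergent_add convergent_const)
    then show ?case by simp
  qed
  define g where "g x = (if convergent (\<lambda>k. f (r k) x) then lim (\<lambda>k. f (r k) x) else 0)" for x
  have [measurable]: "g \<in> borel_measurable borel"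
    unfolding g_def Cauchy_convergent_iff[symmetric] by measurable
  have conv': "AE x in lborel. (\<lambda>k. f (r k) x) \<longlonglongrightarrow> g x"
    using conv by eventually_elim (simp add: g_def convergent_LIMSEQ_iff)
  have fat: "in_L2 (\<lambda>x. f n x - g x) \<and> L2_norm (\<lambda>x. f n x - g x) \<le> \<epsilon>"
    if N: "\<And>m n. m \<ge> N \<Longrightarrow> n \<ge> N \<Longrightarrow> L2_norm (\<lambda>x. f m x - f n x) < \<epsilon>" "n \<ge> N" for n N \<epsilon>
  proof -
    have 1: "AE x in lborel. (\<lambda>k. f n x - f (r k) x) \<longlonglongrightarrow> f n x - g x"
      using conv' by eventually_elim (intro tendsto_intros)
    have 2: "\<forall>\<^sub>F k in sequentially. L2_norm (\<lambda>x. f n x - f (r k) x) \<le> \<epsilon>"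
      using eventually_ge_at_top[of N]
    proof eventually_elim
      case (elim k)
      then show ?case using N(1)[OF N(2), of "r k"] seq_suble[OF sm, of k] by simp
    qed
    show ?thesis
      using L2_Fatou[OF in_L2_diff[OF f f] _ 1 2] by auto
  qed
  have gL2: "in_L2 g"
  proof -
    obtain N where "\<And>m n. m \<ge> N \<Longrightarrow> n \<ge> N \<Longrightarrow> L2_norm (\<lambda>x. f m x - f n x) < 1"
      using Cauchy[of 1] by auto
    from fat[OF this, of N] have "in_L2 (\<lambda>x. f N x - g x)" by auto
    from in_L2_diff[OF f[of N] this] show ?thesis by simp
  qed
  moreover have "(\<lambda>n. L2_norm (\<lambda>x. f n x - g x)) \<longlonglongrightarrow> 0"
  proof (rule LIMSEQ_I)
    fix \<epsilon> :: real assume "\<epsilon> > 0"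
    then obtain N where "\<And>m n. m \<ge> N \<Longrightarrow> n \<ge> N \<Longrightarrow> L2_norm (\<lambda>x. f m x - f n x) < \<epsilon>/2"
      using Cauchy[of "\<epsilon>/2"] by auto
    from fat[OF this] have "L2_norm (\<lambda>x. f n x - g x) < \<epsilon>" if "n \<ge> N" for n
      using \<open>\<epsilon> > 0\<close> that by fastforce
    then show "\<exists>N. \<forall>n\<ge>N. norm (L2_norm (\<lambda>x. f n x - g x) - 0) < \<epsilon>"
      by auto
  qed
  moreover have "equivariant l g" if eq: "\<And>n. equivariant l (f n)" for l
    unfolding equivariant_iff
  proof (intro allI impI)
    fix x :: complex assume x: "x \<noteq> 0"
    let ?y = "complex_of_real (cmod x)"
    have 1: "f n x = f n ?y * ang l x" for n using eq[unfolded equivariant_iff] x by blast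
    then have 2: "f n ?y = f n x * inverse (ang l x)" for n using ang_nonzero[OF x, of l] by simp
    have c: "convergent (\<lambda>k. f (r k) x) \<longleftrightarrow> convergent (\<lambda>k. f (r k) ?y)"
    proof
      assume "convergent (\<lambda>k. f (r k) x)"
      then show "convergent (\<lambda>k. f (r k) ?y)" unfolding 2 by (intro convergent_mult convergent_const)
    next
      assume "convergent (\<lambda>k. f (r k) ?y)"
      then show "convergent (\<lambda>k. f (r k) x)" 
        unfolding 1[of "r _"] by (intro convergent_mult convergent_const)
    qed
    show "g x = g ?y * ang l x"
    proof (cases "convergent (\<lambda>k. f (r k) ?y)")
      case True
      then have "(\<lambda>k. f (r k) ?y * ang l x) \<longlonglongrightarrow> lim (\<lambda>k. f (r k) ?y) * ang l x"
        by (intro tendsto_intros) (simp add: convergent_LIMSEQ_iff)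
      then have "lim (\<lambda>k. f (r k) x) = lim (\<lambda>k. f (r k) ?y) * ang l x"
        unfolding 1[symmetric] by (rule limI)
      then show ?thesis using True c by (simp add: g_def)
    next
      case False
      then show ?thesis using c by (simp add: g_def)
    qed
  qed
  ultimately show ?thesis using that by blast
qed

section \<open>Lebesgue measure on the complex plane\<close>

lemma borel_measurable_Complex [measurable (raw)]:
  assumes [measurable]: "u \<in> borel_measurable M" "v \<in> borel_measurable M"
  shows "(\<lambda>p. Complex (u p) (v p)) \<in> borel_measurable M"
  unfolding Complex_eq by measurable

text \<open>Lebesgue measure is determined by its values on open boxes, so it is enough to compare
  those. This opens Fubini in real and imaginary part.\<close>

lemma lborel_complex: "(lborel :: complex measure) = distr (lborel \<Otimes>\<^sub>M lborel) borel (\<lambda>p. Complex (fst p) (snd p))"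
proof (rule lborel_eqI)
  fix l u :: complex
  assume "\<And>b. b \<in> Basis \<Longrightarrow> l \<bullet> b \<le> u \<bullet> b"
  then have le: "Re l \<le> Re u" "Im l \<le> Im u" by (fastforce simp: Basis_complex_def)+
  have "(\<lambda>p. Complex (fst p) (snd p)) -` box l u \<inter> space (lborel \<Otimes>\<^sub>M lborel) = {Re l<..<Re u} \<times> {Im l<..<Im u}"
    by (auto simp: in_box_complex_iff space_pair_measure)
  then have "emeasure (distr (lborel \<Otimes>\<^sub>M lborel) borel (\<lambda>p. Complex (fst p) (snd p))) (box l u) =
      emeasure (lborel \<Otimes>\<^sub>M lborel) ({Re l<..<Re u} \<times> {Im l<..<Im u})"
    by (subst emeasure_distr) auto
  also have "\<dots> = ennreal (Re u - Re l) * ennreal (Im u - Im l)"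
    using le by (subst lborel.emeasure_pair_measure_Times) auto
  also have "\<dots> = ennreal (\<Prod>b\<in>Basis. (u - l) \<bullet> b)"
    using le by (simp add: Basis_complex_def ennreal_mult)
  finally show "emeasure (distr (lborel \<Otimes>\<^sub>M lborel) borel (\<lambda>p. Complex (fst p) (snd p))) (box l u) =
      ennreal (\<Prod>b\<in>Basis. (u - l) \<bullet> b)" .
qed simp

lemma nn_integral_complex:
  assumes [measurable]: "f \<in> borel_measurable (borel :: complex measure)"
  shows "(\<integral>\<^sup>+z. f z \<partial>lborel) = (\<integral>\<^sup>+x. \<integral>\<^sup>+y. f (Complex x y) \<partial>lborel \<partial>lborel)"
    and "(\<integral>\<^sup>+z. f z \<partial>lborel) = (\<integral>\<^sup>+y. \<integral>\<^sup>+x. f (Complex x y) \<partial>lborel \<partial>lborel)"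
proof -
  have 1: "(\<integral>\<^sup>+z. f z \<partial>lborel) = (\<integral>\<^sup>+p. f (Complex (fst p) (snd p)) \<partial>(lborel \<Otimes>\<^sub>M lborel))"
    by (subst lborel_complex, subst nn_integral_distr) auto
  have 2: "(\<lambda>p. f (Complex (fst p) (snd p))) \<in> borel_measurable (lborel \<Otimes>\<^sub>M lborel)" by measurable
  show "(\<integral>\<^sup>+z. f z \<partial>lborel) = (\<integral>\<^sup>+x. \<integral>\<^sup>+y. f (Complex x y) \<partial>lborel \<partial>lborel)"
    unfolding 1 using lborel.nn_integral_fst[OF 2] by simp
  show "(\<integral>\<^sup>+z. f z \<partial>lborel) = (\<integral>\<^sup>+y. \<integral>\<^sup>+x. f (Complex x y) \<partial>lborel \<partial>lborel)"
    unfolding 1 using lborel_pair.nn_integral_snd[OF 2] by simp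
qed

lemma has_bochner_integral_complex_prod:
  fixes f g :: "real \<Rightarrow> complex"
  assumes f: "integrable lborel f" and g: "integrable lborel g"
  shows "has_bochner_integral lborel (\<lambda>z. f (Re z) * g (Im z)) (integral\<^sup>L lborel f * integral\<^sup>L lborel g)"
proof -
  have [measurable]: "f \<in> borel_measurable borel" "g \<in> borel_measurable borel"
    using f g borel_measurable_integrable by auto
  have i: "integrable (lborel \<Otimes>\<^sub>M lborel) (\<lambda>p. f (fst p) * g (snd p))"
  proof (rule lborel_pair.Fubini_integrable)
    show "integrable lborel (\<lambda>x. LINT y|lborel. norm (f (fst (x, y)) * g (snd (x, y))))"
      using f g by (simp add: norm_mult)
    show "AE x in lborel. integrable lborel (\<lambda>y. f (fst (x, y)) * g (snd (x, y)))"
      using g by simp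
  qed measurable
  have "(LINT p|(lborel \<Otimes>\<^sub>M lborel). f (fst p) * g (snd p)) = integral\<^sup>L lborel f * integral\<^sup>L lborel g"
    using lborel_pair.integral_fst'[OF i] by simp
  with i have "has_bochner_integral (lborel \<Otimes>\<^sub>M lborel) (\<lambda>p. f (fst p) * g (snd p)) (integral\<^sup>L lborel f * integral\<^sup>L lborel g)"
    by (simp add: has_bochner_integral_iff)
  then show ?thesis
    by (subst lborel_complex) (auto simp: has_bochner_integral_iff integrable_distr_eq integral_distr)
qed

text \<open>For Re a \<noteq> 0 the rotation is undone by two affine substitutions in one variable
  each, with an exchange of the order of integration in between; their Jacobians 1/|Re a| and |Re a|
  cancel. For Re a = 0 it is a quarter turn, i.e. an exchange of coordinates and a sign.\<close>

lemma nn_integral_rotate: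
  assumes a: "cmod a = 1" and [measurable]: "f \<in> borel_measurable (borel :: complex measure)"
  shows "(\<integral>\<^sup>+z. f (a * z) \<partial>lborel) = (\<integral>\<^sup>+z. f z \<partial>lborel)"
proof -
  let ?p = "Re a" and ?q = "Im a"
  have pq: "?p\<^sup>2 + ?q\<^sup>2 = 1" using a by (simp add: cmod_def)
  have m2 [measurable]: "(\<lambda>(x, y). f (Complex (u x y) (v x y))) \<in> borel_measurable (borel \<Otimes>\<^sub>M borel)"
    if [measurable]: "(\<lambda>(x, y). u x y) \<in> borel_measurable (borel \<Otimes>\<^sub>M borel)" "(\<lambda>(x, y). v x y) \<in> borel_measurable (borel \<Otimes>\<^sub>M borel)"
    for u v :: "real \<Rightarrow> real \<Rightarrow> real"
    by measurable
  have m1: "(\<lambda>x. f (Complex (u x) (v x))) \<in> borel_measurable borel"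
    if [measurable]: "u \<in> borel_measurable borel" "v \<in> borel_measurable borel" for u v :: "real \<Rightarrow> real"
    by measurable
  have swap: "(\<integral>\<^sup>+y. \<integral>\<^sup>+x. F x y \<partial>lborel \<partial>lborel) = (\<integral>\<^sup>+x. \<integral>\<^sup>+y. F x y \<partial>lborel \<partial>lborel)"
    if "(\<lambda>(x, y). F x y) \<in> borel_measurable (borel \<Otimes>\<^sub>M borel)" for F :: "real \<Rightarrow> real \<Rightarrow> ennreal"
    using lborel_pair.Fubini[of "\<lambda>(x, y). F x y"] that by (simp cong: measurable_cong_sets)
  show ?thesis
  proof (cases "?p = 0")
    case False
    have "(\<integral>\<^sup>+z. f (a * z) \<partial>lborel) = (\<integral>\<^sup>+y. \<integral>\<^sup>+x. f (Complex (?p * x - ?q * y) (?p * y + ?q * x)) \<partial>lborel \<partial>lborel)"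
      by (subst nn_integral_complex(2)) (auto simp: complex_mult complex_eq_iff intro!: nn_integral_cong arg_cong[where f = f])
    also have "\<dots> = (\<integral>\<^sup>+y. ennreal \<bar>1/?p\<bar> * (\<integral>\<^sup>+x. f (Complex x (1/?p * y + ?q / ?p * x)) \<partial>lborel) \<partial>lborel)"
    proof (rule nn_integral_cong)
      fix y
      have "(\<integral>\<^sup>+x. f (Complex (?p * x - ?q * y) (?p * y + ?q * x)) \<partial>lborel) = ennreal \<bar>1/?p\<bar> *
         (\<integral>\<^sup>+x. f (Complex (?p * (?q/?p * y + 1/?p * x) - ?q * y) (?p * y + ?q * (?q/?p * y + 1/?p * x))) \<partial>lborel)"
        by (rule nn_integral_real_affine) (use False in \<open>auto intro!: m1\<close>)
      also have "\<dots> = ennreal \<bar>1/?p\<bar> * (\<integral>\<^sup>+x. f (Complex x (1/?p * y + ?q / ?p * x)) \<partial>lborel)"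
      proof -
        have "?p * y + ?q * (?q / ?p * y + 1 / ?p * x) = (?p\<^sup>2 + ?q\<^sup>2) / ?p * y + ?q / ?p * x" for x
          using False by (simp add: field_simps power2_eq_square)
        then show ?thesis using False unfolding pq by (simp add: field_simps)
      qed
      finally show "(\<integral>\<^sup>+x. f (Complex (?p * x - ?q * y) (?p * y + ?q * x)) \<partial>lborel) = \<dots>" .
    qed
    also have "\<dots> = ennreal \<bar>1/?p\<bar> * (\<integral>\<^sup>+y. \<integral>\<^sup>+x. f (Complex x (1/?p * y + ?q / ?p * x)) \<partial>lborel \<partial>lborel)"
      by (rule nn_integral_cmult) measurable
    also have "(\<integral>\<^sup>+y. \<integral>\<^sup>+x. f (Complex x (1/?p * y + ?q / ?p * x)) \<partial>lborel \<partial>lborel) =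
        (\<integral>\<^sup>+x. \<integral>\<^sup>+y. f (Complex x (1/?p * y + ?q / ?p * x)) \<partial>lborel \<partial>lborel)"
      by (rule swap) measurable
    also have "\<dots> = (\<integral>\<^sup>+x. ennreal \<bar>?p\<bar> * (\<integral>\<^sup>+y. f (Complex x y) \<partial>lborel) \<partial>lborel)"
    proof (rule nn_integral_cong)
      fix x
      have "(\<integral>\<^sup>+y. f (Complex x (1/?p * y + ?q / ?p * x)) \<partial>lborel) = ennreal \<bar>?p\<bar> *
         (\<integral>\<^sup>+y. f (Complex x (1/?p * (- ?q * x + ?p * y) + ?q / ?p * x)) \<partial>lborel)"
        by (rule nn_integral_real_affine) (use False in \<open>auto intro!: m1\<close>)
      also have "\<dots> = ennreal \<bar>?p\<bar> * (\<integral>\<^sup>+y. f (Complex x y) \<partial>lborel)"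
        using False by (simp add: field_simps)
      finally show "(\<integral>\<^sup>+y. f (Complex x (1/?p * y + ?q / ?p * x)) \<partial>lborel) = \<dots>" .
    qed
    also have "\<dots> = ennreal \<bar>?p\<bar> * (\<integral>\<^sup>+z. f z \<partial>lborel)"
      by (subst nn_integral_cmult) (auto simp: nn_integral_complex(1))
    also have "ennreal \<bar>1/?p\<bar> * \<dots> = (\<integral>\<^sup>+z. f z \<partial>lborel)"
      using False by (simp add: mult.assoc[symmetric] ennreal_mult[symmetric] abs_mult[symmetric])
    finally show ?thesis .
  next
    case True
    then have q: "?q \<noteq> 0" "\<bar>?q\<bar> = 1" using pq by (auto simp: power2_eq_1_iff)
    have "(\<integral>\<^sup>+z. f (a * z) \<partial>lborel) = (\<integral>\<^sup>+y. \<integral>\<^sup>+x. f (Complex (- ?q * y) (?q * x)) \<partial>lborel \<partial>lborel)"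
      by (subst nn_integral_complex(2)) (auto simp: True complex_mult complex_eq_iff intro!: nn_integral_cong arg_cong[where f = f])
    also have "\<dots> = (\<integral>\<^sup>+y. \<integral>\<^sup>+x. f (Complex (- ?q * y) x) \<partial>lborel \<partial>lborel)"
    proof (rule nn_integral_cong)
      fix y
      have "(\<integral>\<^sup>+x. f (Complex (- ?q * y) x) \<partial>lborel) = ennreal \<bar>?q\<bar> * (\<integral>\<^sup>+x. f (Complex (- ?q * y) (0 + ?q * x)) \<partial>lborel)"
        by (rule nn_integral_real_affine) (use q in \<open>auto intro!: m1\<close>)
      then show "(\<integral>\<^sup>+x. f (Complex (- ?q * y) (?q * x)) \<partial>lborel) = (\<integral>\<^sup>+x. f (Complex (- ?q * y) x) \<partial>lborel)"
        by (simp add: q)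
    qed
    also have "\<dots> = (\<integral>\<^sup>+y. \<integral>\<^sup>+x. f (Complex y x) \<partial>lborel \<partial>lborel)"
      using nn_integral_real_affine[where c = "- ?q" and t = 0 and f = "\<lambda>y. \<integral>\<^sup>+x. f (Complex y x) \<partial>lborel"] q
      by simp
    also have "\<dots> = (\<integral>\<^sup>+z. f z \<partial>lborel)" by (simp add: nn_integral_complex(1))
    finally show ?thesis .
  qed
qed

lemma lborel_distr_rotate: "cmod a = 1 \<Longrightarrow> distr lborel borel ((*) a) = (lborel :: complex measure)"
proof (rule measure_eqI)
  fix A assume a: "cmod a = 1" and "A \<in> sets (distr lborel borel ((*) a))"
  then have [measurable]: "A \<in> sets borel" by simp
  have "emeasure (distr lborel borel ((*) a)) A = (\<integral>\<^sup>+z. indicator A z \<partial>(distr lborel borel ((*) a)))"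
    by simp
  also have "\<dots> = (\<integral>\<^sup>+z. indicator A (a * z) \<partial>lborel)" by (subst nn_integral_distr) auto
  also have "\<dots> = emeasure lborel A" by (subst nn_integral_rotate[OF a]) auto
  finally show "emeasure (distr lborel borel ((*) a)) A = emeasure lborel A" .
qed simp

lemma integral_rotate:
  fixes f :: "complex \<Rightarrow> complex"
  assumes "cmod a = 1" "f \<in> borel_measurable borel"
  shows "(LINT z|lborel. f (a * z)) = (LINT z|lborel. f z)"
  using integral_distr[of "(*) a" lborel borel f] assms by (simp add: lborel_distr_rotate)

lemma nn_integral_scale:
  assumes "c \<noteq> 0" "f \<in> borel_measurable (borel :: complex measure)"
  shows "(\<integral>\<^sup>+z. f z \<partial>lborel) = ennreal (c\<^sup>2) * (\<integral>\<^sup>+z. f (c *\<^sub>R z) \<partial>lborel)"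
  using assms
  by (subst lborel_affine[of c 0]) (simp_all add: nn_integral_density nn_integral_distr nn_integral_cmult)

lemma integral_scale:
  fixes f :: "complex \<Rightarrow> complex"
  assumes "c \<noteq> 0" "f \<in> borel_measurable borel"
  shows "(LINT z|lborel. f z) = c\<^sup>2 *\<^sub>R (LINT z|lborel. f (c *\<^sub>R z))"
  using assms
  by (subst lborel_affine[of c 0]) (simp_all add: integral_density integral_distr)

lemma L2_scale:
  assumes "in_L2 f" "c \<noteq> 0"
  shows "in_L2 (\<lambda>x. f (c *\<^sub>R x))" "L2_norm f = \<bar>c\<bar> * L2_norm (\<lambda>x. f (c *\<^sub>R x))"
proof -
  note [measurable] = in_L2_measurable[OF assms(1)]
  have m: "(\<lambda>x. f (c *\<^sub>R x)) \<in> borel_measurable borel" by measurable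
  have eq: "(\<integral>\<^sup>+z. ennreal ((cmod (f z))\<^sup>2) \<partial>lborel) = ennreal (c\<^sup>2) * (\<integral>\<^sup>+z. ennreal ((cmod (f (c *\<^sub>R z)))\<^sup>2) \<partial>lborel)"
    by (rule nn_integral_scale) (use assms in measurable)
  then have "(\<integral>\<^sup>+z. ennreal ((cmod (f (c *\<^sub>R z)))\<^sup>2) \<partial>lborel) < \<infinity>"
    using assms(1) \<open>c \<noteq> 0\<close> unfolding in_L2_iff_nn by (auto simp: ennreal_mult_less_top)
  then show 1: "in_L2 (\<lambda>x. f (c *\<^sub>R x))" using m unfolding in_L2_iff_nn by auto
  have "ennreal ((L2_norm f)\<^sup>2) = ennreal (c\<^sup>2 * (L2_norm (\<lambda>x. f (c *\<^sub>R x)))\<^sup>2)"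
    using eq unfolding ennreal_L2_norm_sq[OF assms(1)] ennreal_L2_norm_sq[OF 1] by (simp add: ennreal_mult)
  then have "(L2_norm f)\<^sup>2 = (\<bar>c\<bar> * L2_norm (\<lambda>x. f (c *\<^sub>R x)))\<^sup>2"
    by (subst (asm) ennreal_inj) (auto simp: power_mult_distrib)
  then show "L2_norm f = \<bar>c\<bar> * L2_norm (\<lambda>x. f (c *\<^sub>R x))"
    by (rule power2_eq_imp_eq) auto
qed

section \<open>Density of step functions\<close>

text \<open>The corners are ordered so that the explicit formulas for intervals apply to every
  summand; the inductive form lets linear statements be proved one box at a time.\<close>

inductive box_step :: "(complex \<Rightarrow> complex) \<Rightarrow> bool" where
  zero: "box_step (\<lambda>x. 0)"
| add: "box_step s \<Longrightarrow> Re a \<le> Re b \<Longrightarrow> Im a \<le> Im b \<Longrightarrow> box_step (\<lambda>x. s x + c * indicator (box a b) x)"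

lemma in_L2_indicator:
  assumes "A \<in> sets borel" "emeasure lborel A < \<infinity>"
  shows "in_L2 (indicator A)"
proof -
  have "(\<integral>\<^sup>+x. ennreal ((cmod (indicator A x))\<^sup>2) \<partial>lborel) = (\<integral>\<^sup>+x. indicator A x \<partial>lborel)"
    by (rule nn_integral_cong) (auto simp: indicator_def)
  then show ?thesis using assms unfolding in_L2_iff_nn by simp
qed

lemma in_L2_box: "in_L2 (indicator (box a b))"
  by (rule in_L2_indicator) (use emeasure_lborel_box_finite[of a b] in \<open>auto simp: less_top\<close>)

lemma box_step_in_L2: "box_step s \<Longrightarrow> in_L2 s"
  by (induction rule: box_step.induct) (auto intro!: in_L2_add in_L2_cmult in_L2_box)

lemma box_step_sum: "box_step s \<Longrightarrow> box_step s' \<Longrightarrow> box_step (\<lambda>x. s' x + s x)"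
proof (induction s rule: box_step.induct)
  case (add s a b c)
  have "box_step (\<lambda>x. (s' x + s x) + c * indicator (box a b) x)"
    by (rule box_step.add) (use add in auto)
  then show ?case by (simp add: add.assoc)
qed simp

lemma box_step_cmult: "box_step s \<Longrightarrow> box_step (\<lambda>x. d * s x)"
proof (induction s rule: box_step.induct)
  case (add s a b c)
  have "box_step (\<lambda>x. d * s x + (d * c) * indicator (box a b) x)"
    by (rule box_step.add) (use add in auto)
  then show ?case by (simp add: algebra_simps)
qed (simp add: box_step.zero)

text \<open>The class that is enlarged step by step, by linearity and L^2 limits, until it contains
  every square integrable function.\<close>

definition approximable :: "(complex \<Rightarrow> complex) \<Rightarrow> bool" where
  "approximable f \<longleftrightarrow> in_L2 f \<and> (\<forall>\<epsilon>>0. \<exists>s. box_step s \<and> L2_norm (\<lambda>x. f x - s x) < \<epsilon>)"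

lemma approximable_box_step: "box_step s \<Longrightarrow> approximable s"
  unfolding approximable_def using box_step_in_L2 by (auto intro!: exI[of _ s])

lemma approximable_box: "approximable (indicator (box a b))"
proof (cases "Re a \<le> Re b \<and> Im a \<le> Im b")
  case True
  have "box_step (\<lambda>x. 0 + 1 * indicator (box a b) x)"
    by (rule box_step.add[OF box_step.zero]) (use True in auto)
  then show ?thesis using approximable_box_step by simp
next
  case False
  then have "box a b = {}" by (auto simp: set_eq_iff in_box_complex_iff)
  then have "indicator (box a b) = (\<lambda>x. 0 :: complex)" by auto
  then show ?thesis using approximable_box_step[OF box_step.zero] by simp
qed

lemma approximable_add:
  assumes "approximable f" "approximable g" shows "approximable (\<lambda>x. f x + g x)"
  unfolding approximable_def
proof (intro conjI allI impI)
  show "in_L2 (\<lambda>x. f x + g x)" using assms by (auto simp: approximable_def intro: in_L2_add)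
  fix \<epsilon> :: real assume "\<epsilon> > 0"
  then have e: "\<epsilon>/2 > 0" by simp
  obtain s where s: "box_step s" "L2_norm (\<lambda>x. f x - s x) < \<epsilon>/2"
    using assms(1) e unfolding approximable_def by blast
  obtain s' where s': "box_step s'" "L2_norm (\<lambda>x. g x - s' x) < \<epsilon>/2"
    using assms(2) e unfolding approximable_def by blast
  have "L2_norm (\<lambda>x. (f x + g x) - (s x + s' x)) \<le> L2_norm (\<lambda>x. f x - s x) + L2_norm (\<lambda>x. g x - s' x)"
    using L2_norm_triangle[of "\<lambda>x. f x - s x" "\<lambda>x. g x - s' x"] assms s s'
    by (simp add: approximable_def in_L2_diff box_step_in_L2 algebra_simps)
  with s s' show "\<exists>s. box_step s \<and> L2_norm (\<lambda>x. (f x + g x) - s x) < \<epsilon>"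
    by (intro exI[of _ "\<lambda>x. s x + s' x"]) (auto intro: box_step_sum)
qed

lemma approximable_cmult:
  assumes "approximable f" shows "approximable (\<lambda>x. c * f x)"
  unfolding approximable_def
proof (intro conjI allI impI)
  show "in_L2 (\<lambda>x. c * f x)" using assms by (auto simp: approximable_def intro: in_L2_cmult)
  fix \<epsilon> :: real assume "\<epsilon> > 0"
  then have e: "\<epsilon>/(cmod c + 1) > 0" by (simp add: add_nonneg_pos)
  obtain s where s: "box_step s" "L2_norm (\<lambda>x. f x - s x) < \<epsilon>/(cmod c + 1)"
    using assms(1) e unfolding approximable_def by blast
  have "L2_norm (\<lambda>x. c * f x - c * s x) = cmod c * L2_norm (\<lambda>x. f x - s x)"
    by (subst L2_norm_cmult[symmetric]) (simp add: algebra_simps)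
  also have "\<dots> \<le> (cmod c + 1) * L2_norm (\<lambda>x. f x - s x)" by (intro mult_right_mono) auto
  also have "\<dots> < \<epsilon>" using s(2) by (subst (asm) pos_less_divide_eq) (auto simp: add_nonneg_pos mult.commute)
  finally show "\<exists>s. box_step s \<and> L2_norm (\<lambda>x. c * f x - s x) < \<epsilon>"
    using box_step_cmult[OF s(1), of c] by auto
qed

lemma approximable_sum: "finite I \<Longrightarrow> (\<And>i. i \<in> I \<Longrightarrow> approximable (f i)) \<Longrightarrow> approximable (\<lambda>x. \<Sum>i\<in>I. f i x)"
  by (induction I rule: finite_induct) (auto intro: approximable_add approximable_box_step[OF box_step.zero])

lemma approximable_limit:
  fixes f :: "nat \<Rightarrow> complex \<Rightarrow> complex"
  assumes "\<And>n. approximable (f n)" "in_L2 g" "(\<lambda>n. L2_norm (\<lambda>x. f n x - g x)) \<longlonglongrightarrow> 0"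
  shows "approximable g"
  unfolding approximable_def
proof (intro conjI allI impI assms(2))
  fix \<epsilon> :: real assume "\<epsilon> > 0"
  then have e: "\<epsilon>/2 > 0" by simp
  obtain n where n: "L2_norm (\<lambda>x. f n x - g x) < \<epsilon>/2"
    using order_tendstoD(2)[OF assms(3) e] by (auto simp: eventually_sequentially)
  obtain s where s: "box_step s" "L2_norm (\<lambda>x. f n x - s x) < \<epsilon>/2"
    using assms(1)[of n] e unfolding approximable_def by blast
  have "L2_norm (\<lambda>x. g x - s x) \<le> L2_norm (\<lambda>x. g x - f n x) + L2_norm (\<lambda>x. f n x - s x)"
    using assms s by (intro L2_norm_triangle_diff) (auto simp: approximable_def box_step_in_L2)
  with n s show "\<exists>s. box_step s \<and> L2_norm (\<lambda>x. g x - s x) < \<epsilon>"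
    by (intro exI[of _ s]) (simp add: L2_norm_commute[of g])
qed

lemma approximable_limit_dominated:
  fixes f :: "nat \<Rightarrow> complex \<Rightarrow> complex"
  assumes "\<And>n. approximable (f n)" "in_L2 g" "in_L2 h" "\<And>x. (\<lambda>n. f n x) \<longlonglongrightarrow> g x" "\<And>n x. cmod (f n x) \<le> cmod (h x)"
  shows "approximable g"
  by (rule approximable_limit[of f], rule assms, rule assms, rule L2_dominated_convergence[where h = h])
    (use assms in \<open>auto simp: approximable_def in_L2_measurable\<close>)

definition big_box :: "nat \<Rightarrow> complex set" where
  "big_box n = box (Complex (- real n) (- real n)) (Complex (real n) (real n))"

text \<open>Dynkin's argument: boxes form an intersection-stable generator of the Borel sets.
  Cutting with a fixed box keeps complements square integrable and provides the majorant for
  countable disjoint unions.\<close>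

lemma approximable_indicator_Int_box:
  assumes "A \<in> sets borel" shows "approximable (indicator (A \<inter> big_box n))"
proof -
  let ?E = "range (\<lambda>(a, b). box a b :: complex set)"
  have "Int_stable ?E" by (auto simp: Int_stable_def box_Int_box)
  moreover have "?E \<subseteq> Pow UNIV" by auto
  moreover have "A \<in> sigma_sets UNIV ?E" using assms by (simp add: borel_eq_box)
  ultimately show ?thesis
  proof (induction rule: sigma_sets_induct_disjoint)
    case (basic A)
    then obtain a b where "A = box a b" by auto
    then show ?case unfolding big_box_def by (auto simp: box_Int_box intro: approximable_box)
  next
    case empty
    have "indicator ({} \<inter> big_box n) = (\<lambda>x. 0 :: complex)" by auto
    then show ?case using approximable_box_step[OF box_step.zero] by simp
  next
    case (compl A)
    have "approximable (\<lambda>x. indicator (big_box n) x + (-1) * indicator (A \<inter> big_box n) x)"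
      using compl by (intro approximable_add approximable_cmult) (auto simp: big_box_def approximable_box)
    also have "(\<lambda>x. indicator (big_box n) x + (-1) * indicator (A \<inter> big_box n) x) = (indicator ((UNIV - A) \<inter> big_box n) :: complex \<Rightarrow> complex)"
      by (auto simp: indicator_def fun_eq_iff)
    finally show ?case .
  next
    case (union A)
    have [measurable]: "A i \<in> sets borel" for i using union(2) by (auto simp: borel_eq_box)
    have [measurable]: "big_box n \<in> sets borel" by (simp add: big_box_def)
    have bb: "in_L2 (indicator (big_box n))" unfolding big_box_def by (rule in_L2_box)
    have eq: "(\<Sum>i<N. indicator (A i \<inter> big_box n) x) = (indicator ((\<Union>i<N. A i) \<inter> big_box n) x :: complex)" for N x
      using union(1)
      by (subst indicator_UN_disjoint[symmetric])
         (auto simp: disjoint_family_on_def indicator_def intro!: sum.cong)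
    show ?case
    proof (rule approximable_limit_dominated[where h = "indicator (big_box n)" and
          f = "\<lambda>N x. \<Sum>i<N. indicator (A i \<inter> big_box n) x"])
      show "approximable (\<lambda>x. \<Sum>i<N. indicator (A i \<inter> big_box n) x)" for N
        by (intro approximable_sum) (use union in auto)
      show "in_L2 (indicator (big_box n))" by (rule bb)
      show "in_L2 (indicator ((\<Union>i. A i) \<inter> big_box n))"
        by (rule in_L2_dominated[OF bb, where B = 1]) (auto simp: indicator_def)
      show "cmod (\<Sum>i<N. indicator (A i \<inter> big_box n) x) \<le> cmod (indicator (big_box n) x)" for N x
        unfolding eq by (auto simp: indicator_def)
      show "(\<lambda>N. \<Sum>i<N. indicator (A i \<inter> big_box n) x) \<longlonglongrightarrow> (indicator ((\<Union>i. A i) \<inter> big_box n) x :: complex)" for x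
      proof -
        have "\<forall>\<^sub>F N in sequentially. (indicator ((\<Union>i<N. A i) \<inter> big_box n) x :: complex) = indicator ((\<Union>i. A i) \<inter> big_box n) x"
        proof (cases "x \<in> (\<Union>i. A i)")
          case True
          then obtain i where "x \<in> A i" by auto
          then have "x \<in> (\<Union>i<N. A i)" if "N > i" for N using that by auto
          then have "(indicator ((\<Union>i<N. A i) \<inter> big_box n) x :: complex) = indicator ((\<Union>i. A i) \<inter> big_box n) x" if "N > i" for N
            using that True by (auto simp: indicator_def)
          then show ?thesis by (rule eventually_mono[OF eventually_gt_at_top[of i]])
        qed (auto simp: indicator_def)
        then show ?thesis unfolding eq by (simp add: tendsto_eventually)
      qed
    qed
  qed
qed

lemma big_box_exhausts: "\<forall>\<^sub>F n in sequentially. x \<in> big_box n"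
proof -
  obtain N :: nat where "cmod x < real N" using reals_Archimedean2 by blast
  then have "x \<in> big_box n" if "n \<ge> N" for n
    using that abs_Re_le_cmod[of x] abs_Im_le_cmod[of x] unfolding big_box_def in_box_complex_iff by auto
  then show ?thesis by (auto simp: eventually_sequentially)
qed

lemma approximable_indicator:
  assumes "A \<in> sets borel" "emeasure lborel A < \<infinity>" shows "approximable (indicator A)"
proof (rule approximable_limit_dominated[where h = "indicator A" and f = "\<lambda>n. indicator (A \<inter> big_box n)"])
  show "(\<lambda>n. indicator (A \<inter> big_box n) x) \<longlonglongrightarrow> (indicator A x :: complex)" for x
    by (rule tendsto_eventually) (use big_box_exhausts[of x] in \<open>auto elim!: eventually_mono simp: indicator_def\<close>)
qed (use assms in \<open>auto intro!: approximable_indicator_Int_box in_L2_indicator simp: indicator_def\<close>)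

text \<open>Simple functions bounded by 2|f| converge to f pointwise, so dominated convergence
  reduces the claim to indicators of sets of finite measure.\<close>

theorem L2_box_step_dense:
  assumes "in_L2 f" "\<epsilon> > 0"
  obtains s where "box_step s" "L2_norm (\<lambda>x. f x - s x) < \<epsilon>"
proof -
  have f: "f \<in> borel_measurable lborel" using in_L2_measurable[OF assms(1)] by simp
  obtain s where "\<forall>i. simple_function lborel (s i)" "\<forall>x\<in>space lborel. (\<lambda>i. s i x) \<longlonglongrightarrow> f x"
    "\<forall>i. \<forall>x\<in>space lborel. dist (s i x) 0 \<le> 2 * dist (f x) 0"
    using borel_measurable_implies_sequence_metric[OF f, of 0] by metis
  then have s: "\<And>i. simple_function lborel (s i)" "\<And>x. (\<lambda>i. s i x) \<longlonglongrightarrow> f x"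
    "\<And>i x. cmod (s i x) \<le> 2 * cmod (f x)"
    by (simp_all add: dist_norm)
  have sL2: "in_L2 (s i)" for i
    by (rule in_L2_dominated[OF assms(1), where B = 2])
      (use s borel_measurable_simple_function[OF s(1)] in auto)
  have "approximable (s i)" for i
  proof -
    have fin: "finite (range (s i))" using s(1)[of i] by (simp add: simple_function_def)
    have [measurable]: "s i \<in> borel_measurable borel" using in_L2_measurable[OF sL2] .
    \<comment> \<open>The value 0 is left out because its level set may have infinite measure; the
      other level sets have finite measure by Chebyshev's inequality.\<close>
    have "approximable (\<lambda>x. \<Sum>y\<in>range (s i) - {0}. y * indicator {x. s i x = y} x)"
    proof (intro approximable_sum approximable_cmult approximable_indicator)
      fix y assume y: "y \<in> range (s i) - {0}"
      show "{x. s i x = y} \<in> sets borel" by measurable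
      then have "emeasure lborel {x. s i x = y} = (\<integral>\<^sup>+x. indicator {x. s i x = y} x \<partial>lborel)" by simp
      also have "\<dots> \<le> (\<integral>\<^sup>+x. ennreal (1 / (cmod y)\<^sup>2) * ennreal ((cmod (s i x))\<^sup>2) \<partial>lborel)"
        using y by (intro nn_integral_mono) (auto simp: indicator_def ennreal_mult[symmetric])
      also have "\<dots> < \<infinity>"
        using sL2[of i] unfolding in_L2_iff_nn by (subst nn_integral_cmult) (auto simp: ennreal_mult_less_top)
      finally show "emeasure lborel {x. s i x = y} < \<infinity>" .
    qed (use fin in auto)
    also have "(\<lambda>x. \<Sum>y\<in>range (s i) - {0}. y * indicator {x. s i x = y} x) = s i"
    proof
      fix x
      have "(\<Sum>y\<in>range (s i) - {0}. y * indicator {x. s i x = y} x) = (\<Sum>y\<in>range (s i) - {0}. if y = s i x then y else 0)"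
        by (rule sum.cong) (auto simp: indicator_def)
      also have "\<dots> = s i x" using fin by (subst sum.delta) auto
      finally show "(\<Sum>y\<in>range (s i) - {0}. y * indicator {x. s i x = y} x) = s i x" .
    qed
    finally show ?thesis .
  qed
  then have "approximable f"
    by (rule approximable_limit_dominated[where h = "\<lambda>x. 2 * f x"])
      (use s assms in \<open>auto intro: in_L2_cmult simp: norm_mult\<close>)
  then show ?thesis using assms(2) that unfolding approximable_def by blast
qed

section \<open>Fourier transforms of intervals\<close>

lemma borel_measurable_cis [measurable]: "cis \<in> borel_measurable borel"
  by (intro borel_measurable_continuous_onI continuous_intros)

lemma cmod_diff_cis_le: "cmod (cis x - cis y) \<le> 2"
  using norm_triangle_ineq4[of "cis x" "cis y"] by simp

text \<open>On the positive axis Si x - (1 - cos x)/x is an antiderivative for a = 1, and the limit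
  pi/2 of Si at infinity gives half of the integral. Evenness doubles it, and scaling by a
  multiplies it by |a|.\<close>

lemma has_bochner_integral_1_minus_cos_over_sq:
  "has_bochner_integral lborel (\<lambda>x::real. (1 - cos (a * x)) / x\<^sup>2) (pi * \<bar>a\<bar>)"
proof -
  define f where "f x = (1 - cos x) / x\<^sup>2" for x :: real
  define F where "F x = Si x - (1 - cos x) / x" for x :: real
  have f0: "f x \<ge> 0" for x by (simp add: f_def)
  have deriv: "DERIV F x :> f x" if "x > 0" for x
  proof -
    have s: "sinc x = sin x / x" using that by simp
    have "((\<lambda>x. (1 - cos x) / x) has_real_derivative (sin x * x - (1 - cos x)) / (x * x)) (at x)"
      using that by (auto intro!: derivative_eq_intros)
    from DERIV_diff[OF DERIV_Si[of x] this] show ?thesis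
      unfolding F_def f_def s using that by (simp add: field_simps power2_eq_square)
  qed
  have lim0: "((F \<circ> real_of_ereal) \<longlongrightarrow> 0) (at_right (ereal 0))"
  proof -
    \<comment> \<open>The boundary term (1 - cos h)/h is minus the difference quotient of cos at 0,
      so it vanishes in the limit.\<close>
    have 1: "((\<lambda>h. (cos (0 + h) - cos 0) / h) \<longlongrightarrow> - sin 0) (at (0::real))"
      using DERIV_cos[of 0] unfolding DERIV_def .
    have "((\<lambda>h. Si h + (cos (0 + h) - cos 0) / h) \<longlongrightarrow> Si 0 + - sin 0) (at_right (0::real))"
      by (intro tendsto_add filterlim_mono[OF 1 order_refl at_within_le_at])
        (use isCont_Si[of 0] in \<open>simp add: isCont_def filterlim_at_split\<close>)
    moreover have "Si 0 + - sin 0 = 0" by (simp add: Si_def zero_ereal_def interval_integral_endpoints_same)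
    ultimately have "(F \<longlongrightarrow> 0) (at_right 0)"
      by (simp add: F_def[abs_def] diff_divide_distrib algebra_simps)
    then show ?thesis using ereal_tendsto_simps(2) by blast
  qed
  have limT: "((F \<circ> real_of_ereal) \<longlongrightarrow> pi/2) (at_left \<infinity>)"
  proof -
    have "((\<lambda>x::real. (1 - cos x) / x) \<longlongrightarrow> 0) at_top"
    proof (rule Lim_null_comparison)
      show "\<forall>\<^sub>F x in at_top. norm ((1 - cos x) / x) \<le> 2 / (x::real)"
        using eventually_gt_at_top[of 0]
      proof eventually_elim
        case (elim x)
        have "\<bar>1 - cos x\<bar> \<le> 2" using cos_ge_minus_one[of x] cos_le_one[of x] by linarith
        then show ?case using elim by (simp add: divide_right_mono)
      qed
      show "((\<lambda>x::real. 2 / x) \<longlongrightarrow> 0) at_top" 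
        by (intro tendsto_divide_0[OF tendsto_const] filterlim_at_top_imp_at_infinity filterlim_ident)
    qed
    then have "(F \<longlongrightarrow> pi/2 - 0) at_top" unfolding F_def by (intro tendsto_diff Si_at_top)
    then show ?thesis by (simp add: ereal_tendsto_simps)
  qed
  have cont: "isCont f x" if "x > 0" for x
    unfolding f_def by (intro continuous_intros) (use that in auto)
  have e: "einterval (ereal 0) \<infinity> = {0<..}" by (auto simp: einterval_def)
  have "set_integrable lborel (einterval (ereal 0) \<infinity>) f" and "(LBINT x=ereal 0..\<infinity>. f x) = pi/2 - 0"
    using interval_integral_FTC_nonneg[of "ereal 0" \<infinity> F f 0 "pi/2"] deriv cont f0 lim0 limT by auto
  then have "set_integrable lborel {0<..} f" "(LINT x:{0<..}|lborel. f x) = pi/2"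
    unfolding interval_lebesgue_integral_def e by simp_all
  then have "has_bochner_integral lborel (\<lambda>x. indicator {0<..} x * f x) (pi/2)"
    by (simp add: has_bochner_integral_iff set_integrable_def set_lebesgue_integral_def)
  note h1 = this
  have "has_bochner_integral lborel (\<lambda>x. indicator {0<..} (0 + (-1) * x) * f (0 + (-1) * x)) (pi/2 /\<^sub>R \<bar>-1\<bar>)"
    by (subst lborel_has_bochner_integral_real_affine_iff[symmetric]) (use h1 in auto)
  from has_bochner_integral_add[OF h1 this]
  have "has_bochner_integral lborel (\<lambda>x. indicator {0<..} x * f x + indicator {0<..} (-x) * f (-x)) pi"
    by simp
  \<comment> \<open>Equality holds even at x = 0, where both indicators vanish and division by zero
    gives f 0 = 0.\<close>
  moreover have "(\<lambda>x. indicator {0<..} x * f x + indicator {0<..} (-x) * f (-x)) = f"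
    by (auto simp: fun_eq_iff f_def indicator_def)
  ultimately have h: "has_bochner_integral lborel f pi" by simp
  show ?thesis
  proof (cases "a = 0")
    case False
    then have "has_bochner_integral lborel (\<lambda>x. f (0 + a * x)) (pi /\<^sub>R \<bar>a\<bar>)"
      using lborel_has_bochner_integral_real_affine_iff[of a f pi 0] h by simp
    then have "has_bochner_integral lborel (\<lambda>x. a\<^sup>2 * f (0 + a * x)) (a\<^sup>2 * (pi /\<^sub>R \<bar>a\<bar>))"
      by (rule has_bochner_integral_mult_right)
    moreover have "a\<^sup>2 * (pi /\<^sub>R \<bar>a\<bar>) = pi * \<bar>a\<bar>"
      using False by (cases "a > 0") (auto simp: power2_eq_square field_simps)
    moreover have "(\<lambda>x. a\<^sup>2 * f (0 + a * x)) = (\<lambda>x. (1 - cos (a * x)) / x\<^sup>2)"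
      using False by (auto simp: f_def fun_eq_iff power_mult_distrib)
    ultimately show ?thesis by (simp only:)
  qed (simp add: has_bochner_integral_zero)
qed

lemma integrable_inverse_1_plus_sq: "integrable lborel (\<lambda>x::real. 1 / (1 + x\<^sup>2))"
  using integrable_inverse_1_plus_square
  by (simp add: set_integrable_def einterval_def inverse_eq_divide)

definition interval_ft :: "real \<Rightarrow> real \<Rightarrow> real \<Rightarrow> complex" where
  "interval_ft a b \<xi> = (LINT x|lborel. cis (- (x * \<xi>)) * indicator {a<..<b} x)"

lemma borel_measurable_interval_ft [measurable]: "interval_ft a b \<in> borel_measurable borel"
  unfolding interval_ft_def by measurable

text \<open>Bridges the open intervals that come from boxes and the closed ones of the fundamental
  theorem of calculus.\<close>

lemma integral_indicator_open_closed:
  fixes f :: "real \<Rightarrow> complex"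
  assumes [measurable]: "f \<in> borel_measurable borel"
  shows "(LINT x|lborel. f x * indicator {a<..<b} x) = (LINT x|lborel. indicator {a..b} x *\<^sub>R f x)"
proof -
  have "(LINT x|lborel. indicator {a<..<b} x *\<^sub>R f x) = (LINT x|lborel. indicator {a..b} x *\<^sub>R f x)"
  proof (rule integral_cong_AE)
    show "AE x in lborel. indicator {a<..<b} x *\<^sub>R f x = indicator {a..b} x *\<^sub>R f x"
      using AE_lborel_singleton[of a] AE_lborel_singleton[of b]
      by eventually_elim (auto simp: indicator_def)
  qed (use assms in measurable)
  moreover have "f x * indicator {a<..<b} x = indicator {a<..<b} x *\<^sub>R f x" for x
    by (simp add: indicator_def)
  ultimately show ?thesis by simp
qed

lemma interval_ft_eq:
  assumes "a \<le> b" "\<xi> \<noteq> 0"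
  shows "interval_ft a b \<xi> = (cis (- (a * \<xi>)) - cis (- (b * \<xi>))) / (\<i> * of_real \<xi>)"
proof -
  define F where "F x = - cis (- (x * \<xi>)) / (\<i> * of_real \<xi>)" for x
  have "interval_ft a b \<xi> = (LINT x|lborel. indicator {a..b} x *\<^sub>R cis (- (x * \<xi>)))"
    unfolding interval_ft_def by (rule integral_indicator_open_closed) measurable
  also have "\<dots> = F b - F a"
  proof (rule integral_FTC_atLeastAtMost[OF assms(1)])
    fix x
    show "(F has_vector_derivative cis (- (x * \<xi>))) (at x within {a..b})"
    proof -
      have "((\<lambda>z. - exp (- (\<i> * of_real \<xi> * z)) / (\<i> * of_real \<xi>)) has_field_derivative
          exp (- (\<i> * of_real \<xi> * of_real x))) (at (of_real x))"
        using assms(2) by (auto intro!: derivative_eq_intros)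
      from has_vector_derivative_real_field[OF this] show ?thesis
        unfolding F_def cis_conv_exp by (simp add: mult_ac)
    qed
  qed (intro continuous_intros)
  also have "\<dots> = (cis (- (a * \<xi>)) - cis (- (b * \<xi>))) / (\<i> * of_real \<xi>)"
    by (simp add: F_def diff_divide_distrib)
  finally show ?thesis .
qed

text \<open>Combines the trivial bound b - a with the bound 2/|\<xi>| from the explicit formula.
  Products of two such bounds are dominated by a multiple of 1/(1 + \<xi>^2).\<close>

lemma interval_ft_bound:
  assumes "a \<le> b" shows "cmod (interval_ft a b \<xi>) \<le> (b - a + 2) / (1 + \<bar>\<xi>\<bar>)"
proof -
  have 1: "cmod (interval_ft a b \<xi>) \<le> b - a"
  proof -
    have "cmod (interval_ft a b \<xi>) \<le> (LINT x|lborel. cmod (cis (- (x * \<xi>)) * indicator {a<..<b} x))"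
      unfolding interval_ft_def by (rule integral_norm_bound)
    also have "\<dots> = (LINT x|lborel. indicator {a<..<b} x)"
      by (rule Bochner_Integration.integral_cong) (auto simp: norm_mult indicator_def)
    also have "\<dots> = b - a" using assms by simp
    finally show ?thesis .
  qed
  have 2: "cmod (interval_ft a b \<xi>) * \<bar>\<xi>\<bar> \<le> 2"
  proof (cases "\<xi> = 0")
    case False
    then show ?thesis using cmod_diff_cis_le by (simp add: interval_ft_eq[OF assms] norm_divide norm_mult)
  qed simp
  have "cmod (interval_ft a b \<xi>) * (1 + \<bar>\<xi>\<bar>) \<le> b - a + 2" using 1 2 by (simp add: algebra_simps)
  then show ?thesis by (simp add: pos_le_divide_eq)
qed

lemma interval_ft_minus: "interval_ft a b (- \<xi>) = cnj (interval_ft a b \<xi>)"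
  unfolding interval_ft_def
  by (subst Bochner_Integration.integral_cnj[symmetric], rule Bochner_Integration.integral_cong) (auto simp: cis_cnj indicator_def)

text \<open>One-dimensional Plancherel identity for two intervals:
  \<open>max 0 (min b d - max a c)\<close> is the length of their overlap.\<close>

lemma interval_ft_inner:
  assumes "a \<le> b" "c \<le> d"
  shows "has_bochner_integral lborel (\<lambda>\<xi>. interval_ft a b \<xi> * cnj (interval_ft c d \<xi>))
    (of_real (2 * pi * max 0 (min b d - max a c)))"
proof -
  define h where "h \<xi> = interval_ft a b \<xi> * cnj (interval_ft c d \<xi>)" for \<xi>
  have [measurable]: "h \<in> borel_measurable borel" unfolding h_def by measurable
  have int: "integrable lborel h"
  proof (rule Bochner_Integration.integrable_bound)
    show "integrable lborel (\<lambda>\<xi>. (b - a + 2) * (d - c + 2) * (1 / (1 + \<xi>\<^sup>2)))"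
      by (intro integrable_mult_right integrable_inverse_1_plus_sq)
    show "AE \<xi> in lborel. norm (h \<xi>) \<le> norm ((b - a + 2) * (d - c + 2) * (1 / (1 + \<xi>\<^sup>2)))"
    proof (rule AE_I2)
      fix \<xi> :: real
      have "norm (h \<xi>) \<le> ((b - a + 2) / (1 + \<bar>\<xi>\<bar>)) * ((d - c + 2) / (1 + \<bar>\<xi>\<bar>))"
        unfolding h_def norm_mult complex_mod_cnj
        using assms by (intro mult_mono interval_ft_bound) auto
      also have "\<dots> = (b - a + 2) * (d - c + 2) / (1 + \<bar>\<xi>\<bar>)\<^sup>2" by (simp add: power2_eq_square)
      also have "\<dots> \<le> (b - a + 2) * (d - c + 2) / (1 + \<xi>\<^sup>2)"
        using assms by (intro divide_left_mono mult_pos_pos) (auto simp: power2_sum add_pos_nonneg)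
      finally show "norm (h \<xi>) \<le> norm ((b - a + 2) * (d - c + 2) * (1 / (1 + \<xi>\<^sup>2)))"
        using assms by simp
    qed
  qed measurable
  \<comment> \<open>The substitution of -\<xi> for \<xi> conjugates the integrand, so the integral
    is real and only real parts have to be computed.\<close>
  have "cnj (integral\<^sup>L lborel h) = (LINT \<xi>|lborel. cnj (h \<xi>))" by simp
  also have "\<dots> = (LINT \<xi>|lborel. h (0 + (-1) * \<xi>))"
    by (rule Bochner_Integration.integral_cong) (auto simp: h_def interval_ft_minus)
  also have "\<dots> = integral\<^sup>L lborel h"
    using lborel_integral_real_affine[of "-1" h 0] by simp
  finally have real: "integral\<^sup>L lborel h = of_real (Re (integral\<^sup>L lborel h))"
    by (simp add: complex_eq_iff)
  \<comment> \<open>Multiplying out gives four cosines over \<xi>^2 with signs that sum to zero.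
    Each cosine can thus be replaced by cos - 1, which makes the four integrals converge
    separately.\<close>
  let ?g = "\<lambda>\<alpha> \<xi>::real. (1 - cos (\<alpha> * \<xi>)) / \<xi>\<^sup>2"
  have 1: "has_bochner_integral lborel (\<lambda>\<xi>. (?g (d - a) \<xi> + ?g (c - b) \<xi>) - (?g (c - a) \<xi> + ?g (d - b) \<xi>))
      ((pi * \<bar>d - a\<bar> + pi * \<bar>c - b\<bar>) - (pi * \<bar>c - a\<bar> + pi * \<bar>d - b\<bar>))"
    by (intro has_bochner_integral_add has_bochner_integral_diff has_bochner_integral_1_minus_cos_over_sq)
  have "Re (integral\<^sup>L lborel h) = (LINT \<xi>|lborel. Re (h \<xi>))" using int by simp
  also have "\<dots> = (LINT \<xi>|lborel. (?g (d - a) \<xi> + ?g (c - b) \<xi>) - (?g (c - a) \<xi> + ?g (d - b) \<xi>))"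
  proof (rule integral_cong_AE)
    show "AE \<xi> in lborel. Re (h \<xi>) = (?g (d - a) \<xi> + ?g (c - b) \<xi>) - (?g (c - a) \<xi> + ?g (d - b) \<xi>)"
      using AE_lborel_singleton[of "0::real"]
    proof eventually_elim
      case (elim \<xi>)
      have "h \<xi> = (cis (- (a * \<xi>)) - cis (- (b * \<xi>))) * cnj (cis (- (c * \<xi>)) - cis (- (d * \<xi>))) / of_real (\<xi>\<^sup>2)"
      proof -
        have "(\<i> * complex_of_real \<xi>) * cnj (\<i> * complex_of_real \<xi>) = of_real (\<xi>\<^sup>2)"
          by (simp add: complex_eq_iff power2_eq_square)
        then show ?thesis unfolding h_def interval_ft_eq[OF assms(1) elim] interval_ft_eq[OF assms(2) elim]
          by (simp only: complex_cnj_divide times_divide_times_eq)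
      qed
      also have "(cis (- (a * \<xi>)) - cis (- (b * \<xi>))) * cnj (cis (- (c * \<xi>)) - cis (- (d * \<xi>))) =
         cis ((c - a) * \<xi>) - cis ((d - a) * \<xi>) - cis ((c - b) * \<xi>) + cis ((d - b) * \<xi>)"
        by (simp add: cis_cnj algebra_simps cis_mult)
      also have "Re (\<dots> / of_real (\<xi>\<^sup>2)) = (cos ((c - a) * \<xi>) - cos ((d - a) * \<xi>) - cos ((c - b) * \<xi>) + cos ((d - b) * \<xi>)) / \<xi>\<^sup>2"
        by (simp only: Re_divide_of_real) simp
      also have "\<dots> = (?g (d - a) \<xi> + ?g (c - b) \<xi>) - (?g (c - a) \<xi> + ?g (d - b) \<xi>)"
        by (simp add: diff_divide_distrib add_divide_distrib)
      finally show ?case .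
    qed
  qed measurable
  also have "\<dots> = (pi * \<bar>d - a\<bar> + pi * \<bar>c - b\<bar>) - (pi * \<bar>c - a\<bar> + pi * \<bar>d - b\<bar>)"
    by (rule has_bochner_integral_integral_eq[OF 1])
  also have "\<dots> = pi * ((\<bar>d - a\<bar> + \<bar>c - b\<bar>) - (\<bar>c - a\<bar> + \<bar>d - b\<bar>))" by (simp add: algebra_simps)
  also have "(\<bar>d - a\<bar> + \<bar>c - b\<bar>) - (\<bar>c - a\<bar> + \<bar>d - b\<bar>) = 2 * max 0 (min b d - max a c)"
    using assms by (auto simp: abs_if max_def min_def)
  finally have "Re (integral\<^sup>L lborel h) = 2 * pi * max 0 (min b d - max a c)" by simp
  then have "integral\<^sup>L lborel h = of_real (2 * pi * max 0 (min b d - max a c))" using real by simp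
  with int show ?thesis unfolding has_bochner_integral_iff h_def by blast
qed

section \<open>The Plancherel theorem\<close>

text \<open>The integral over the whole plane with the normalisation of \<open>has_fourier\<close>;
  it is meaningful for integrable functions and becomes the working formula once applied to
  truncations.\<close>

definition fourier_int :: "(complex \<Rightarrow> complex) \<Rightarrow> complex \<Rightarrow> complex" where
  "fourier_int f \<xi> = (LINT x|lborel. cis (- (x \<bullet> \<xi>)) * f x) / of_real (2 * pi)"

lemma borel_measurable_fourier_int [measurable]:
  assumes [measurable]: "f \<in> borel_measurable borel"
  shows "fourier_int f \<in> borel_measurable borel"
  unfolding fourier_int_def by measurable

lemma integrable_cis_mult:
  assumes "integrable lborel f" "h \<in> borel_measurable borel"
  shows "integrable lborel (\<lambda>x::complex. cis (h x) * f x)"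
  by (rule Bochner_Integration.integrable_bound[OF assms(1)])
    (use assms borel_measurable_integrable[OF assms(1)] in \<open>auto simp: norm_mult\<close>)

lemma fourier_int_add:
  assumes "integrable lborel f" "integrable lborel g"
  shows "fourier_int (\<lambda>x. f x + g x) \<xi> = fourier_int f \<xi> + fourier_int g \<xi>"
  unfolding fourier_int_def using assms
  by (simp add: distrib_left integrable_cis_mult add_divide_distrib)

lemma fourier_int_cmult: "fourier_int (\<lambda>x. c * f x) \<xi> = c * fourier_int f \<xi>"
proof -
  have "(LINT x|lborel. cis (- (x \<bullet> \<xi>)) * (c * f x)) = (LINT x|lborel. c * (cis (- (x \<bullet> \<xi>)) * f x))"
    by (simp add: mult_ac)
  then show ?thesis by (simp add: fourier_int_def)
qed

lemma fourier_int_diff: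
  assumes "integrable lborel f" "integrable lborel g"
  shows "fourier_int (\<lambda>x. f x - g x) \<xi> = fourier_int f \<xi> - fourier_int g \<xi>"
  using fourier_int_add[OF assms(1), of "\<lambda>x. (-1) * g x" \<xi>] assms(2) fourier_int_cmult[of "-1" g \<xi>] by simp

lemma fourier_int_bound:
  assumes "integrable lborel f"
  shows "cmod (fourier_int f \<xi>) \<le> (LINT x|lborel. cmod (f x))"
proof -
  have "cmod (LINT x|lborel. cis (- (x \<bullet> \<xi>)) * f x) \<le> (LINT x|lborel. cmod (cis (- (x \<bullet> \<xi>)) * f x))"
    by (rule integral_norm_bound)
  also have "\<dots> = (LINT x|lborel. cmod (f x))" by (simp add: norm_mult)
  finally have 1: "cmod (LINT x|lborel. cis (- (x \<bullet> \<xi>)) * f x) \<le> (LINT x|lborel. cmod (f x))" .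
  have "cmod (fourier_int f \<xi>) = cmod (LINT x|lborel. cis (- (x \<bullet> \<xi>)) * f x) / (2 * pi)"
    by (simp add: fourier_int_def norm_divide)
  also have "\<dots> \<le> cmod (LINT x|lborel. cis (- (x \<bullet> \<xi>)) * f x) / 1"
    using pi_gt3 by (intro divide_left_mono) auto
  finally show ?thesis using 1 by simp
qed

section \<open>Plancherel's identity for step functions\<close>

lemma integrable_indicator_interval: "integrable lborel (\<lambda>x. cis (h x) * indicator {a<..<b::real} x)"
  if [measurable]: "h \<in> borel_measurable borel"
proof (rule Bochner_Integration.integrable_bound)
  show "integrable lborel (indicator {a<..<b} :: real \<Rightarrow> real)" by (cases "a \<le> b") auto
qed (auto simp: norm_mult indicator_def)

lemma indicator_box_prod:
  "indicator (box a b) x = (indicator {Re a<..<Re b} (Re x) * indicator {Im a<..<Im b} (Im x) :: complex)"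
  by (auto simp: indicator_def in_box_complex_iff)

lemma fourier_int_box:
  "fourier_int (indicator (box a b)) \<xi> =
     interval_ft (Re a) (Re b) (Re \<xi>) * interval_ft (Im a) (Im b) (Im \<xi>) / of_real (2 * pi)"
proof -
  have "(LINT x|lborel. cis (- (x \<bullet> \<xi>)) * indicator (box a b) x) =
     (LINT z|lborel. (cis (- (Re z * Re \<xi>)) * indicator {Re a<..<Re b} (Re z)) * (cis (- (Im z * Im \<xi>)) * indicator {Im a<..<Im b} (Im z)))"
  proof (rule Bochner_Integration.integral_cong[OF refl])
    fix z :: complex
    have "cis (- (z \<bullet> \<xi>)) = cis (- (Re z * Re \<xi>)) * cis (- (Im z * Im \<xi>))"
      by (simp add: cis_mult inner_complex_def)
    then show "cis (- (z \<bullet> \<xi>)) * indicator (box a b) z = (cis (- (Re z * Re \<xi>)) * indicator {Re a<..<Re b} (Re z)) * (cis (- (Im z * Im \<xi>)) * indicator {Im a<..<Im b} (Im z))"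
      by (simp add: indicator_box_prod)
  qed
  also have "\<dots> = interval_ft (Re a) (Re b) (Re \<xi>) * interval_ft (Im a) (Im b) (Im \<xi>)"
    unfolding interval_ft_def
    by (intro has_bochner_integral_integral_eq has_bochner_integral_complex_prod integrable_indicator_interval) auto
  finally show ?thesis by (simp add: fourier_int_def)
qed

text \<open>Both sides factor over the coordinates. Each one-dimensional integral yields 2 pi times
  an overlap length, and the factors 2 pi cancel against the normalisation of the two
  transforms.\<close>

lemma L2_inner_boxes:
  assumes "Re a \<le> Re b" "Im a \<le> Im b" "Re c \<le> Re d" "Im c \<le> Im d"
  shows "has_bochner_integral lborel
      (\<lambda>\<xi>. fourier_int (indicator (box a b)) \<xi> * cnj (fourier_int (indicator (box c d)) \<xi>))
      (L2_inner (indicator (box a b)) (indicator (box c d)))"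
proof -
  define l where "l = max 0 (min (Re b) (Re d) - max (Re a) (Re c))"
  define k where "k = max 0 (min (Im b) (Im d) - max (Im a) (Im c))"
  let ?E = "\<lambda>x. interval_ft (Re a) (Re b) x * cnj (interval_ft (Re c) (Re d) x)"
  let ?G = "\<lambda>x. interval_ft (Im a) (Im b) x * cnj (interval_ft (Im c) (Im d) x)"
  note E = interval_ft_inner[OF assms(1,3), folded l_def] and G = interval_ft_inner[OF assms(2,4), folded k_def]
  have "has_bochner_integral lborel (\<lambda>z. ?E (Re z) * ?G (Im z)) (integral\<^sup>L lborel ?E * integral\<^sup>L lborel ?G)"
    using E G by (intro has_bochner_integral_complex_prod) (auto simp: has_bochner_integral_iff)
  then have "has_bochner_integral lborel (\<lambda>z. (?E (Re z) * ?G (Im z)) / of_real ((2 * pi)\<^sup>2))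
     ((integral\<^sup>L lborel ?E * integral\<^sup>L lborel ?G) / of_real ((2 * pi)\<^sup>2))"
    by (rule has_bochner_integral_divide)
  moreover have "(\<lambda>z. (?E (Re z) * ?G (Im z)) / of_real ((2 * pi)\<^sup>2)) =
     (\<lambda>\<xi>. fourier_int (indicator (box a b)) \<xi> * cnj (fourier_int (indicator (box c d)) \<xi>))"
    by (simp add: fourier_int_box fun_eq_iff power2_eq_square)
  moreover have "(integral\<^sup>L lborel ?E * integral\<^sup>L lborel ?G) / of_real ((2 * pi)\<^sup>2) = of_real (l * k)"
    using E G by (simp add: has_bochner_integral_iff power2_eq_square)
  moreover have "L2_inner (indicator (box a b)) (indicator (box c d)) = of_real (l * k)"
  proof -
    have i: "integrable lborel (\<lambda>x. indicator {p<..<q} x * indicator {r<..<s} x :: complex)" for p q r s :: real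
    proof -
      have "(\<lambda>x. indicator {p<..<q} x * indicator {r<..<s} x :: complex) = (\<lambda>x. cis 0 * indicator {max p r<..<min q s} x)"
        by (auto simp: fun_eq_iff indicator_def)
      then show ?thesis using integrable_indicator_interval[of "\<lambda>_. 0" "max p r" "min q s"] by simp
    qed
    have v: "(LINT x|lborel. indicator {p<..<q} x * indicator {r<..<s} x :: complex) = of_real (max 0 (min q s - max p r))"
      for p q r s :: real
    proof -
      have "(LINT x|lborel. indicator {p<..<q} x * indicator {r<..<s} x :: complex) = (LINT x|lborel. of_real (indicator {max p r<..<min q s} x))"
        by (rule Bochner_Integration.integral_cong) (auto simp: indicator_def)
      also have "\<dots> = of_real (max 0 (min q s - max p r))"
        by (cases "max p r \<le> min q s") (auto simp del: of_real_indicator)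
      finally show ?thesis .
    qed
    have "L2_inner (indicator (box a b)) (indicator (box c d)) =
      (LINT z|lborel. (indicator {Re a<..<Re b} (Re z) * indicator {Re c<..<Re d} (Re z)) * (indicator {Im a<..<Im b} (Im z) * indicator {Im c<..<Im d} (Im z)))"
      unfolding L2_inner_def
      by (rule Bochner_Integration.integral_cong) (auto simp: in_box_complex_iff indicator_def)
    also have "\<dots> = of_real l * of_real k"
      using has_bochner_integral_integral_eq[OF has_bochner_integral_complex_prod[OF i i]]
      unfolding l_def k_def v .
    finally show ?thesis by simp
  qed
  ultimately show ?thesis by simp
qed

lemma L2_inner_integrable: "in_L2 f \<Longrightarrow> in_L2 g \<Longrightarrow> integrable lborel (\<lambda>x. f x * cnj (g x))"
  by (rule L2_mult_integrable[OF _ in_L2_cnj])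

lemma L2_inner_add_left:
  assumes "in_L2 f" "in_L2 g" "in_L2 h"
  shows "L2_inner (\<lambda>x. f x + g x) h = L2_inner f h + L2_inner g h"
  unfolding L2_inner_def using assms by (simp add: distrib_right L2_inner_integrable)

lemma L2_inner_cmult_left: "L2_inner (\<lambda>x. c * f x) h = c * L2_inner f h"
  unfolding L2_inner_def by (simp add: mult.assoc)

lemma L2_inner_commute: "L2_inner f g = cnj (L2_inner g f)"
  unfolding L2_inner_def by (subst Bochner_Integration.integral_cnj[symmetric]) (simp add: mult.commute)

lemma L2_inner_self: "L2_inner f f = of_real ((L2_norm f)\<^sup>2)"
  unfolding L2_inner_def L2_norm_sq by (simp add: complex_norm_square[symmetric] flip: integral_complex_of_real)

lemma integrable_indicator_box: "integrable lborel (indicator (box a b) :: complex \<Rightarrow> complex)"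
  using has_bochner_integral_complex_prod[OF integrable_indicator_interval[of "\<lambda>_. 0" "Re a" "Re b"] integrable_indicator_interval[of "\<lambda>_. 0" "Im a" "Im b"]]
  by (simp add: has_bochner_integral_iff indicator_box_prod[abs_def])

lemma box_step_integrable: "box_step s \<Longrightarrow> integrable lborel s"
  by (induction rule: box_step.induct) (auto simp: integrable_indicator_box)

lemma in_L2_fourier_int_box:
  assumes "Re a \<le> Re b" "Im a \<le> Im b" shows "in_L2 (fourier_int (indicator (box a b)))"
proof -
  have "integrable lborel (\<lambda>x. Re (fourier_int (indicator (box a b)) x * cnj (fourier_int (indicator (box a b)) x)))"
    using L2_inner_boxes[OF assms assms] by (intro integrable_Re) (simp add: has_bochner_integral_iff)
  then show ?thesis
    unfolding in_L2_def by (simp add: complex_norm_square[symmetric] del: complex_mult_cnj)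
qed

lemma fourier_int_box_step_add:
  assumes "box_step s"
  shows "fourier_int (\<lambda>x. s x + c * indicator (box a b) x) = (\<lambda>\<xi>. fourier_int s \<xi> + c * fourier_int (indicator (box a b)) \<xi>)"
proof
  have "integrable lborel (\<lambda>x. c * indicator (box a b) x :: complex)"
    by (intro integrable_mult_right integrable_indicator_box)
  then show "fourier_int (\<lambda>x. s x + c * indicator (box a b) x) \<xi> = fourier_int s \<xi> + c * fourier_int (indicator (box a b)) \<xi>" for \<xi>
    using fourier_int_add[OF box_step_integrable[OF assms]] fourier_int_cmult by simp
qed

lemma fourier_int_zero [simp]: "fourier_int (\<lambda>x. 0) = (\<lambda>\<xi>. 0)"
  by (simp add: fourier_int_def fun_eq_iff)

lemma in_L2_fourier_int_box_step: "box_step s \<Longrightarrow> in_L2 (fourier_int s)"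
  by (induction rule: box_step.induct)
    (auto simp: fourier_int_box_step_add intro!: in_L2_add in_L2_cmult in_L2_fourier_int_box)

lemma L2_inner_zero_left [simp]: "L2_inner (\<lambda>x. 0) g = 0"
  by (simp add: L2_inner_def)

text \<open>Sesquilinear extension from pairs of boxes, one induction per argument; conjugate
  symmetry lets linearity in the left argument serve both times.\<close>

lemma Plancherel_box_step:
  assumes "box_step s" "box_step s'"
  shows "L2_inner (fourier_int s) (fourier_int s') = L2_inner s s'"
proof -
  have 1: "L2_inner (fourier_int s) (fourier_int (indicator (box c d))) = L2_inner s (indicator (box c d))"
    if "Re c \<le> Re d" "Im c \<le> Im d" "box_step s" for c d s
    using that(3)
  proof (induction rule: box_step.induct)
    case (add s a b e)
    have "L2_inner (fourier_int (indicator (box a b))) (fourier_int (indicator (box c d))) = L2_inner (indicator (box a b)) (indicator (box c d))"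
      using has_bochner_integral_integral_eq[OF L2_inner_boxes[of a b c d]] add that by (simp add: L2_inner_def)
    with add that show ?case
      by (simp add: fourier_int_box_step_add L2_inner_add_left L2_inner_cmult_left in_L2_fourier_int_box_step
          in_L2_fourier_int_box in_L2_cmult in_L2_box box_step_in_L2)
  qed simp
  have "L2_inner (fourier_int s') (fourier_int s) = L2_inner s' s"
    using assms(2)
  proof (induction rule: box_step.induct)
    case (add s' a b e)
    have "L2_inner (fourier_int (indicator (box a b))) (fourier_int s) = L2_inner (indicator (box a b)) s"
      using 1[OF add(2,3) assms(1)] by (simp add: L2_inner_commute[of "fourier_int (indicator _)"] L2_inner_commute[of "indicator _"])
    with add assms(1) show ?case
      by (simp add: fourier_int_box_step_add L2_inner_add_left L2_inner_cmult_left in_L2_fourier_int_box_step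
          in_L2_fourier_int_box in_L2_cmult in_L2_box box_step_in_L2)
  qed simp
  then show ?thesis using L2_inner_commute by metis
qed

section \<open>Square integrable functions of bounded support\<close>

lemma box_step_mult_box:
  "box_step s \<Longrightarrow> box_step (\<lambda>x. indicator (box c d) x * s x)"
proof (induction rule: box_step.induct)
  case (add s a b e)
  obtain p q where pq: "box a b \<inter> box c d = box p q" by (auto simp: box_Int_box)
  have eq: "indicator (box c d) x * (s x + e * indicator (box a b) x) = indicator (box c d) x * s x + e * indicator (box p q) x" for x
    by (auto simp: pq[symmetric] indicator_def)
  show ?case
  \<comment> \<open>The corners of the intersection may be out of order; the intersection is then
    empty and the term drops out.\<close>
  proof (cases "Re p \<le> Re q \<and> Im p \<le> Im q")
    case True
    then show ?thesis unfolding eq using add by (intro box_step.add) auto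
  next
    case False
    then have "box p q = {}" by (auto simp: set_eq_iff in_box_complex_iff)
    then show ?thesis unfolding eq using add by simp
  qed
qed (simp add: box_step.zero)

text \<open>Bounded refers to the support, not to the values. Such functions are integrable, so
  \<open>fourier_int\<close> is an absolutely convergent integral on them.\<close>

definition bounded_L2 :: "(complex \<Rightarrow> complex) \<Rightarrow> bool" where
  "bounded_L2 f \<longleftrightarrow> in_L2 f \<and> (\<exists>n. \<forall>x. x \<notin> big_box n \<longrightarrow> f x = 0)"

lemma bounded_L2_in_L2: "bounded_L2 f \<Longrightarrow> in_L2 f"
  by (simp add: bounded_L2_def)

lemma big_box_mono: "m \<le> n \<Longrightarrow> big_box m \<subseteq> big_box n"
  by (auto simp: big_box_def in_box_complex_iff)

lemma in_L2_big_box: "in_L2 (indicator (big_box n))"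
  unfolding big_box_def by (rule in_L2_box)

lemma L1_le_L2:
  assumes "in_L2 f" "\<And>x. x \<notin> big_box n \<Longrightarrow> f x = 0"
  shows "integrable lborel f" "(LINT x|lborel. cmod (f x)) \<le> L2_norm f * L2_norm (indicator (big_box n))"
proof -
  have 1: "f x = f x * indicator (big_box n) x" for x using assms(2)[of x] by (auto simp: indicator_def)
  show "integrable lborel f" using L2_mult_integrable[OF assms(1) in_L2_big_box, of n] by (simp flip: 1)
  have "(LINT x|lborel. cmod (f x)) = (LINT x|lborel. cmod (f x) * cmod (indicator (big_box n) x))"
    by (rule Bochner_Integration.integral_cong) (use assms(2) in \<open>auto simp: indicator_def\<close>)
  then show "(LINT x|lborel. cmod (f x)) \<le> L2_norm f * L2_norm (indicator (big_box n))"
    using L2_cauchy_schwarz[OF assms(1) in_L2_big_box] by simp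
qed

lemma bounded_L2_integrable: "bounded_L2 f \<Longrightarrow> integrable lborel f"
  unfolding bounded_L2_def using L1_le_L2(1) by blast

lemma bounded_L2_diff:
  assumes "bounded_L2 f" "bounded_L2 g" shows "bounded_L2 (\<lambda>x. f x - g x)"
proof -
  obtain n k where "\<And>x. x \<notin> big_box n \<Longrightarrow> f x = 0" "\<And>x. x \<notin> big_box k \<Longrightarrow> g x = 0"
    using assms unfolding bounded_L2_def by metis
  then have "\<forall>x. x \<notin> big_box (max n k) \<longrightarrow> f x - g x = 0"
    using big_box_mono[of n "max n k"] big_box_mono[of k "max n k"] by fastforce
  then show ?thesis using assms unfolding bounded_L2_def by (auto intro: in_L2_diff)
qed

text \<open>The approximating step functions share one support box, so L^2 errors control L^1 errors
  and the transforms converge at every point. By the isometry on step functions they are also Cauchy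
  in L^2, and Fatou identifies the L^2 limit with the pointwise one,
  \<open>fourier_int f\<close>.\<close>

lemma fourier_int_bounded_L2:
  assumes "bounded_L2 f"
  obtains s where "\<And>n. box_step (s n)" "(\<lambda>n. L2_norm (\<lambda>x. f x - s n x)) \<longlonglongrightarrow> 0" "in_L2 (fourier_int f)"
    "(\<lambda>n. L2_norm (\<lambda>x. fourier_int f x - fourier_int (s n) x)) \<longlonglongrightarrow> 0"
proof -
  obtain N where N: "\<And>x. x \<notin> big_box N \<Longrightarrow> f x = 0" and f: "in_L2 f"
    using assms unfolding bounded_L2_def by blast
  have "\<exists>s. box_step s \<and> (\<forall>x. x \<notin> big_box N \<longrightarrow> s x = 0) \<and> L2_norm (\<lambda>x. f x - s x) < 1 / real (Suc n)" for n
  proof -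
    obtain s where s: "box_step s" "L2_norm (\<lambda>x. f x - s x) < 1 / real (Suc n)"
      using L2_box_step_dense[OF f, of "1 / real (Suc n)"] by auto
    \<comment> \<open>Cutting off to the support of f can only reduce the error, since f vanishes
      outside.\<close>
    let ?s = "\<lambda>x. indicator (big_box N) x * s x"
    have b: "box_step ?s" unfolding big_box_def by (rule box_step_mult_box[OF s(1)])
    have "L2_norm (\<lambda>x. f x - ?s x) \<le> L2_norm (\<lambda>x. f x - s x)"
    proof (rule L2_norm_mono_AE)
      show "in_L2 (\<lambda>x. f x - s x)" by (intro in_L2_diff f box_step_in_L2 s)
      show "(\<lambda>x. f x - ?s x) \<in> borel_measurable borel"
        by (intro in_L2_measurable in_L2_diff f box_step_in_L2 b)
      show "AE x in lborel. cmod (f x - ?s x) \<le> cmod (f x - s x)"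
        by (rule AE_I2) (use N in \<open>auto simp: indicator_def\<close>)
    qed
    then show ?thesis using b s by (intro exI[of _ ?s]) auto
  qed
  then obtain s where s: "\<And>n. box_step (s n)" "\<And>n x. x \<notin> big_box N \<Longrightarrow> s n x = 0"
    "\<And>n. L2_norm (\<lambda>x. f x - s n x) < 1 / real (Suc n)" by metis
  have inv: "(\<lambda>n. 1 / real (Suc n)) \<longlonglongrightarrow> 0" by (rule lim_1_over_n[THEN LIMSEQ_Suc])
  have sf: "(\<lambda>n. L2_norm (\<lambda>x. f x - s n x)) \<longlonglongrightarrow> 0"
    by (rule Lim_null_comparison[OF _ inv]) (use s(3) in \<open>auto intro!: always_eventually less_imp_le\<close>)
  have sL2: "in_L2 (s n)" for n using s(1) box_step_in_L2 by blast
  define K where "K = L2_norm (indicator (big_box N))"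
  have pt: "(\<lambda>n. fourier_int (s n) \<xi>) \<longlonglongrightarrow> fourier_int f \<xi>" for \<xi>
  proof (rule LIM_zero_cancel, rule Lim_null_comparison)
    show "(\<lambda>n. L2_norm (\<lambda>x. f x - s n x) * K) \<longlonglongrightarrow> 0" using tendsto_mult_left_zero[OF sf] by simp
    have "norm (fourier_int (s n) \<xi> - fourier_int f \<xi>) \<le> L2_norm (\<lambda>x. f x - s n x) * K" for n
    proof -
      have "fourier_int (s n) \<xi> - fourier_int f \<xi> = fourier_int (\<lambda>x. s n x - f x) \<xi>"
        using fourier_int_diff[OF box_step_integrable[OF s(1)] bounded_L2_integrable[OF assms]] by simp
      also have "cmod \<dots> \<le> (LINT x|lborel. cmod (s n x - f x))"
        using box_step_integrable[OF s(1)] bounded_L2_integrable[OF assms] by (intro fourier_int_bound) simp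
      also have "\<dots> \<le> L2_norm (\<lambda>x. s n x - f x) * K" unfolding K_def
        by (intro L1_le_L2) (use s N f sL2 in \<open>auto intro: in_L2_diff\<close>)
      finally show ?thesis by (simp add: L2_norm_commute[of f])
    qed
    then show "\<forall>\<^sub>F n in sequentially. norm (fourier_int (s n) \<xi> - fourier_int f \<xi>) \<le> L2_norm (\<lambda>x. f x - s n x) * K"
      by simp
  qed
  have iso: "L2_norm (\<lambda>\<xi>. fourier_int (s m) \<xi> - fourier_int (s n) \<xi>) = L2_norm (\<lambda>x. s m x - s n x)" for m n
  proof -
    have b: "box_step (\<lambda>x. s m x - s n x)"
      using box_step_sum[OF box_step_cmult[OF s(1)[of n], of "-1"] s(1)[of m]] by simp
    have "(\<lambda>\<xi>. fourier_int (s m) \<xi> - fourier_int (s n) \<xi>) = fourier_int (\<lambda>x. s m x - s n x)"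
      using fourier_int_diff[OF box_step_integrable[OF s(1)] box_step_integrable[OF s(1)]] by (simp add: fun_eq_iff)
    then show ?thesis
      using Plancherel_box_step[OF b b] unfolding L2_inner_self of_real_eq_iff by simp
  qed
  have Fs: "in_L2 (fourier_int (s n))" for n by (rule in_L2_fourier_int_box_step[OF s(1)])
  have fat: "in_L2 (\<lambda>\<xi>. fourier_int f \<xi> - fourier_int (s n) \<xi>) \<and> L2_norm (\<lambda>\<xi>. fourier_int f \<xi> - fourier_int (s n) \<xi>) \<le> 2 / real (Suc n)" for n
  proof -
    have "\<forall>\<^sub>F m in sequentially. L2_norm (\<lambda>\<xi>. fourier_int (s m) \<xi> - fourier_int (s n) \<xi>) \<le> 2 / real (Suc n)"
      using eventually_ge_at_top[of n]
    proof eventually_elim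
      case (elim m)
      have "L2_norm (\<lambda>x. s m x - s n x) \<le> L2_norm (\<lambda>x. s m x - f x) + L2_norm (\<lambda>x. f x - s n x)"
        by (intro L2_norm_triangle_diff f sL2)
      also have "\<dots> \<le> 1 / real (Suc m) + 1 / real (Suc n)"
        using s(3)[of m] s(3)[of n] by (simp add: L2_norm_commute[of f])
      also have "\<dots> \<le> 1 / real (Suc n) + 1 / real (Suc n)"
        using elim by (intro add_right_mono divide_left_mono) auto
      finally show ?case using iso by simp
    qed
    moreover have "AE \<xi> in lborel. (\<lambda>m. fourier_int (s m) \<xi> - fourier_int (s n) \<xi>) \<longlonglongrightarrow> fourier_int f \<xi> - fourier_int (s n) \<xi>"
      by (intro AE_I2 tendsto_intros pt)
    moreover have "(\<lambda>\<xi>. fourier_int f \<xi> - fourier_int (s n) \<xi>) \<in> borel_measurable borel"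
      using in_L2_measurable[OF f] in_L2_measurable[OF sL2] by measurable
    ultimately show ?thesis
      using L2_Fatou[of "\<lambda>m \<xi>. fourier_int (s m) \<xi> - fourier_int (s n) \<xi>"] in_L2_diff[OF Fs Fs] by blast
  qed
  have "in_L2 (fourier_int f)" using in_L2_add[OF conjunct1[OF fat[of 0]] Fs[of 0]] by simp
  moreover have "(\<lambda>n. L2_norm (\<lambda>x. fourier_int f x - fourier_int (s n) x)) \<longlonglongrightarrow> 0"
  proof (rule Lim_null_comparison)
    show "(\<lambda>n. 2 / real (Suc n)) \<longlonglongrightarrow> 0" using tendsto_mult_left[OF inv, of 2] by simp
  qed (use fat in \<open>auto intro!: always_eventually\<close>)
  ultimately show ?thesis using that s(1) sf by blast
qed

text \<open>Stated for the plain product, so that it covers both the inner product and the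
  multiplication formula, and for a general filter, so that it covers sequences and real truncation
  radii.\<close>

lemma L2_bilinear_tendsto:
  assumes "\<forall>\<^sub>F n in F. in_L2 (f n)" "in_L2 f'" "((\<lambda>n. L2_norm (\<lambda>x. f n x - f' x)) \<longlongrightarrow> 0) F"
    and "\<forall>\<^sub>F n in F. in_L2 (g n)" "in_L2 g'" "((\<lambda>n. L2_norm (\<lambda>x. g n x - g' x)) \<longlongrightarrow> 0) F"
  shows "((\<lambda>n. LINT x|lborel. f n x * g n x) \<longlongrightarrow> (LINT x|lborel. f' x * g' x)) F"
proof (rule LIM_zero_cancel, rule Lim_null_comparison)
  have "((\<lambda>n. L2_norm (\<lambda>x. f n x - f' x) * L2_norm (g n) + L2_norm f' * L2_norm (\<lambda>x. g n x - g' x)) \<longlongrightarrow> 0 * L2_norm g' + L2_norm f' * 0) F"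
    by (intro tendsto_intros assms L2_norm_tendsto)
  then show "((\<lambda>n. L2_norm (\<lambda>x. f n x - f' x) * L2_norm (g n) + L2_norm f' * L2_norm (\<lambda>x. g n x - g' x)) \<longlongrightarrow> 0) F"
    by simp
  show "\<forall>\<^sub>F n in F. norm ((LINT x|lborel. f n x * g n x) - (LINT x|lborel. f' x * g' x))
      \<le> L2_norm (\<lambda>x. f n x - f' x) * L2_norm (g n) + L2_norm f' * L2_norm (\<lambda>x. g n x - g' x)"
    using assms(1,4)
  proof eventually_elim
    case (elim n)
    have "(LINT x|lborel. f n x * g n x) - (LINT x|lborel. f' x * g' x) = (LINT x|lborel. f n x * g n x - f' x * g' x)"
      using elim assms by (simp add: L2_mult_integrable)
    also have "\<dots> = (LINT x|lborel. (f n x - f' x) * g n x + f' x * (g n x - g' x))"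
      by (simp add: algebra_simps)
    also have "\<dots> = (LINT x|lborel. (f n x - f' x) * g n x) + (LINT x|lborel. f' x * (g n x - g' x))"
      using elim assms by (intro Bochner_Integration.integral_add L2_mult_integrable in_L2_diff)
    finally have eq: "(LINT x|lborel. f n x * g n x) - (LINT x|lborel. f' x * g' x) = \<dots>" .
    show ?case unfolding eq
      by (rule norm_triangle_mono[OF L2_integral_bound[OF in_L2_diff[OF elim(1) assms(2)] elim(2)]
        L2_integral_bound[OF assms(2) in_L2_diff[OF elim(2) assms(5)]]])
  qed
qed

lemma L2_inner_tendsto:
  assumes "\<forall>\<^sub>F n in F. in_L2 (f n)" "in_L2 f'" "((\<lambda>n. L2_norm (\<lambda>x. f n x - f' x)) \<longlongrightarrow> 0) F"
    and "\<forall>\<^sub>F n in F. in_L2 (g n)" "in_L2 g'" "((\<lambda>n. L2_norm (\<lambda>x. g n x - g' x)) \<longlongrightarrow> 0) F"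
  shows "((\<lambda>n. L2_inner (f n) (g n)) \<longlongrightarrow> L2_inner f' g') F"
  unfolding L2_inner_def
proof (rule L2_bilinear_tendsto[OF assms(1-3)])
  show "\<forall>\<^sub>F n in F. in_L2 (\<lambda>x. cnj (g n x))" using assms(4) by eventually_elim (rule in_L2_cnj)
  show "in_L2 (\<lambda>x. cnj (g' x))" by (rule in_L2_cnj[OF assms(5)])
  have "L2_norm (\<lambda>x. cnj (g n x) - cnj (g' x)) = L2_norm (\<lambda>x. g n x - g' x)" for n
    by (rule L2_norm_cong) (simp flip: complex_cnj_diff)
  then show "((\<lambda>n. L2_norm (\<lambda>x. cnj (g n x) - cnj (g' x))) \<longlongrightarrow> 0) F" using assms(6) by simp
qed

lemma Plancherel_bounded:
  assumes "bounded_L2 f" "bounded_L2 g"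
  shows "L2_inner (fourier_int f) (fourier_int g) = L2_inner f g"
proof -
  obtain s where s: "\<And>n. box_step (s n)" "(\<lambda>n. L2_norm (\<lambda>x. f x - s n x)) \<longlonglongrightarrow> 0" "in_L2 (fourier_int f)"
    "(\<lambda>n. L2_norm (\<lambda>x. fourier_int f x - fourier_int (s n) x)) \<longlonglongrightarrow> 0"
    using fourier_int_bounded_L2[OF assms(1)] by blast
  obtain s' where s': "\<And>n. box_step (s' n)" "(\<lambda>n. L2_norm (\<lambda>x. g x - s' n x)) \<longlonglongrightarrow> 0" "in_L2 (fourier_int g)"
    "(\<lambda>n. L2_norm (\<lambda>x. fourier_int g x - fourier_int (s' n) x)) \<longlonglongrightarrow> 0"
    using fourier_int_bounded_L2[OF assms(2)] by blast
  have "(\<lambda>n. L2_inner (fourier_int (s n)) (fourier_int (s' n))) \<longlonglongrightarrow> L2_inner (fourier_int f) (fourier_int g)"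
    by (intro L2_inner_tendsto) (use s s' in_L2_fourier_int_box_step in \<open>auto simp: L2_norm_commute[of "fourier_int (_ _)"]\<close>)
  moreover have "(\<lambda>n. L2_inner (s n) (s' n)) \<longlonglongrightarrow> L2_inner f g"
    by (intro L2_inner_tendsto) (use s s' box_step_in_L2 assms bounded_L2_in_L2 in \<open>auto simp: L2_norm_commute[of _ f] L2_norm_commute[of _ g]\<close>)
  ultimately show ?thesis
    using LIMSEQ_unique by (simp add: Plancherel_box_step[OF s(1) s'(1)])
qed

lemma fourier_int_bounded_isometry: "bounded_L2 f \<Longrightarrow> L2_norm (fourier_int f) = L2_norm f"
  using Plancherel_bounded[of f f] unfolding L2_inner_self of_real_eq_iff by simp

section \<open>Truncation and the extension to all of L^2\<close>

definition truncate :: "real \<Rightarrow> (complex \<Rightarrow> complex) \<Rightarrow> complex \<Rightarrow> complex" where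
  "truncate R f x = indicator (cball 0 R) x * f x"

lemma bounded_L2_truncate:
  assumes "in_L2 f" shows "bounded_L2 (truncate R f)"
proof -
  obtain n :: nat where n: "R < real n" using reals_Archimedean2 by blast
  have "truncate R f x = 0" if "x \<notin> big_box n" for x
    using that n abs_Re_le_cmod[of x] abs_Im_le_cmod[of x] unfolding truncate_def
    by (force simp: indicator_def big_box_def in_box_complex_iff)
  moreover have "in_L2 (truncate R f)" unfolding truncate_def
    by (rule in_L2_mult_bounded[OF assms, where B = 1]) (auto simp: indicator_def)
  ultimately show ?thesis unfolding bounded_L2_def by blast
qed

lemmas in_L2_truncate = bounded_L2_in_L2[OF bounded_L2_truncate]
lemmas integrable_truncate = bounded_L2_integrable[OF bounded_L2_truncate]

lemma in_L2_fourier_int: "bounded_L2 f \<Longrightarrow> in_L2 (fourier_int f)"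
  using fourier_int_bounded_L2 by blast

lemma has_fourier_iff:
  "has_fourier f F \<longleftrightarrow> in_L2 f \<and> in_L2 F \<and>
     ((\<lambda>R. L2_norm (\<lambda>\<xi>. fourier_int (truncate R f) \<xi> - F \<xi>)) \<longlongrightarrow> 0) at_top"
proof -
  have "(LINT x:cball 0 R|lborel. cis (- (x \<bullet> \<xi>)) * f x) / of_real (2 * pi) = fourier_int (truncate R f) \<xi>" for R \<xi>
    unfolding fourier_int_def truncate_def set_lebesgue_integral_def
    by (rule arg_cong[where f = "\<lambda>x. x / _"], rule Bochner_Integration.integral_cong) (auto simp: indicator_def)
  then show ?thesis unfolding has_fourier_def by (simp add: L2_norm_commute[of F])
qed

lemma truncate_tendsto:
  assumes "in_L2 f" shows "((\<lambda>R. L2_norm (\<lambda>x. truncate R f x - f x)) \<longlongrightarrow> 0) at_top"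
proof (rule tendsto_at_topI_sequentially)
  fix X :: "nat \<Rightarrow> real" assume X: "filterlim X at_top sequentially"
  show "(\<lambda>n. L2_norm (\<lambda>x. truncate (X n) f x - f x)) \<longlonglongrightarrow> 0"
  proof (rule L2_dominated_convergence[where h = f])
    show "AE x in lborel. (\<lambda>n. truncate (X n) f x) \<longlonglongrightarrow> f x"
    proof (rule AE_I2, rule tendsto_eventually)
      fix x
      have "\<forall>\<^sub>F n in sequentially. X n \<ge> cmod x" using X by (simp add: filterlim_at_top)
      then show "\<forall>\<^sub>F n in sequentially. truncate (X n) f x = f x"
        by eventually_elim (simp add: truncate_def)
    qed
  qed (use assms in_L2_truncate in_L2_measurable in \<open>auto simp: truncate_def indicator_def\<close>)
qed

lemma fourier_int_diff_norm:
  assumes "bounded_L2 f" "bounded_L2 g"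
  shows "L2_norm (\<lambda>\<xi>. fourier_int f \<xi> - fourier_int g \<xi>) = L2_norm (\<lambda>x. f x - g x)"
proof -
  have "(\<lambda>\<xi>. fourier_int f \<xi> - fourier_int g \<xi>) = fourier_int (\<lambda>x. f x - g x)"
    using fourier_int_diff[OF bounded_L2_integrable bounded_L2_integrable] assms by (simp add: fun_eq_iff)
  then show ?thesis using fourier_int_bounded_isometry[OF bounded_L2_diff[OF assms]] by simp
qed

lemma cmod_1_mult_cnj: "cmod a = 1 \<Longrightarrow> a * cnj a = 1"
  by (simp add: complex_norm_square[symmetric])

lemma inner_mult_unit:
  assumes "cmod a = 1" shows "(a * x) \<bullet> (a * y) = x \<bullet> y"
proof -
  have i: "u \<bullet> v = Re (u * cnj v)" for u v by (simp add: inner_complex_def)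
  have "(a * x) * cnj (a * y) = (a * cnj a) * (x * cnj y)" by (simp only: complex_cnj_mult mult_ac)
  then have "(a * x) * cnj (a * y) = x * cnj y" unfolding cmod_1_mult_cnj[OF assms] by simp
  then show ?thesis unfolding i by (rule arg_cong)
qed

text \<open>The form in which equivariance enters a change of variables: rotation by a unit a
  multiplies by the constant \<open>ang l a\<close>.\<close>

lemma equivariant_rotate:
  assumes "equivariant l f" "cmod a = 1" "x \<noteq> 0"
  shows "f (a * x) = ang l a * f x"
proof -
  have a: "a \<noteq> 0" "sgn a = a" using assms(2) by (auto simp: sgn_eq)
  have "f (a * x) = f (of_real (cmod (a * x))) * ang l (a * x)"
    using assms a unfolding equivariant_iff by (metis mult_eq_0_iff)
  also have "\<dots> = f (of_real (cmod x)) * (ang l a * ang l x)"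
    using assms(2) by (simp add: norm_mult ang_def sgn_mult power_int_mult_distrib)
  also have "\<dots> = ang l a * f x"
    using assms(1,3) unfolding equivariant_iff by (metis mult.assoc mult.commute)
  finally show ?thesis .
qed

text \<open>Rotating the variable of integration by the direction of \<xi> moves \<xi> to the
  positive real axis, because Lebesgue measure and the inner product are rotation invariant; the
  factor released by f is \<open>ang l \<xi>\<close>.\<close>

lemma equivariant_fourier_int:
  assumes eq: "equivariant l f" and [measurable]: "f \<in> borel_measurable borel"
  shows "equivariant l (fourier_int f)"
  unfolding equivariant_iff
proof (intro allI impI)
  fix \<xi> :: complex assume \<xi>: "\<xi> \<noteq> 0"
  define a where "a = sgn \<xi>"
  have a: "cmod a = 1" using \<xi> by (simp add: a_def norm_sgn)
  have \<xi>a: "\<xi> = a * of_real (cmod \<xi>)" using \<xi> by (simp add: a_def sgn_eq)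
  have "(LINT x|lborel. cis (- (x \<bullet> \<xi>)) * f x) = (LINT x|lborel. cis (- ((a * x) \<bullet> \<xi>)) * f (a * x))"
    by (rule integral_rotate[OF a, symmetric]) measurable
  also have "\<dots> = (LINT x|lborel. ang l a * (cis (- (x \<bullet> of_real (cmod \<xi>))) * f x))"
  proof (rule integral_cong_AE)
    show "AE x in lborel. cis (- ((a * x) \<bullet> \<xi>)) * f (a * x) = ang l a * (cis (- (x \<bullet> of_real (cmod \<xi>))) * f x)"
      using AE_lborel_singleton[of "0::complex"]
    proof eventually_elim
      case (elim x)
      have "(a * x) \<bullet> \<xi> = x \<bullet> of_real (cmod \<xi>)" by (subst \<xi>a) (rule inner_mult_unit[OF a])
      then show ?case using equivariant_rotate[OF eq a elim] by simp
    qed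
  qed measurable
  finally have "fourier_int f \<xi> = ang l a * fourier_int f (of_real (cmod \<xi>))"
    by (simp add: fourier_int_def)
  moreover have "ang l a = ang l \<xi>" by (simp add: ang_def a_def)
  ultimately show "fourier_int f \<xi> = fourier_int f (of_real (cmod \<xi>)) * ang l \<xi>" by simp
qed

text \<open>The isometry bounds the distance between the transforms of two truncations by the two
  truncation errors. Integer radii therefore give a Cauchy sequence, and letting the second radius
  tend to infinity extends the limit to real radii. Equivariance passes through truncation,
  transform and limit.\<close>

lemma has_fourier_exists:
  assumes f: "in_L2 f"
  obtains F where "has_fourier f F" "\<And>l. equivariant l f \<Longrightarrow> equivariant l F"
proof -
  define T where "T R = fourier_int (truncate R f)" for R
  define e where "e R = L2_norm (\<lambda>x. truncate R f x - f x)" for R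
  have T: "in_L2 (T R)" for R unfolding T_def by (rule in_L2_fourier_int[OF bounded_L2_truncate[OF f]])
  have TT: "L2_norm (\<lambda>x. T R x - T S x) \<le> e R + e S" for R S
    unfolding T_def fourier_int_diff_norm[OF bounded_L2_truncate[OF f] bounded_L2_truncate[OF f]] e_def
    using L2_norm_triangle_diff[OF in_L2_truncate[OF f] f in_L2_truncate[OF f], of R S]
    by (simp add: L2_norm_commute[of f])
  have e: "(e \<longlongrightarrow> 0) at_top" unfolding e_def by (rule truncate_tendsto[OF f])
  then have e': "(\<lambda>n. e (real n)) \<longlonglongrightarrow> 0" by (rule filterlim_compose[OF _ filterlim_real_sequentially])
  have "\<exists>N. \<forall>m\<ge>N. \<forall>n\<ge>N. L2_norm (\<lambda>x. T (real m) x - T (real n) x) < \<epsilon>" if "\<epsilon> > 0" for \<epsilon>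
  proof -
    have "\<epsilon>/2 > 0" using that by simp
    from order_tendstoD(2)[OF e' this] obtain N where N: "\<And>n. n \<ge> N \<Longrightarrow> e (real n) < \<epsilon>/2"
      by (auto simp: eventually_sequentially)
    have "L2_norm (\<lambda>x. T (real m) x - T (real n) x) < \<epsilon>" if "m \<ge> N" "n \<ge> N" for m n
      using TT[of "real m" "real n"] N[OF that(1)] N[OF that(2)] by linarith
    then show ?thesis by blast
  qed
  then obtain F where F: "in_L2 F" "(\<lambda>n. L2_norm (\<lambda>x. T (real n) x - F x)) \<longlonglongrightarrow> 0"
    "\<And>l. (\<And>n. equivariant l (T (real n))) \<Longrightarrow> equivariant l F"
    by (rule L2_complete[of "\<lambda>n. T (real n)", OF T]) blast+
  have "((\<lambda>R. L2_norm (\<lambda>\<xi>. T R \<xi> - F \<xi>)) \<longlongrightarrow> 0) at_top"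
  proof (rule Lim_null_comparison[OF _ e], rule always_eventually, rule allI)
    fix R
    have "L2_norm (\<lambda>\<xi>. T R \<xi> - F \<xi>) \<le> e R + e (real n) + L2_norm (\<lambda>x. T (real n) x - F x)" for n
      using L2_norm_triangle_diff[OF T[of R] T[of "real n"] F(1)] TT[of R "real n"] by linarith
    moreover have "(\<lambda>n. e R + e (real n) + L2_norm (\<lambda>x. T (real n) x - F x)) \<longlonglongrightarrow> e R + 0 + 0"
      by (intro tendsto_intros e' F)
    ultimately have "L2_norm (\<lambda>\<xi>. T R \<xi> - F \<xi>) \<le> e R + 0 + 0"
      by (intro LIMSEQ_le_const[of _ _ "L2_norm (\<lambda>\<xi>. T R \<xi> - F \<xi>)"]) auto
    then show "norm (L2_norm (\<lambda>\<xi>. T R \<xi> - F \<xi>)) \<le> e R" by simp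
  qed
  then have "has_fourier f F" using f F(1) by (simp add: has_fourier_iff T_def)
  moreover have "equivariant l F" if "equivariant l f" for l
  proof (rule F(3))
    fix n :: nat
    have "equivariant l (truncate (real n) f)"
      unfolding equivariant_iff
    proof (intro allI impI)
      fix x :: complex assume "x \<noteq> 0"
      then have "f x = f (of_real (cmod x)) * ang l x" using that unfolding equivariant_iff by blast
      then have "truncate (real n) f x = indicator (cball 0 (real n)) x * (f (of_real (cmod x)) * ang l x)"
        unfolding truncate_def by (rule arg_cong)
      then show "truncate (real n) f x = truncate (real n) f (of_real (cmod x)) * ang l x"
        by (simp add: truncate_def indicator_def)
    qed
    then show "equivariant l (T (real n))"
      unfolding T_def by (rule equivariant_fourier_int) (rule in_L2_measurable[OF in_L2_truncate[OF f]])
  qed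
  ultimately show ?thesis using that by blast
qed

lemma has_fourier_in_L2: "has_fourier f F \<Longrightarrow> in_L2 f" "has_fourier f F \<Longrightarrow> in_L2 F"
  by (auto simp: has_fourier_def)

lemma eventually_in_L2_fourier_int_truncate: "in_L2 f \<Longrightarrow> \<forall>\<^sub>F R in F. in_L2 (fourier_int (truncate R f))"
  by (intro always_eventually allI in_L2_fourier_int bounded_L2_truncate)

lemma has_fourier_unique:
  assumes "has_fourier f F" "has_fourier f G" shows "AE \<xi> in lborel. F \<xi> = G \<xi>"
  by (rule L2_tendsto_unique[of at_top "\<lambda>R. fourier_int (truncate R f)"])
    (use assms in \<open>auto simp: has_fourier_iff eventually_in_L2_fourier_int_truncate\<close>)

lemma has_fourier_fourier: "in_L2 f \<Longrightarrow> has_fourier f (fourier f)"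
proof -
  assume "in_L2 f"
  then obtain F where "has_fourier f F" using has_fourier_exists by blast
  then show "has_fourier f (fourier f)" unfolding fourier_def by (metis someI)
qed

lemma in_L2_fourier: "in_L2 f \<Longrightarrow> in_L2 (fourier f)"
  using has_fourier_fourier has_fourier_in_L2 by blast

lemma fourier_AE: "has_fourier f F \<Longrightarrow> AE \<xi> in lborel. fourier f \<xi> = F \<xi>"
  using has_fourier_unique has_fourier_fourier has_fourier_in_L2(1) by blast

lemma has_fourier_inner:
  assumes "has_fourier f F" "has_fourier g G" shows "L2_inner F G = L2_inner f g"
proof -
  have "((\<lambda>R. L2_inner (fourier_int (truncate R f)) (fourier_int (truncate R g))) \<longlongrightarrow> L2_inner F G) at_top"
    by (intro L2_inner_tendsto) (use assms in \<open>auto simp: has_fourier_iff eventually_in_L2_fourier_int_truncate\<close>)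
  moreover have "((\<lambda>R. L2_inner (truncate R f) (truncate R g)) \<longlongrightarrow> L2_inner f g) at_top"
    by (intro L2_inner_tendsto truncate_tendsto) (use assms in \<open>auto simp: has_fourier_iff in_L2_truncate\<close>)
  ultimately show ?thesis
    using assms by (simp add: Plancherel_bounded[OF bounded_L2_truncate bounded_L2_truncate] has_fourier_iff
        tendsto_unique[OF trivial_limit_at_top_linorder])
qed

lemma has_fourier_norm: "has_fourier f F \<Longrightarrow> L2_norm F = L2_norm f"
  using has_fourier_inner[of f F f F] unfolding L2_inner_self of_real_eq_iff by simp

lemma has_fourier_add:
  assumes "has_fourier f F" "has_fourier g G"
  shows "has_fourier (\<lambda>x. f x + g x) (\<lambda>\<xi>. F \<xi> + G \<xi>)"
  unfolding has_fourier_iff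
proof (intro conjI)
  have L2: "in_L2 f" "in_L2 g" "in_L2 F" "in_L2 G" using assms has_fourier_in_L2 by auto
  then show "in_L2 (\<lambda>x. f x + g x)" "in_L2 (\<lambda>\<xi>. F \<xi> + G \<xi>)" by (auto intro: in_L2_add)
  have eq: "truncate R (\<lambda>x. f x + g x) = (\<lambda>x. truncate R f x + truncate R g x)" for R
    by (simp add: truncate_def fun_eq_iff algebra_simps)
  have lim: "((\<lambda>R. L2_norm (\<lambda>\<xi>. fourier_int (truncate R f) \<xi> - F \<xi>) + L2_norm (\<lambda>\<xi>. fourier_int (truncate R g) \<xi> - G \<xi>)) \<longlongrightarrow> 0 + 0) at_top"
    using assms unfolding has_fourier_iff by (intro tendsto_add) auto
  have "L2_norm (\<lambda>\<xi>. fourier_int (truncate R (\<lambda>x. f x + g x)) \<xi> - (F \<xi> + G \<xi>)) \<le>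
     L2_norm (\<lambda>\<xi>. fourier_int (truncate R f) \<xi> - F \<xi>) + L2_norm (\<lambda>\<xi>. fourier_int (truncate R g) \<xi> - G \<xi>)" for R
  proof -
    have "(\<lambda>\<xi>. fourier_int (truncate R (\<lambda>x. f x + g x)) \<xi> - (F \<xi> + G \<xi>)) =
       (\<lambda>\<xi>. (fourier_int (truncate R f) \<xi> - F \<xi>) + (fourier_int (truncate R g) \<xi> - G \<xi>))"
      using L2 by (simp add: eq fourier_int_add integrable_truncate fun_eq_iff)
    then show ?thesis
      using L2 L2_norm_triangle[of "\<lambda>\<xi>. fourier_int (truncate R f) \<xi> - F \<xi>" "\<lambda>\<xi>. fourier_int (truncate R g) \<xi> - G \<xi>"]
      by (simp add: in_L2_diff in_L2_fourier_int bounded_L2_truncate)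
  qed
  then show "((\<lambda>R. L2_norm (\<lambda>\<xi>. fourier_int (truncate R (\<lambda>x. f x + g x)) \<xi> - (F \<xi> + G \<xi>))) \<longlongrightarrow> 0) at_top"
    by (intro Lim_null_comparison[OF _ lim[unfolded add_0]]) (auto intro!: always_eventually)
qed

lemma has_fourier_cmult:
  assumes "has_fourier f F" shows "has_fourier (\<lambda>x. c * f x) (\<lambda>\<xi>. c * F \<xi>)"
  unfolding has_fourier_iff
proof (intro conjI)
  show "in_L2 (\<lambda>x. c * f x)" "in_L2 (\<lambda>\<xi>. c * F \<xi>)" using assms has_fourier_in_L2 by (auto intro: in_L2_cmult)
  have "(\<lambda>\<xi>. fourier_int (truncate R (\<lambda>x. c * f x)) \<xi> - c * F \<xi>) = (\<lambda>\<xi>. c * (fourier_int (truncate R f) \<xi> - F \<xi>))" for R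
  proof -
    have "truncate R (\<lambda>x. c * f x) = (\<lambda>x. c * truncate R f x)" by (simp add: truncate_def fun_eq_iff)
    then show ?thesis by (simp only: fourier_int_cmult right_diff_distrib)
  qed
  moreover have "((\<lambda>R. cmod c * L2_norm (\<lambda>\<xi>. fourier_int (truncate R f) \<xi> - F \<xi>)) \<longlongrightarrow> cmod c * 0) at_top"
    using assms unfolding has_fourier_iff by (intro tendsto_mult tendsto_const) auto
  ultimately show "((\<lambda>R. L2_norm (\<lambda>\<xi>. fourier_int (truncate R (\<lambda>x. c * f x)) \<xi> - c * F \<xi>)) \<longlongrightarrow> 0) at_top"
    by (simp add: L2_norm_cmult)
qed

lemma has_fourier_diff:
  assumes "has_fourier f F" "has_fourier g G"
  shows "has_fourier (\<lambda>x. f x - g x) (\<lambda>\<xi>. F \<xi> - G \<xi>)"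
  using has_fourier_add[OF assms(1) has_fourier_cmult[OF assms(2), of "-1"]] by simp

lemma has_fourier_bounded:
  assumes "bounded_L2 f" shows "has_fourier f (fourier_int f)"
  unfolding has_fourier_iff
proof (intro conjI)
  have f: "in_L2 f" using assms by (rule bounded_L2_in_L2)
  show "in_L2 f" "in_L2 (fourier_int f)" using assms f in_L2_fourier_int by auto
  show "((\<lambda>R. L2_norm (\<lambda>\<xi>. fourier_int (truncate R f) \<xi> - fourier_int f \<xi>)) \<longlongrightarrow> 0) at_top"
    unfolding fourier_int_diff_norm[OF bounded_L2_truncate[OF f] assms] by (rule truncate_tendsto[OF f])
qed

text \<open>Allows the almost everywhere identity supplied by inversion to be turned into a
  statement about a prescribed representative.\<close>

lemma has_fourier_cong_AE:
  assumes "has_fourier f F" "g \<in> borel_measurable borel" "AE x in lborel. f x = g x"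
    and "G \<in> borel_measurable borel" "AE x in lborel. F x = G x"
  shows "has_fourier g G"
proof -
  have L2: "in_L2 f" "in_L2 F" using assms has_fourier_in_L2 by auto
  then have L2': "in_L2 g" "in_L2 G" using assms in_L2_cong_AE by blast+
  note [measurable] = L2(1)[THEN in_L2_measurable] L2(2)[THEN in_L2_measurable] assms(2,4)
  have "fourier_int (truncate R f) \<xi> = fourier_int (truncate R g) \<xi>" for R \<xi>
  proof -
    have "(LINT x|lborel. cis (- (x \<bullet> \<xi>)) * truncate R f x) = (LINT x|lborel. cis (- (x \<bullet> \<xi>)) * truncate R g x)"
    proof (rule integral_cong_AE)
      show "(\<lambda>x. cis (- (x \<bullet> \<xi>)) * truncate R f x) \<in> borel_measurable lborel"
        "(\<lambda>x. cis (- (x \<bullet> \<xi>)) * truncate R g x) \<in> borel_measurable lborel"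
        using in_L2_measurable[OF in_L2_truncate[OF L2(1)]] in_L2_measurable[OF in_L2_truncate[OF L2'(1)]]
        by simp_all
    qed (use assms(3) in \<open>auto simp: truncate_def\<close>)
    then show ?thesis by (simp add: fourier_int_def)
  qed
  then have eq: "fourier_int (truncate R f) = fourier_int (truncate R g)" for R by blast
  have [measurable]: "fourier_int (truncate R g) \<in> borel_measurable borel" for R
    using L2' by (intro in_L2_measurable in_L2_fourier_int bounded_L2_truncate)
  have "L2_norm (\<lambda>\<xi>. fourier_int (truncate R f) \<xi> - F \<xi>) = L2_norm (\<lambda>\<xi>. fourier_int (truncate R g) \<xi> - G \<xi>)" for R
    unfolding eq by (rule L2_norm_cong_AE) (use assms(5) in auto)
  then show ?thesis using assms(1) L2' unfolding has_fourier_iff by simp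
qed

section \<open>Reflection, conjugation, inversion and surjectivity\<close>

lemma integral_uminus_complex:
  fixes f :: "complex \<Rightarrow> complex"
  shows "f \<in> borel_measurable borel \<Longrightarrow> (LINT z|lborel. f (- z)) = (LINT z|lborel. f z)"
  using integral_rotate[of "-1" f] by simp

lemma in_L2_reflect: "in_L2 f \<Longrightarrow> in_L2 (\<lambda>x. f (- x))"
  using L2_scale(1)[of f "-1"] by simp

lemma L2_norm_reflect: "in_L2 f \<Longrightarrow> L2_norm (\<lambda>x. f (- x)) = L2_norm f"
  using L2_scale(2)[of f "-1"] by simp

lemma has_fourier_reflect:
  assumes "has_fourier f F" shows "has_fourier (\<lambda>x. f (- x)) (\<lambda>\<xi>. F (- \<xi>))"
  unfolding has_fourier_iff
proof (intro conjI)
  have L2: "in_L2 f" "in_L2 F" using assms has_fourier_in_L2 by auto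
  then show "in_L2 (\<lambda>x. f (- x))" "in_L2 (\<lambda>\<xi>. F (- \<xi>))" by (auto intro: in_L2_reflect)
  have "fourier_int (truncate R (\<lambda>x. f (- x))) \<xi> = fourier_int (truncate R f) (- \<xi>)" for R \<xi>
  proof -
    have [measurable]: "truncate R f \<in> borel_measurable borel" using in_L2_measurable[OF in_L2_truncate[OF L2(1)]] .
    have "(LINT x|lborel. cis (- (x \<bullet> \<xi>)) * truncate R (\<lambda>x. f (- x)) x) =
        (LINT x|lborel. cis (- ((- x) \<bullet> (- \<xi>))) * truncate R f (- x))"
      by (simp add: truncate_def indicator_def)
    also have "\<dots> = (LINT x|lborel. cis (- (x \<bullet> (- \<xi>))) * truncate R f x)"
      by (rule integral_uminus_complex) measurable
    finally show ?thesis by (simp add: fourier_int_def)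
  qed
  then have "L2_norm (\<lambda>\<xi>. fourier_int (truncate R (\<lambda>x. f (- x))) \<xi> - F (- \<xi>)) = L2_norm (\<lambda>\<xi>. fourier_int (truncate R f) \<xi> - F \<xi>)" for R
    using L2 by (subst L2_norm_reflect[symmetric]) (auto intro!: in_L2_diff in_L2_fourier_int bounded_L2_truncate)
  then show "((\<lambda>R. L2_norm (\<lambda>\<xi>. fourier_int (truncate R (\<lambda>x. f (- x))) \<xi> - F (- \<xi>))) \<longlongrightarrow> 0) at_top"
    using assms unfolding has_fourier_iff by simp
qed

lemma has_fourier_cnj_reflect:
  assumes "has_fourier f F" shows "has_fourier (\<lambda>x. cnj (f (- x))) (\<lambda>\<xi>. cnj (F \<xi>))"
  unfolding has_fourier_iff
proof (intro conjI)
  have L2: "in_L2 f" "in_L2 F" using assms has_fourier_in_L2 by auto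
  then show "in_L2 (\<lambda>x. cnj (f (- x)))" "in_L2 (\<lambda>\<xi>. cnj (F \<xi>))" by (auto intro: in_L2_reflect in_L2_cnj)
  have "fourier_int (truncate R (\<lambda>x. cnj (f (- x)))) \<xi> = cnj (fourier_int (truncate R f) \<xi>)" for R \<xi>
  proof -
    have [measurable]: "truncate R f \<in> borel_measurable borel" using in_L2_measurable[OF in_L2_truncate[OF L2(1)]] .
    have "(LINT x|lborel. cis (- (x \<bullet> \<xi>)) * truncate R (\<lambda>x. cnj (f (- x))) x) =
        (LINT x|lborel. cnj (cis (- ((- x) \<bullet> \<xi>)) * truncate R f (- x)))"
      by (rule Bochner_Integration.integral_cong) (auto simp: truncate_def indicator_def cis_cnj)
    also have "\<dots> = (LINT x|lborel. cnj (cis (- (x \<bullet> \<xi>)) * truncate R f x))"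
      by (rule integral_uminus_complex) measurable
    also have "\<dots> = cnj (LINT x|lborel. (cis (- (x \<bullet> \<xi>)) * truncate R f x))"
      by (rule Bochner_Integration.integral_cnj)
    finally show ?thesis by (simp add: fourier_int_def)
  qed
  then have "L2_norm (\<lambda>\<xi>. fourier_int (truncate R (\<lambda>x. cnj (f (- x)))) \<xi> - cnj (F \<xi>)) = L2_norm (\<lambda>\<xi>. fourier_int (truncate R f) \<xi> - F \<xi>)" for R
    by (intro L2_norm_cong) (simp flip: complex_cnj_diff)
  then show "((\<lambda>R. L2_norm (\<lambda>\<xi>. fourier_int (truncate R (\<lambda>x. cnj (f (- x)))) \<xi> - cnj (F \<xi>))) \<longlongrightarrow> 0) at_top"
    using assms unfolding has_fourier_iff by simp
qed

text \<open>Fubini for the symmetric kernel of modulus 1; the double integral converges absolutely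
  because both functions are integrable.\<close>

lemma fourier_int_multiplication:
  assumes "integrable lborel f" "integrable lborel g"
  shows "(LINT x|lborel. fourier_int f x * g x) = (LINT x|lborel. f x * fourier_int g x)"
proof -
  have [measurable]: "f \<in> borel_measurable borel" "g \<in> borel_measurable borel"
    using assms borel_measurable_integrable by auto
  let ?h = "\<lambda>x \<xi>. cis (- (x \<bullet> \<xi>)) * f x * g \<xi>"
  have "integrable (lborel \<Otimes>\<^sub>M lborel) (case_prod ?h)"
  proof (rule lborel_pair.Fubini_integrable)
    show "integrable lborel (\<lambda>x. LINT y|lborel. norm (case_prod ?h (x, y)))"
      using assms by (simp add: norm_mult)
    show "AE x in lborel. integrable lborel (\<lambda>y. case_prod ?h (x, y))"
    proof (rule AE_I2)
      fix x
      have "integrable lborel (\<lambda>y. f x * (cis (- (x \<bullet> y)) * g y))"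
        by (intro integrable_mult_right integrable_cis_mult assms) measurable
      then show "integrable lborel (\<lambda>y. case_prod ?h (x, y))" by (simp add: mult_ac)
    qed
  qed measurable
  from lborel_pair.Fubini_integral[OF this]
  have "(LINT y|lborel. (LINT x|lborel. cis (- (x \<bullet> y)) * f x) * g y) = (LINT x|lborel. f x * (LINT y|lborel. cis (- (y \<bullet> x)) * g y))"
    by (simp add: mult_ac inner_commute flip: integral_mult_right_zero integral_mult_left_zero)
  then show ?thesis by (simp add: fourier_int_def)
qed

lemma has_fourier_multiplication:
  assumes "has_fourier f F" "has_fourier g G"
  shows "(LINT x|lborel. F x * g x) = (LINT x|lborel. f x * G x)"
proof -
  have "((\<lambda>R. LINT x|lborel. fourier_int (truncate R f) x * truncate R g x) \<longlongrightarrow> (LINT x|lborel. F x * g x)) at_top"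
    by (intro L2_bilinear_tendsto truncate_tendsto) (use assms in \<open>auto simp: has_fourier_iff eventually_in_L2_fourier_int_truncate in_L2_truncate\<close>)
  moreover have "((\<lambda>R. LINT x|lborel. truncate R f x * fourier_int (truncate R g) x) \<longlongrightarrow> (LINT x|lborel. f x * G x)) at_top"
    by (intro L2_bilinear_tendsto truncate_tendsto) (use assms in \<open>auto simp: has_fourier_iff eventually_in_L2_fourier_int_truncate in_L2_truncate\<close>)
  ultimately show ?thesis
    using assms by (simp add: fourier_int_multiplication integrable_truncate has_fourier_iff
        tendsto_unique[OF trivial_limit_at_top_linorder])
qed

text \<open>
  With \<open>h = cnj (g (- x))\<close> the transform of \<open>h\<close> is the conjugate of that of \<open>g\<close>, so that the
  multiplication formula and Plancherel's identity give
  \<open>\<integral>F (F f) h = \<integral>F f cnj (F g) = \<integral>f cnj g = \<integral>f (- x) h\<close> for every \<open>h\<close> in \<open>L\<^sup>2\<close>.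
\<close>

theorem fourier_inversion:
  assumes "has_fourier f F" "has_fourier F G" shows "AE x in lborel. G x = f (- x)"
proof -
  have L2: "in_L2 f" "in_L2 F" "in_L2 G" using assms has_fourier_in_L2 by auto
  define D where "D x = G x - f (- x)" for x
  have D: "in_L2 D" unfolding D_def by (intro in_L2_diff in_L2_reflect L2)
  have Dr: "in_L2 (\<lambda>x. D (- x))" by (rule in_L2_reflect[OF D])
  obtain H where H: "has_fourier (\<lambda>x. D (- x)) H" using has_fourier_exists[OF Dr] by blast
  have H': "has_fourier (\<lambda>x. cnj (D x)) (\<lambda>\<xi>. cnj (H \<xi>))"
    using has_fourier_cnj_reflect[OF H] by simp
  have "(LINT x|lborel. G x * cnj (D x)) = L2_inner F H"
    using has_fourier_multiplication[OF assms(2) H'] unfolding L2_inner_def .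
  also have "\<dots> = L2_inner f (\<lambda>x. D (- x))" by (rule has_fourier_inner[OF assms(1) H])
  also have "\<dots> = (LINT x|lborel. f (- x) * cnj (D x))"
    unfolding L2_inner_def using integral_uminus_complex[of "\<lambda>x. f (- x) * cnj (D x)"]
      in_L2_measurable[OF in_L2_reflect[OF L2(1)]] in_L2_measurable[OF D] by simp
  finally have "(LINT x|lborel. G x * cnj (D x)) - (LINT x|lborel. f (- x) * cnj (D x)) = 0" by simp
  moreover have "(LINT x|lborel. G x * cnj (D x)) - (LINT x|lborel. f (- x) * cnj (D x)) = (LINT x|lborel. G x * cnj (D x) - f (- x) * cnj (D x))"
    by (intro Bochner_Integration.integral_diff[symmetric] L2_inner_integrable L2 D in_L2_reflect)
  ultimately have "L2_inner D D = 0" unfolding L2_inner_def by (simp add: D_def algebra_simps)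
  then have "L2_norm D = 0" unfolding L2_inner_self by simp
  from L2_norm_0_imp_AE[OF D this] show ?thesis by (simp add: D_def)
qed

text \<open>The preimage is the reflected transform of G: by inversion, transforming twice reflects,
  and a further reflection undoes this.\<close>

theorem fourier_surj:
  assumes "in_L2 G"
  obtains f where "has_fourier f G" "\<And>l. equivariant l G \<Longrightarrow> equivariant l f"
proof -
  obtain H where H: "has_fourier G H" "\<And>l. equivariant l G \<Longrightarrow> equivariant l H"
    using has_fourier_exists[OF assms] by blast
  have HL2: "in_L2 H" using H has_fourier_in_L2 by blast
  obtain K where K: "has_fourier H K" using has_fourier_exists[OF HL2] by blast
  have "AE x in lborel. K x = G (- x)" by (rule fourier_inversion[OF H(1) K])
  then have "has_fourier H (\<lambda>x. G (- x))"
    by (intro has_fourier_cong_AE[OF K]) (use HL2 assms in \<open>auto intro: in_L2_measurable in_L2_reflect\<close>)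
  from has_fourier_reflect[OF this] have "has_fourier (\<lambda>x. H (- x)) G" by simp
  \<comment> \<open>Reflection is rotation by -1, which contributes the same constant
    \<open>ang l (-1)\<close> at x and at |x|.\<close>
  moreover have "equivariant l (\<lambda>x. H (- x))" if "equivariant l G" for l
    unfolding equivariant_iff
  proof (intro allI impI)
    fix x :: complex assume x: "x \<noteq> 0"
    have e: "equivariant l H" using H(2) that by blast
    have "H (- x) = ang l (-1) * H x" using equivariant_rotate[OF e, of "-1" x] x by simp
    moreover have "H (- of_real (cmod x)) = ang l (-1) * H (of_real (cmod x))"
      using equivariant_rotate[OF e, of "-1" "of_real (cmod x)"] x by simp
    moreover have "H x = H (of_real (cmod x)) * ang l x" using e x unfolding equivariant_iff by blast
    ultimately show "H (- x) = H (- of_real (cmod x)) * ang l x" by simp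
  qed
  ultimately show ?thesis using that by blast
qed

section \<open>The free evolution on the Fourier side\<close>

lemma fourier_AE_bounded: "bounded_L2 f \<Longrightarrow> AE \<xi> in lborel. fourier f \<xi> = fourier_int f \<xi>"
  by (rule fourier_AE[OF has_fourier_bounded])

lemma L2_norm_fourier: "in_L2 f \<Longrightarrow> L2_norm (fourier f) = L2_norm f"
  using has_fourier_norm has_fourier_fourier by blast

text \<open>The choice in \<open>free_evol\<close> is not vacuous: multiplication by a phase
  preserves L^2, and surjectivity supplies a function with the resulting transform.\<close>

lemma free_evol:
  assumes "in_L2 f"
  shows "in_L2 (free_evol t f)" "AE \<xi> in lborel. fourier (free_evol t f) \<xi> = cis (- t * (cmod \<xi>)\<^sup>2) * fourier f \<xi>"
proof -
  have [measurable]: "fourier f \<in> borel_measurable borel" using in_L2_measurable[OF in_L2_fourier[OF assms]] .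
  have "in_L2 (\<lambda>\<xi>. cis (- t * (cmod \<xi>)\<^sup>2) * fourier f \<xi>)"
    by (rule in_L2_mult_bounded[OF in_L2_fourier[OF assms], where B = 1]) auto
  then obtain g where g: "has_fourier g (\<lambda>\<xi>. cis (- t * (cmod \<xi>)\<^sup>2) * fourier f \<xi>)"
    using fourier_surj by blast
  then have "\<exists>g. in_L2 g \<and> (AE \<xi> in lborel. fourier g \<xi> = cis (- t * (cmod \<xi>)\<^sup>2) * fourier f \<xi>)"
    using fourier_AE has_fourier_in_L2 by blast
  from someI_ex[OF this] show "in_L2 (free_evol t f)" "AE \<xi> in lborel. fourier (free_evol t f) \<xi> = cis (- t * (cmod \<xi>)\<^sup>2) * fourier f \<xi>"
    unfolding free_evol_def by auto
qed

text \<open>Moves the scattering norm to the Fourier side, for arbitrary representatives V and F of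
  the transforms.\<close>

lemma L2_norm_minus_free_evol:
  assumes v: "has_fourier v V" and f: "has_fourier f F"
  shows "L2_norm (\<lambda>x. v x - free_evol t f x) = L2_norm (\<lambda>\<xi>. V \<xi> - cis (- t * (cmod \<xi>)\<^sup>2) * F \<xi>)"
proof -
  have L2: "in_L2 v" "in_L2 V" "in_L2 f" "in_L2 F" using assms has_fourier_in_L2 by auto
  note fe = free_evol[OF L2(3), of t]
  note [measurable] = L2[THEN in_L2_measurable] in_L2_measurable[OF in_L2_fourier[OF fe(1)]]
  have "L2_norm (\<lambda>x. v x - free_evol t f x) = L2_norm (\<lambda>\<xi>. V \<xi> - fourier (free_evol t f) \<xi>)"
    by (rule has_fourier_norm[symmetric, OF has_fourier_diff[OF v has_fourier_fourier[OF fe(1)]]])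
  also have "\<dots> = L2_norm (\<lambda>\<xi>. V \<xi> - cis (- t * (cmod \<xi>)\<^sup>2) * F \<xi>)"
    by (rule L2_norm_cong_AE) (use fe(2) fourier_AE[OF f] in \<open>auto elim: eventually_elim2\<close>)
  finally show ?thesis .
qed

section \<open>Fresnel integrals\<close>

definition fresnel :: "real \<Rightarrow> complex" where
  "fresnel x = (LBINT s=ereal 0..ereal x. cis (s\<^sup>2))"

lemma fresnel_has_vector_derivative: "(fresnel has_vector_derivative cis (x\<^sup>2)) (at x)"
proof -
  have "((\<lambda>u. LBINT y=ereal 0..ereal u. cis (y\<^sup>2)) has_vector_derivative cis (x\<^sup>2))
      (at x within {min 0 (x - 1)..max 0 (x + 1)})"
    by (rule interval_integral_FTC2) (auto intro!: continuous_intros)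
  \<comment> \<open>The fundamental theorem gives a derivative relative to a compact interval
    containing 0; the interval is enlarged so that x is interior.\<close>
  moreover have "at x within {min 0 (x - 1)..max 0 (x + 1)} = at x"
    by (intro at_within_interior) auto
  ultimately show ?thesis unfolding fresnel_def[abs_def] by simp
qed

lemma continuous_on_fresnel: "continuous_on S fresnel"
  by (rule continuous_on_vector_derivative[OF has_vector_derivative_at_within[OF fresnel_has_vector_derivative]])

lemma fresnel_minus: "fresnel (- x) = - fresnel x"
proof -
  have "fresnel (- x) = (LBINT s=- ereal (- x)..- ereal 0. cis ((- s)\<^sup>2))"
    unfolding fresnel_def by (rule interval_integral_reflect)
  also have "\<dots> = (LBINT s=ereal x..ereal 0. cis (s\<^sup>2))" by simp
  also have "\<dots> = - fresnel x" unfolding fresnel_def by (rule interval_integral_endpoints_reverse)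
  finally show ?thesis .
qed

text \<open>Integration by parts: \<open>cis (s\<^sup>2) / (2 i s)\<close> is an antiderivative of the integrand up to \<open>O(s\<^sup>-\<^sup>2)\<close>.\<close>

lemma fresnel_diff_bound_aux:
  assumes "0 < x" "x < y" shows "cmod (fresnel y - fresnel x) \<le> 1 / x"
proof -
  define G where "G s = fresnel s - cis (s\<^sup>2) / (2 * \<i> * of_real s)" for s
  define G' where "G' s = - \<i> * cis (s\<^sup>2) / (2 * of_real (s\<^sup>2))" for s :: real
  have der: "(G has_vector_derivative G' s) (at s)" if "s > 0" for s
  proof -
    have "((\<lambda>z. exp (\<i> * z\<^sup>2) / (2 * \<i> * z)) has_field_derivative
        (exp (\<i> * (of_real s)\<^sup>2) + \<i> * exp (\<i> * (of_real s)\<^sup>2) / (2 * (of_real s)\<^sup>2))) (at (of_real s))"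
      using that by (auto intro!: derivative_eq_intros simp: field_simps power2_eq_square)
    from has_vector_derivative_real_field[OF this]
    have "((\<lambda>s. cis (s\<^sup>2) / (2 * \<i> * of_real s)) has_vector_derivative
        (cis (s\<^sup>2) + \<i> * cis (s\<^sup>2) / (2 * of_real (s\<^sup>2)))) (at s)"
      by (simp add: cis_conv_exp)
    from has_vector_derivative_diff[OF fresnel_has_vector_derivative this]
    show ?thesis unfolding G_def G'_def by simp
  qed
  have "cmod (G y - G x) \<le> (- 1 / (2 * y)) - (- 1 / (2 * x))"
  proof (rule differentiable_bound_general[OF assms(2), where f' = G' and \<phi>' = "\<lambda>s. 1 / (2 * s\<^sup>2)"])
    show "continuous_on {x..y} G"
      by (rule continuous_on_vector_derivative[where f' = G'], rule has_vector_derivative_at_within, rule der)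
        (use assms in auto)
    show "continuous_on {x..y} (\<lambda>s. - 1 / (2 * s))"
      using assms by (intro continuous_intros) auto
    fix s assume s: "x < s" "s < y"
    then show "(G has_vector_derivative G' s) (at s)" using der assms by auto
    show "((\<lambda>s. - 1 / (2 * s)) has_vector_derivative 1 / (2 * s\<^sup>2)) (at s)"
      using s assms unfolding has_real_derivative_iff_has_vector_derivative[symmetric]
      by (auto intro!: derivative_eq_intros simp: field_simps power2_eq_square)
    show "norm (G' s) \<le> 1 / (2 * s\<^sup>2)" by (simp add: G'_def norm_mult norm_divide norm_power)
  qed
  moreover have "cmod (cis (s\<^sup>2) / (2 * \<i> * of_real s)) = 1 / (2 * s)" if "s > 0" for s :: real
    using that by (simp add: norm_divide norm_mult)
  moreover have "fresnel y - fresnel x = (G y - G x) + (cis (y\<^sup>2) / (2 * \<i> * of_real y) - cis (x\<^sup>2) / (2 * \<i> * of_real x))"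
    by (simp add: G_def)
  moreover have "cmod ((G y - G x) + (cis (y\<^sup>2) / (2 * \<i> * of_real y) - cis (x\<^sup>2) / (2 * \<i> * of_real x)))
     \<le> cmod (G y - G x) + (cmod (cis (y\<^sup>2) / (2 * \<i> * of_real y)) + cmod (cis (x\<^sup>2) / (2 * \<i> * of_real x)))"
    by (rule order_trans[OF norm_triangle_ineq add_left_mono[OF norm_triangle_ineq4]])
  moreover have "1 / (2 * x) + 1 / (2 * x) = 1 / x" using assms by (simp add: field_simps)
  ultimately show ?thesis using assms by simp
qed

text \<open>Oddness transfers the bound to the negative axis. The two-sided form fits a point
  outside an interval, which has both endpoints on one side.\<close>

lemma fresnel_diff_bound:
  assumes "0 < d" "(d \<le> x \<and> d \<le> y) \<or> (x \<le> - d \<and> y \<le> - d)"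
  shows "cmod (fresnel y - fresnel x) \<le> 1 / d"
proof -
  have 1: "cmod (fresnel y - fresnel x) \<le> 1 / d" if "d \<le> x" "d \<le> y" for x y
  proof -
    have 2: "1 / x \<le> 1 / d" "1 / y \<le> 1 / d" using that assms(1) by (auto intro: divide_left_mono)
    consider "x < y" | "x = y" | "y < x" by linarith
    then show ?thesis
    proof cases
      case 1
      then show ?thesis using fresnel_diff_bound_aux[of x y] 2 that assms(1) by linarith
    next
      case 3
      then show ?thesis using fresnel_diff_bound_aux[of y x] 2 that assms(1) norm_minus_commute[of "fresnel y" "fresnel x"] by linarith
    qed (use assms in auto)
  qed
  show ?thesis
  proof (cases "d \<le> x \<and> d \<le> y")
    case False
    then have "cmod (fresnel (- y) - fresnel (- x)) \<le> 1 / d" using assms by (intro 1) auto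
    then show ?thesis by (simp add: fresnel_minus norm_minus_commute)
  qed (use 1 in auto)
qed

text \<open>The tail bound makes the values at integers Cauchy and then controls real arguments at
  rate 1/x; oddness gives the limit at minus infinity.\<close>

lemma fresnel_limit:
  obtains L where "(fresnel \<longlongrightarrow> L) at_top" "(fresnel \<longlongrightarrow> - L) at_bot"
proof -
  have "Cauchy (\<lambda>n. fresnel (real n))"
  proof (rule metric_CauchyI)
    fix e :: real assume e: "e > 0"
    obtain N :: nat where N: "2 / e < real N" using reals_Archimedean2 by blast
    then have "N > 0" using e by (cases N) (auto simp: field_simps)
    have "dist (fresnel (real m)) (fresnel (real n)) < e" if "m \<ge> N" "n \<ge> N" for m n
    proof -
      have "cmod (fresnel (real m) - fresnel (real n)) \<le> 1 / real N"
        using that \<open>N > 0\<close> by (intro fresnel_diff_bound) auto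
      also have "1 / real N < e"
      proof -
        have "1 < e * real N" using N e by (simp add: field_simps)
        then show ?thesis using \<open>N > 0\<close> by (simp add: field_simps)
      qed
      finally show ?thesis by (simp add: dist_norm)
    qed
    then show "\<exists>M. \<forall>m\<ge>M. \<forall>n\<ge>M. dist (fresnel (real m)) (fresnel (real n)) < e" by blast
  qed
  then obtain L where L: "(\<lambda>n. fresnel (real n)) \<longlonglongrightarrow> L" using Cauchy_convergent convergent_def by blast
  have "(fresnel \<longlongrightarrow> L) at_top"
  proof (rule LIM_zero_cancel, rule Lim_null_comparison)
    show "((\<lambda>x::real. 1 / x) \<longlongrightarrow> 0) at_top"
      by (intro tendsto_divide_0[OF tendsto_const] filterlim_at_top_imp_at_infinity filterlim_ident)
    show "\<forall>\<^sub>F x in at_top. norm (fresnel x - L) \<le> 1 / x"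
      using eventually_gt_at_top[of 0]
    proof eventually_elim
      case (elim x)
      have lim: "(\<lambda>n. norm (fresnel x - fresnel (real n))) \<longlonglongrightarrow> norm (fresnel x - L)"
        by (intro tendsto_intros L)
      have "\<forall>\<^sub>F n in sequentially. real n \<ge> x"
        using filterlim_real_sequentially by (simp add: filterlim_at_top)
      then have "\<forall>\<^sub>F n in sequentially. norm (fresnel x - fresnel (real n)) \<le> 1 / x"
        by eventually_elim (use elim in \<open>auto intro!: fresnel_diff_bound\<close>)
      then show ?case by (rule tendsto_upperbound[OF lim]) simp
    qed
  qed
  moreover from this have "((\<lambda>x. - fresnel (- x)) \<longlongrightarrow> - L) at_bot"
    by (intro tendsto_minus) (rule filterlim_compose[OF _ filterlim_uminus_at_top_at_bot])
  then have "(fresnel \<longlongrightarrow> - L) at_bot" by (simp add: fresnel_minus)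
  ultimately show ?thesis using that by blast
qed

lemma fresnel_bounded: obtains M where "M > 0" "\<And>x. cmod (fresnel x) \<le> M"
proof -
  have "bounded (fresnel ` {-1..1})"
    by (intro compact_imp_bounded compact_continuous_image continuous_on_fresnel) auto
  then obtain B where B: "\<And>x. x \<in> {-1..1} \<Longrightarrow> cmod (fresnel x) \<le> B" "B > 0"
    unfolding bounded_pos by blast
  have "cmod (fresnel x) \<le> B + 1" for x
  proof -
    consider "x \<in> {-1..1}" | "x \<ge> 1" | "x \<le> -1" by fastforce
    then show ?thesis
    proof cases
      case 1
      then show ?thesis using B(1)[OF 1] by linarith
    next
      case 2
      then have "cmod (fresnel x - fresnel 1) \<le> 1 / 1" by (intro fresnel_diff_bound) auto
      then show ?thesis using B(1)[of 1] norm_triangle_sub[of "fresnel x" "fresnel 1"] by simp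
    next
      case 3
      then have "cmod (fresnel x - fresnel (-1)) \<le> 1 / 1" by (intro fresnel_diff_bound) auto
      then show ?thesis using B(1)[of "-1"] norm_triangle_sub[of "fresnel x" "fresnel (-1)"] by simp
    qed
  qed
  then show ?thesis using that[of "B + 1"] B(2) by auto
qed

text \<open>Convolution of the indicator of an interval with the oscillating kernel
  \<open>sqrt t * cis (t / 4 * y\<^sup>2)\<close>. The factor \<open>sqrt t\<close> keeps its total
  oscillatory mass independent of t, so it acts as an approximate identity up to a constant.\<close>

definition chirp :: "real \<Rightarrow> real \<Rightarrow> real \<Rightarrow> real \<Rightarrow> complex" where
  "chirp a b t \<zeta> = of_real (sqrt t) * (LINT y|lborel. cis (t / 4 * (y - \<zeta>)\<^sup>2) * indicator {a<..<b} y)"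

lemma borel_measurable_chirp [measurable]: "chirp a b t \<in> borel_measurable borel"
  unfolding chirp_def by measurable

text \<open>Substitution s = sqrt t (y - \<zeta>)/2; the factor 2 is what remains of
  \<open>sqrt t\<close> after division by the derivative \<open>sqrt t / 2\<close>.\<close>

lemma chirp_eq:
  assumes "a \<le> b" "t > 0"
  shows "chirp a b t \<zeta> = 2 * (fresnel (sqrt t * (b - \<zeta>) / 2) - fresnel (sqrt t * (a - \<zeta>) / 2))"
proof -
  define F where "F y = (2 / sqrt t) *\<^sub>R fresnel (sqrt t * (y - \<zeta>) / 2)" for y
  have "(LINT y|lborel. cis (t / 4 * (y - \<zeta>)\<^sup>2) * indicator {a<..<b} y) = (LINT y|lborel. indicator {a..b} y *\<^sub>R cis (t / 4 * (y - \<zeta>)\<^sup>2))"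
    by (rule integral_indicator_open_closed) measurable
  also have "\<dots> = F b - F a"
  proof (rule integral_FTC_atLeastAtMost[OF assms(1)])
    fix y
    have 1: "((\<lambda>y. sqrt t * (y - \<zeta>) / 2) has_vector_derivative sqrt t / 2) (at y within {a..b})"
      unfolding has_real_derivative_iff_has_vector_derivative[symmetric]
      by (auto intro!: derivative_eq_intros)
    have 2: "(fresnel has_vector_derivative cis ((sqrt t * (y - \<zeta>) / 2)\<^sup>2)) (at (sqrt t * (y - \<zeta>) / 2) within (\<lambda>y. sqrt t * (y - \<zeta>) / 2) ` {a..b})"
      by (rule has_vector_derivative_at_within[OF fresnel_has_vector_derivative])
    have "(F has_vector_derivative ((2 / sqrt t) *\<^sub>R ((sqrt t / 2) *\<^sub>R cis ((sqrt t * (y - \<zeta>) / 2)\<^sup>2)))) (at y within {a..b})"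
      unfolding F_def
      using has_vector_derivative_scaleR[OF DERIV_const[of "2 / sqrt t"] vector_diff_chain_within[OF 1 2]]
      by (simp add: o_def)
    moreover have "(sqrt t * (y - \<zeta>) / 2)\<^sup>2 = t / 4 * (y - \<zeta>)\<^sup>2"
      using assms by (simp add: power_mult_distrib power_divide)
    ultimately show "(F has_vector_derivative cis (t / 4 * (y - \<zeta>)\<^sup>2)) (at y within {a..b})"
      using assms by simp
  qed (intro continuous_intros)
  finally show ?thesis
    using assms by (simp add: chirp_def F_def scaleR_conv_of_real field_simps)
qed

text \<open>A bound uniform in t with decay 1/|\<zeta>|, square integrable and hence usable as a
  majorant. Near the interval it rests on boundedness of \<open>fresnel\<close>, far away on the
  tail bound.\<close>

lemma chirp_bound:
  assumes "a \<le> b"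
  obtains K where "\<And>t \<zeta>. t \<ge> 1 \<Longrightarrow> cmod (chirp a b t \<zeta>) \<le> K / sqrt (1 + \<zeta>\<^sup>2)"
proof -
  obtain M where M: "M > 0" "\<And>x. cmod (fresnel x) \<le> M" using fresnel_bounded by blast
  \<comment> \<open>With this radius, a point outside \<open>{-R..R}\<close> has \<delta> \<ge> 1,
    where \<delta> is a lower bound for its distance to both endpoints.\<close>
  define R where "R = \<bar>a\<bar> + \<bar>b\<bar> + 1"
  have R: "R \<ge> 1" by (simp add: R_def)
  have "cmod (chirp a b t \<zeta>) * (1 + \<bar>\<zeta>\<bar>) \<le> (4 * M + 4) * (1 + R)" if t: "t \<ge> 1" for t \<zeta>
  proof (cases "\<bar>\<zeta>\<bar> \<le> R")
    case True
    have "cmod (chirp a b t \<zeta>) \<le> 2 * (M + M)"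
      using norm_triangle_ineq4[of "fresnel (sqrt t * (b - \<zeta>) / 2)" "fresnel (sqrt t * (a - \<zeta>) / 2)"]
        M(2)[of "sqrt t * (b - \<zeta>) / 2"] M(2)[of "sqrt t * (a - \<zeta>) / 2"] t
      unfolding chirp_eq[OF assms less_le_trans[OF zero_less_one t]] norm_mult by simp
    then show ?thesis using True M(1) by (intro mult_mono) auto
  next
    case False
    define \<delta> where "\<delta> = \<bar>\<zeta>\<bar> - (\<bar>a\<bar> + \<bar>b\<bar>)"
    have \<delta>: "\<delta> \<ge> 1" using False by (simp add: \<delta>_def R_def)
    have st: "sqrt t \<ge> 1" using t by simp
    have mono: "\<delta> / 2 \<le> sqrt t * x / 2" if "x \<ge> \<delta>" for x
      using mult_mono[OF st that] \<delta> t by simp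
    have "(\<delta> / 2 \<le> sqrt t * (a - \<zeta>) / 2 \<and> \<delta> / 2 \<le> sqrt t * (b - \<zeta>) / 2) \<or>
       (sqrt t * (a - \<zeta>) / 2 \<le> - (\<delta> / 2) \<and> sqrt t * (b - \<zeta>) / 2 \<le> - (\<delta> / 2))"
    proof (cases "\<zeta> < 0")
      case True
      then have "a - \<zeta> \<ge> \<delta>" "b - \<zeta> \<ge> \<delta>" by (auto simp: \<delta>_def)
      then show ?thesis using mono by blast
    next
      case False
      then have "\<zeta> - a \<ge> \<delta>" "\<zeta> - b \<ge> \<delta>" by (auto simp: \<delta>_def)
      then have "\<delta> / 2 \<le> sqrt t * (\<zeta> - a) / 2" "\<delta> / 2 \<le> sqrt t * (\<zeta> - b) / 2" using mono by blast+
      then show ?thesis by (simp add: algebra_simps)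
    qed
    then have "cmod (fresnel (sqrt t * (b - \<zeta>) / 2) - fresnel (sqrt t * (a - \<zeta>) / 2)) \<le> 1 / (\<delta> / 2)"
      using \<delta> by (intro fresnel_diff_bound) auto
    then have 1: "cmod (chirp a b t \<zeta>) \<le> 4 / \<delta>"
      unfolding chirp_eq[OF assms less_le_trans[OF zero_less_one t]] norm_mult by simp
    have "1 + \<bar>\<zeta>\<bar> = \<delta> + R" by (simp add: \<delta>_def R_def)
    also have "\<dots> \<le> \<delta> * (1 + R)" using \<delta> R mult_right_mono[OF \<delta>, of R] by (simp add: algebra_simps)
    finally have 2: "1 + \<bar>\<zeta>\<bar> \<le> \<delta> * (1 + R)" .
    have "cmod (chirp a b t \<zeta>) * (1 + \<bar>\<zeta>\<bar>) \<le> (4 / \<delta>) * (\<delta> * (1 + R))"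
      by (intro mult_mono 1 2) (use \<delta> in auto)
    also have "\<dots> = 4 * (1 + R)" using \<delta> by simp
    also have "\<dots> \<le> (4 * M + 4) * (1 + R)" using M R by (intro mult_right_mono) auto
    finally show ?thesis .
  qed
  moreover have "sqrt (1 + \<zeta>\<^sup>2) \<le> 1 + \<bar>\<zeta>\<bar>" for \<zeta> :: real
    by (rule real_le_lsqrt) (auto simp: power2_sum)
  ultimately have "cmod (chirp a b t \<zeta>) * sqrt (1 + \<zeta>\<^sup>2) \<le> (4 * M + 4) * (1 + R)" if "t \<ge> 1" for t \<zeta>
    using that by (meson mult_left_mono norm_ge_zero order_trans)
  then show ?thesis
    by (intro that[of "(4 * M + 4) * (1 + R)"]) (simp add: pos_le_divide_eq add_pos_nonneg)
qed

text \<open>For \<zeta> inside the interval the two Fresnel arguments run to opposite infinities and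
  the difference tends to 2L, doubled by the prefactor; outside they run to the same infinity and
  cancel. At an endpoint one argument would stay at 0.\<close>

lemma chirp_tendsto:
  assumes "a \<le> b" "\<zeta> \<noteq> a" "\<zeta> \<noteq> b" "(fresnel \<longlongrightarrow> L) at_top" "(fresnel \<longlongrightarrow> - L) at_bot"
  shows "((\<lambda>t. chirp a b t \<zeta>) \<longlongrightarrow> 4 * L * indicator {a<..<b} \<zeta>) at_top"
proof -
  have sq: "filterlim sqrt at_top at_top" by (rule sqrt_at_top)
  have lim: "((\<lambda>t. fresnel (sqrt t * (c - \<zeta>) / 2)) \<longlongrightarrow> (if c > \<zeta> then L else - L)) at_top" if "c \<noteq> \<zeta>" for c
  proof (cases "c > \<zeta>")
    case True
    have "filterlim (\<lambda>t. ((c - \<zeta>) / 2) * sqrt t) at_top at_top"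
      by (rule filterlim_tendsto_pos_mult_at_top[OF tendsto_const _ sq]) (use True in auto)
    then show ?thesis using True filterlim_compose[OF assms(4)] by (simp add: mult_ac)
  next
    case False
    have "filterlim (\<lambda>t. ((\<zeta> - c) / 2) * sqrt t) at_top at_top"
      by (rule filterlim_tendsto_pos_mult_at_top[OF tendsto_const _ sq]) (use False that in auto)
    then have "filterlim (\<lambda>t. - (((\<zeta> - c) / 2) * sqrt t)) at_bot at_top"
      by (simp add: filterlim_uminus_at_top)
    then have "((\<lambda>t. fresnel (- (((\<zeta> - c) / 2) * sqrt t))) \<longlongrightarrow> - L) at_top"
      by (rule filterlim_compose[OF assms(5)])
    moreover have "- (((\<zeta> - c) / 2) * sqrt t) = sqrt t * (c - \<zeta>) / 2" for t by (simp add: field_simps)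
    ultimately show ?thesis using False by (simp only: if_False)
  qed
  have "((\<lambda>t. 2 * (fresnel (sqrt t * (b - \<zeta>) / 2) - fresnel (sqrt t * (a - \<zeta>) / 2))) \<longlongrightarrow>
      2 * ((if b > \<zeta> then L else - L) - (if a > \<zeta> then L else - L))) at_top"
    by (intro tendsto_intros lim) (use assms in auto)
  then have lim2: "((\<lambda>t. 2 * (fresnel (sqrt t * (b - \<zeta>) / 2) - fresnel (sqrt t * (a - \<zeta>) / 2))) \<longlongrightarrow>
      4 * L * indicator {a<..<b} \<zeta>) at_top"
    by (rule tendsto_eq_rhs) (use assms in \<open>auto simp: indicator_def\<close>)
  have "\<forall>\<^sub>F t in at_top. 2 * (fresnel (sqrt t * (b - \<zeta>) / 2) - fresnel (sqrt t * (a - \<zeta>) / 2)) = chirp a b t \<zeta>"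
    using eventually_gt_at_top[of 0] by eventually_elim (simp add: chirp_eq[OF assms(1)])
  then show ?thesis by (rule Lim_transform_eventually[OF lim2])
qed

section \<open>The pseudoconformal transformation of a fixed profile\<close>

text \<open>The pseudoconformal map at time t applied to a function of space alone, so that the
  profile can be held fixed while t varies.\<close>

definition pc_dilate :: "real \<Rightarrow> (complex \<Rightarrow> complex) \<Rightarrow> complex \<Rightarrow> complex" where
  "pc_dilate t w x = of_real (1 / t) * cis ((cmod x)\<^sup>2 / (4 * t)) * w (x / of_real t)"

lemma pc_dilate_L2:
  assumes "in_L2 w" "t > 0"
  shows "in_L2 (pc_dilate t w)" "L2_norm (pc_dilate t w) = L2_norm w"
proof -
  have eq: "w (x / of_real t) = w ((1 / t) *\<^sub>R x)" for x by (simp add: scaleR_conv_of_real)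
  have w: "in_L2 (\<lambda>x. w (x / of_real t))" unfolding eq by (rule L2_scale(1)) (use assms in auto)
  show "in_L2 (pc_dilate t w)"
    unfolding pc_dilate_def by (rule in_L2_mult_bounded[OF w, where B = "1/t"]) (use assms(2) in \<open>auto simp: norm_mult norm_divide\<close>)
  have "L2_norm (pc_dilate t w) = (1 / t) * L2_norm (\<lambda>x. w (x / of_real t))"
    using L2_norm_cmult[of "of_real (1 / t)" "\<lambda>x. w (x / of_real t)"] assms(2)
      L2_norm_cong[of "pc_dilate t w" "\<lambda>x. of_real (1 / t) * w (x / of_real t)"]
    by (simp add: pc_dilate_def norm_mult norm_divide)
  also have "\<dots> = L2_norm w" unfolding eq using L2_scale(2)[OF assms(1), of "1/t"] assms(2) by simp
  finally show "L2_norm (pc_dilate t w) = L2_norm w" .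
qed

lemma pc_dilate_diff: "(\<lambda>x. pc_dilate t f x - pc_dilate t g x) = pc_dilate t (\<lambda>x. f x - g x)"
  by (simp only: pc_dilate_def right_diff_distrib fun_eq_iff simp_thms)

lemma pc_dilate_lin: "(\<lambda>x. pc_dilate t f x + c * pc_dilate t g x) = pc_dilate t (\<lambda>x. f x + c * g x)"
  by (simp only: pc_dilate_def distrib_left mult.left_commute fun_eq_iff simp_thms)

text \<open>The free phase splits off after scaling by t and completing the square. Scaling
  contributes t^2 and the transformation 1/t; the remaining factor t is shared as
  \<open>sqrt t\<close> between the two chirps.\<close>

lemma fourier_int_pc_dilate_box:
  assumes t: "t > 0"
  shows "fourier_int (pc_dilate t (indicator (box a b))) \<xi> = cis (- t * (cmod \<xi>)\<^sup>2) *
    (chirp (Re a) (Re b) t (2 * Re \<xi>) * chirp (Im a) (Im b) t (2 * Im \<xi>) / of_real (2 * pi))"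
proof -
  have "in_L2 (pc_dilate t (indicator (box a b)))" by (rule pc_dilate_L2(1)[OF in_L2_box t])
  note [measurable] = in_L2_measurable[OF this]
  let ?f = "\<lambda>y. cis (t / 4 * (Re y - 2 * Re \<xi>)\<^sup>2) * indicator {Re a<..<Re b} (Re y)"
  let ?g = "\<lambda>y. cis (t / 4 * (Im y - 2 * Im \<xi>)\<^sup>2) * indicator {Im a<..<Im b} (Im y)"
  have m: "(\<lambda>x. cis (- (x \<bullet> \<xi>)) * pc_dilate t (indicator (box a b)) x) \<in> borel_measurable borel"
    by measurable
  have "(LINT x|lborel. cis (- (x \<bullet> \<xi>)) * pc_dilate t (indicator (box a b)) x) =
      t\<^sup>2 *\<^sub>R (LINT y|lborel. cis (- ((t *\<^sub>R y) \<bullet> \<xi>)) * pc_dilate t (indicator (box a b)) (t *\<^sub>R y))"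
    using integral_scale[OF _ m, of t] t by simp
  also have "(LINT y|lborel. cis (- ((t *\<^sub>R y) \<bullet> \<xi>)) * pc_dilate t (indicator (box a b)) (t *\<^sub>R y)) =
      (LINT y|lborel. (of_real (1 / t) * cis (- t * (cmod \<xi>)\<^sup>2)) * (?f y * ?g y))"
  proof (rule Bochner_Integration.integral_cong[OF refl])
    fix y
    have "- ((t *\<^sub>R y) \<bullet> \<xi>) + (cmod (t *\<^sub>R y))\<^sup>2 / (4 * t) =
      - t * (cmod \<xi>)\<^sup>2 + (t / 4 * (Re y - 2 * Re \<xi>)\<^sup>2 + t / 4 * (Im y - 2 * Im \<xi>)\<^sup>2)"
      unfolding cmod_power2 inner_complex_def using t by (simp add: field_simps power2_eq_square)
    then have "cis (- ((t *\<^sub>R y) \<bullet> \<xi>)) * cis ((cmod (t *\<^sub>R y))\<^sup>2 / (4 * t)) =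
       cis (- t * (cmod \<xi>)\<^sup>2) * (cis (t / 4 * (Re y - 2 * Re \<xi>)\<^sup>2) * cis (t / 4 * (Im y - 2 * Im \<xi>)\<^sup>2))"
      unfolding cis_mult by (rule arg_cong)
    moreover have "t *\<^sub>R y / of_real t = y" using t by (simp add: scaleR_conv_of_real)
    moreover have "A * (T * B * (i * j)) = (T * C) * ((P * i) * (R * j))" if "A * B = C * (P * R)"
      for A B C P R T i j :: complex
    proof -
      have "A * (T * B * (i * j)) = (T * i * j) * (A * B)" by (simp only: mult_ac)
      then show ?thesis unfolding that by (simp only: mult_ac)
    qed
    ultimately show "cis (- ((t *\<^sub>R y) \<bullet> \<xi>)) * pc_dilate t (indicator (box a b)) (t *\<^sub>R y) =
       (of_real (1 / t) * cis (- t * (cmod \<xi>)\<^sup>2)) * (?f y * ?g y)"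
      unfolding pc_dilate_def indicator_box_prod by simp
  qed
  also have "\<dots> = (of_real (1 / t) * cis (- t * (cmod \<xi>)\<^sup>2)) * (LINT y|lborel. ?f y * ?g y)"
    by simp
  also have "(LINT y|lborel. ?f y * ?g y) =
     (LINT y|lborel. cis (t / 4 * (y - 2 * Re \<xi>)\<^sup>2) * indicator {Re a<..<Re b} y) *
     (LINT y|lborel. cis (t / 4 * (y - 2 * Im \<xi>)\<^sup>2) * indicator {Im a<..<Im b} y)"
    by (intro has_bochner_integral_integral_eq has_bochner_integral_complex_prod integrable_indicator_interval) auto
  also have "t\<^sup>2 *\<^sub>R ((of_real (1 / t) * cis (- t * (cmod \<xi>)\<^sup>2)) * \<dots>) =
      cis (- t * (cmod \<xi>)\<^sup>2) * (chirp (Re a) (Re b) t (2 * Re \<xi>) * chirp (Im a) (Im b) t (2 * Im \<xi>))"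
  proof -
    have "t\<^sup>2 *\<^sub>R ((of_real (1 / t) * c) * (p * q)) = c * ((of_real (sqrt t) * p) * (of_real (sqrt t) * q))" for c p q :: complex
    proof -
      have 1: "complex_of_real (sqrt t) * of_real (sqrt t) = of_real t" using t by (simp flip: of_real_mult)
      have "t\<^sup>2 *\<^sub>R ((of_real (1 / t) * c) * (p * q)) = of_real t * (c * (p * q))"
        using t by (simp add: scaleR_conv_of_real power2_eq_square)
      also have "\<dots> = (of_real (sqrt t) * of_real (sqrt t)) * (c * (p * q))" by (simp only: 1)
      also have "\<dots> = c * ((of_real (sqrt t) * p) * (of_real (sqrt t) * q))" by (simp only: mult_ac)
      finally show ?thesis .
    qed
    then show ?thesis unfolding chirp_def .
  qed
  finally show ?thesis by (simp add: fourier_int_def)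
qed

lemma bounded_L2_pc_dilate_box:
  assumes t: "t > 0" shows "bounded_L2 (pc_dilate t (indicator (box a b)))"
proof -
  obtain n :: nat where n: "t * (cmod a + cmod b) < real n" using reals_Archimedean2 by blast
  have "pc_dilate t (indicator (box a b)) x = 0" if x: "x \<notin> big_box n" for x
  proof -
    have "x / of_real t \<notin> box a b"
    proof
      assume "x / of_real t \<in> box a b"
      then have "\<bar>Re x / t\<bar> < cmod a + cmod b" "\<bar>Im x / t\<bar> < cmod a + cmod b"
        using abs_Re_le_cmod[of a] abs_Re_le_cmod[of b] abs_Im_le_cmod[of a] abs_Im_le_cmod[of b]
        unfolding in_box_complex_iff by (auto simp: abs_less_iff)
      then have "\<bar>Re x\<bar> < real n" "\<bar>Im x\<bar> < real n"
        using n t by (auto simp: abs_divide field_simps)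
      then show False using x unfolding big_box_def in_box_complex_iff by (auto simp: abs_less_iff)
    qed
    then show ?thesis by (simp add: pc_dilate_def)
  qed
  then show ?thesis unfolding bounded_L2_def using pc_dilate_L2(1)[OF in_L2_box t] by blast
qed

lemma AE_Re_neq: "AE z in lborel. Re z \<noteq> c" and AE_Im_neq: "AE z in lborel. Im z \<noteq> c"
proof -
  have "emeasure lborel {z. Re z = c} = (\<integral>\<^sup>+z. indicator {z. Re z = c} z \<partial>lborel)" by simp
  also have "\<dots> = (\<integral>\<^sup>+x. \<integral>\<^sup>+y. indicator {c} x \<partial>(lborel::real measure) \<partial>(lborel::real measure))"
    by (subst nn_integral_complex(1)) (auto simp: indicator_def intro!: nn_integral_cong)
  also have "\<dots> = 0" by (simp add: nn_integral_multc)
  finally show "AE z in lborel. Re z \<noteq> c" by (subst AE_iff_measurable[OF _ refl]) auto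
  have "emeasure lborel {z. Im z = c} = (\<integral>\<^sup>+z. indicator {z. Im z = c} z \<partial>lborel)" by simp
  also have "\<dots> = (\<integral>\<^sup>+y. \<integral>\<^sup>+x. indicator {c} y \<partial>(lborel::real measure) \<partial>(lborel::real measure))"
    by (subst nn_integral_complex(2)) (auto simp: indicator_def intro!: nn_integral_cong)
  also have "\<dots> = 0" by (simp add: nn_integral_multc)
  finally show "AE z in lborel. Im z \<noteq> c" by (subst AE_iff_measurable[OF _ refl]) auto
qed

text \<open>The square is a product of two functions of the form c/(1 + x^2), each integrable on the
  line.\<close>

lemma in_L2_chirp_majorant: "in_L2 (\<lambda>z. of_real (K / sqrt (1 + (Re z)\<^sup>2) * (K' / sqrt (1 + (Im z)\<^sup>2))))"
proof -
  have i: "integrable lborel (\<lambda>x::real. complex_of_real (B\<^sup>2 * (1 / (1 + x\<^sup>2))))" for B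
    by (intro integrable_of_real integrable_mult_right integrable_inverse_1_plus_sq)
  have "integrable lborel (\<lambda>z. Re (complex_of_real (K\<^sup>2 * (1 / (1 + (Re z)\<^sup>2))) * complex_of_real (K'\<^sup>2 * (1 / (1 + (Im z)\<^sup>2)))))"
    using has_bochner_integral_complex_prod[OF i[of K] i[of K']] by (intro integrable_Re) (simp add: has_bochner_integral_iff)
  moreover have "Re (complex_of_real (K\<^sup>2 * (1 / (1 + (Re z)\<^sup>2))) * complex_of_real (K'\<^sup>2 * (1 / (1 + (Im z)\<^sup>2)))) =
     (cmod (of_real (K / sqrt (1 + (Re z)\<^sup>2) * (K' / sqrt (1 + (Im z)\<^sup>2)))))\<^sup>2" for z
    by (simp only: norm_of_real power2_abs flip: of_real_mult)
      (simp add: power_mult_distrib power_divide add_nonneg_nonneg)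
  ultimately show ?thesis unfolding in_L2_def by simp
qed

lemma chirp_product_tendsto:
  assumes ab: "Re a \<le> Re b" "Im a \<le> Im b" and L: "(fresnel \<longlongrightarrow> L) at_top" "(fresnel \<longlongrightarrow> - L) at_bot"
  shows "((\<lambda>t. L2_norm (\<lambda>\<xi>. chirp (Re a) (Re b) t (Re \<xi>) * chirp (Im a) (Im b) t (Im \<xi>) -
     (4 * L)\<^sup>2 * indicator (box a b) \<xi>)) \<longlongrightarrow> 0) at_top"
proof (rule tendsto_at_topI_sequentially)
  fix X :: "nat \<Rightarrow> real" assume X: "filterlim X at_top sequentially"
  \<comment> \<open>The majorant is available only for t \<ge> 1; the maximum changes finitely many
    terms and leaves the limit alone.\<close>
  define Y where "Y n = max 1 (X n)" for n
  have Y1: "Y n \<ge> 1" for n by (simp add: Y_def)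
  have XY: "\<forall>\<^sub>F n in sequentially. Y n = X n"
  proof -
    have "\<forall>\<^sub>F n in sequentially. X n \<ge> 1" using X by (simp add: filterlim_at_top)
    then show ?thesis by eventually_elim (simp add: Y_def)
  qed
  then have Y: "filterlim Y at_top sequentially" using X filterlim_cong[OF refl refl XY] by blast
  obtain K where K: "\<And>t \<zeta>. t \<ge> 1 \<Longrightarrow> cmod (chirp (Re a) (Re b) t \<zeta>) \<le> K / sqrt (1 + \<zeta>\<^sup>2)"
    using chirp_bound[OF ab(1)] by blast
  obtain K' where K': "\<And>t \<zeta>. t \<ge> 1 \<Longrightarrow> cmod (chirp (Im a) (Im b) t \<zeta>) \<le> K' / sqrt (1 + \<zeta>\<^sup>2)"
    using chirp_bound[OF ab(2)] by blast
  let ?P = "\<lambda>t \<xi>. chirp (Re a) (Re b) t (Re \<xi>) * chirp (Im a) (Im b) t (Im \<xi>)"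
  have "(\<lambda>n. L2_norm (\<lambda>\<xi>. ?P (Y n) \<xi> - (4 * L)\<^sup>2 * indicator (box a b) \<xi>)) \<longlonglongrightarrow> 0"
  proof (rule L2_dominated_convergence)
    show "in_L2 (\<lambda>z. of_real (K / sqrt (1 + (Re z)\<^sup>2) * (K' / sqrt (1 + (Im z)\<^sup>2))))" by (rule in_L2_chirp_majorant)
    show "(\<lambda>x. (4 * L)\<^sup>2 * indicator (box a b) x) \<in> borel_measurable borel" by simp
    show "AE x in lborel. (\<lambda>n. ?P (Y n) x) \<longlonglongrightarrow> (4 * L)\<^sup>2 * indicator (box a b) x"
      using AE_Re_neq[of "Re a"] AE_Re_neq[of "Re b"] AE_Im_neq[of "Im a"] AE_Im_neq[of "Im b"]
    proof eventually_elim
      case (elim x)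
      have "(\<lambda>n. ?P (Y n) x) \<longlonglongrightarrow> (4 * L * indicator {Re a<..<Re b} (Re x)) * (4 * L * indicator {Im a<..<Im b} (Im x))"
        by (intro tendsto_mult filterlim_compose[OF chirp_tendsto Y]) (use elim ab L in auto)
      then show ?case by (simp add: indicator_box_prod power2_eq_square mult_ac)
    qed
    show "AE x in lborel. cmod (?P (Y n) x) \<le> cmod (of_real (K / sqrt (1 + (Re x)\<^sup>2) * (K' / sqrt (1 + (Im x)\<^sup>2))))" for n
    proof (rule AE_I2)
      fix x
      have "cmod (?P (Y n) x) \<le> K / sqrt (1 + (Re x)\<^sup>2) * (K' / sqrt (1 + (Im x)\<^sup>2))"
        unfolding norm_mult
        by (intro mult_mono K K' Y1 order_trans[OF norm_ge_zero K[OF Y1[of n]]]) auto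
      then show "cmod (?P (Y n) x) \<le> cmod (of_real (K / sqrt (1 + (Re x)\<^sup>2) * (K' / sqrt (1 + (Im x)\<^sup>2))))"
        unfolding norm_of_real by linarith
    qed
  qed measurable
  then show "(\<lambda>n. L2_norm (\<lambda>\<xi>. ?P (X n) \<xi> - (4 * L)\<^sup>2 * indicator (box a b) \<xi>)) \<longlonglongrightarrow> 0"
    by (rule Lim_transform_eventually) (use XY in \<open>auto elim: eventually_mono\<close>)
qed

text \<open>
  Here \<open>\<kappa> w(2\<xi>)\<close> is the Fourier transform of the datum of the free wave that \<open>pc_dilate t w\<close> approaches.
\<close>

definition free_defect :: "complex \<Rightarrow> (complex \<Rightarrow> complex) \<Rightarrow> real \<Rightarrow> real" where
  "free_defect \<kappa> w t = L2_norm (\<lambda>\<xi>. fourier (pc_dilate t w) \<xi> - cis (- t * (cmod \<xi>)\<^sup>2) * (\<kappa> * w (2 * \<xi>)))"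

lemma in_L2_double: "in_L2 w \<Longrightarrow> in_L2 (\<lambda>\<xi>. w (2 * \<xi>))" "in_L2 w \<Longrightarrow> L2_norm (\<lambda>\<xi>. w (2 * \<xi>)) = L2_norm w / 2"
  using L2_scale[of w 2] by (simp_all add: scaleR_conv_of_real)

lemma in_L2_free_wave:
  assumes "in_L2 w" shows "in_L2 (\<lambda>\<xi>. cis (- t * (cmod \<xi>)\<^sup>2) * (\<kappa> * w (2 * \<xi>)))"
  by (rule in_L2_mult_bounded[where B = 1]) (use assms in \<open>auto intro!: in_L2_cmult in_L2_double\<close>)

text \<open>A bound uniform in t, as the density argument requires: the transform of the dilated
  profile has the norm of w, and the subtracted free wave has norm |\<kappa>| times half of
  it.\<close>

lemma free_defect_bound:
  assumes "in_L2 w" "t > 0" shows "free_defect \<kappa> w t \<le> (1 + cmod \<kappa>) * L2_norm w"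
proof -
  let ?W = "\<lambda>\<xi>. cis (- t * (cmod \<xi>)\<^sup>2) * (\<kappa> * w (2 * \<xi>))"
  have "free_defect \<kappa> w t \<le> L2_norm (fourier (pc_dilate t w)) + L2_norm ?W"
    unfolding free_defect_def
    using L2_norm_triangle_diff[OF in_L2_fourier[OF pc_dilate_L2(1)[OF assms]] in_L2_zero in_L2_free_wave[OF assms(1), of t \<kappa>]]
      L2_norm_cong[of "\<lambda>x. 0 - ?W x" ?W] by simp
  also have "L2_norm ?W = cmod \<kappa> * (L2_norm w / 2)"
    using L2_norm_cong[of ?W "\<lambda>\<xi>. \<kappa> * w (2 * \<xi>)"] L2_norm_cmult[of \<kappa> "\<lambda>\<xi>. w (2 * \<xi>)"] in_L2_double(2)[OF assms(1)]
    by (simp add: norm_mult)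
  also have "L2_norm (fourier (pc_dilate t w)) = L2_norm w"
    by (simp add: L2_norm_fourier pc_dilate_L2 assms)
  finally show ?thesis
    using mult_nonneg_nonneg[OF norm_ge_zero L2_norm_nonneg, of \<kappa> w] unfolding distrib_right by linarith
qed

text \<open>The form matches one step of the induction on step functions and, with c = 1, the
  splitting of a function into step function and error. The transform is linear only almost
  everywhere, which the norm does not see.\<close>

lemma free_defect_add:
  assumes "in_L2 f" "in_L2 g" "t > 0"
  shows "free_defect \<kappa> (\<lambda>x. f x + c * g x) t \<le> free_defect \<kappa> f t + cmod c * free_defect \<kappa> g t"
proof -
  let ?W = "\<lambda>w \<xi>. cis (- t * (cmod \<xi>)\<^sup>2) * (\<kappa> * w (2 * \<xi>))"
  let ?D = "\<lambda>w \<xi>. fourier (pc_dilate t w) \<xi> - ?W w \<xi>"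
  have D: "in_L2 (?D w)" if "in_L2 w" for w
    by (intro in_L2_diff in_L2_free_wave in_L2_fourier pc_dilate_L2 that assms)
  have fg: "in_L2 (\<lambda>x. f x + c * g x)" by (intro in_L2_add in_L2_cmult assms)
  have "has_fourier (\<lambda>x. pc_dilate t f x + c * pc_dilate t g x) (\<lambda>\<xi>. fourier (pc_dilate t f) \<xi> + c * fourier (pc_dilate t g) \<xi>)"
    by (intro has_fourier_add has_fourier_cmult has_fourier_fourier pc_dilate_L2 assms)
  from fourier_AE[OF this[unfolded pc_dilate_lin]]
  have "AE \<xi> in lborel. ?D (\<lambda>x. f x + c * g x) \<xi> = ?D f \<xi> + c * ?D g \<xi>"
    by eventually_elim (simp add: algebra_simps)
  then have "free_defect \<kappa> (\<lambda>x. f x + c * g x) t = L2_norm (\<lambda>\<xi>. ?D f \<xi> + c * ?D g \<xi>)"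
    unfolding free_defect_def
    by (intro L2_norm_cong_AE in_L2_measurable D fg in_L2_add in_L2_cmult assms) auto
  also have "\<dots> \<le> L2_norm (?D f) + L2_norm (\<lambda>\<xi>. c * ?D g \<xi>)"
    by (intro L2_norm_triangle in_L2_cmult D assms)
  finally show ?thesis unfolding L2_norm_cmult free_defect_def .
qed

lemma free_defect_box:
  assumes ab: "Re a \<le> Re b" "Im a \<le> Im b" and L: "(fresnel \<longlongrightarrow> L) at_top" "(fresnel \<longlongrightarrow> - L) at_bot"
  shows "((\<lambda>t. free_defect ((4 * L)\<^sup>2 / of_real (2 * pi)) (indicator (box a b)) t) \<longlongrightarrow> 0) at_top"
proof -
  let ?P = "\<lambda>t \<xi>. chirp (Re a) (Re b) t (Re \<xi>) * chirp (Im a) (Im b) t (Im \<xi>) - (4 * L)\<^sup>2 * indicator (box a b) \<xi>"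
  have "free_defect ((4 * L)\<^sup>2 / of_real (2 * pi)) (indicator (box a b)) t = L2_norm (?P t) / (4 * pi)" if t: "t > 0" for t
  proof -
    let ?V = "fourier (pc_dilate t (indicator (box a b)))"
    \<comment> \<open>Square integrability of the chirp product is read off from the transform
      itself, by multiplying back 2 pi and the inverse free phase and then rescaling.\<close>
    have PL2: "in_L2 (?P t)"
    proof -
      have F: "in_L2 (fourier_int (pc_dilate t (indicator (box a b))))"
        by (rule in_L2_fourier_int[OF bounded_L2_pc_dilate_box[OF t]])
      have "in_L2 (\<lambda>\<xi>. (of_real (2 * pi) * cis (t * (cmod \<xi>)\<^sup>2)) * fourier_int (pc_dilate t (indicator (box a b))) \<xi>)"
        by (rule in_L2_mult_bounded[OF F, where B = "2 * pi"]) (auto simp: norm_mult)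
      then have "in_L2 (\<lambda>\<xi>. chirp (Re a) (Re b) t (2 * Re \<xi>) * chirp (Im a) (Im b) t (2 * Im \<xi>))"
      proof (rule in_L2_cong_AE)
        show "AE \<xi> in lborel. (of_real (2 * pi) * cis (t * (cmod \<xi>)\<^sup>2)) * fourier_int (pc_dilate t (indicator (box a b))) \<xi> =
           chirp (Re a) (Re b) t (2 * Re \<xi>) * chirp (Im a) (Im b) t (2 * Im \<xi>)"
        proof (rule AE_I2)
          fix \<xi>
          have c: "cis (t * (cmod \<xi>)\<^sup>2) * cis (- t * (cmod \<xi>)\<^sup>2) = 1" by (simp add: cis_mult)
          have p: "(p * e) * (e' * (u / p)) = (e * e') * u" if "p \<noteq> 0" for p e e' u :: complex
            using that by (simp add: field_simps)
          have "complex_of_real (2 * pi) \<noteq> 0" by simp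
          from p[OF this, of "cis (t * (cmod \<xi>)\<^sup>2)" "cis (- t * (cmod \<xi>)\<^sup>2)"]
          show "(of_real (2 * pi) * cis (t * (cmod \<xi>)\<^sup>2)) * fourier_int (pc_dilate t (indicator (box a b))) \<xi> =
            chirp (Re a) (Re b) t (2 * Re \<xi>) * chirp (Im a) (Im b) t (2 * Im \<xi>)"
            unfolding fourier_int_pc_dilate_box[OF t] c mult_1 .
        qed
      qed measurable
      from L2_scale(1)[OF this, of "1/2"]
      have "in_L2 (\<lambda>\<xi>. chirp (Re a) (Re b) t (Re \<xi>) * chirp (Im a) (Im b) t (Im \<xi>))" by simp
      then show ?thesis by (intro in_L2_diff in_L2_cmult in_L2_box)
    qed
    note [measurable] = in_L2_measurable[OF PL2]
    have "free_defect ((4 * L)\<^sup>2 / of_real (2 * pi)) (indicator (box a b)) t = L2_norm (\<lambda>\<xi>. of_real (1 / (2 * pi)) * ?P t (2 * \<xi>))"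
      unfolding free_defect_def
    proof (rule L2_norm_cong_AE)
      show "AE \<xi> in lborel. cmod (?V \<xi> - cis (- t * (cmod \<xi>)\<^sup>2) * ((4 * L)\<^sup>2 / of_real (2 * pi) * indicator (box a b) (2 * \<xi>))) =
         cmod (of_real (1 / (2 * pi)) * ?P t (2 * \<xi>))"
        using fourier_AE_bounded[OF bounded_L2_pc_dilate_box[OF t, of a b]]
      proof eventually_elim
        case (elim \<xi>)
        have alg: "e * (u / p) - e * (k / p * i) = e * (inverse p * (u - k * i))" for e u p k i :: complex
          by (simp add: divide_inverse algebra_simps)
        have "?V \<xi> - cis (- t * (cmod \<xi>)\<^sup>2) * ((4 * L)\<^sup>2 / of_real (2 * pi) * indicator (box a b) (2 * \<xi>)) =
            cis (- t * (cmod \<xi>)\<^sup>2) * (inverse (of_real (2 * pi)) * ?P t (2 * \<xi>))"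
          unfolding elim fourier_int_pc_dilate_box[OF t] alg by simp
        then show ?case by (simp add: norm_mult norm_inverse norm_divide inverse_eq_divide)
      qed
      show "(\<lambda>\<xi>. ?V \<xi> - cis (- t * (cmod \<xi>)\<^sup>2) * ((4 * L)\<^sup>2 / of_real (2 * pi) * indicator (box a b) (2 * \<xi>))) \<in> borel_measurable borel"
        by (intro in_L2_measurable in_L2_diff in_L2_fourier in_L2_free_wave pc_dilate_L2 t in_L2_box)
      show "(\<lambda>\<xi>. of_real (1 / (2 * pi)) * ?P t (2 * \<xi>)) \<in> borel_measurable borel"
        by (intro in_L2_measurable in_L2_cmult in_L2_double(1)[OF PL2])
    qed
    \<comment> \<open>The dilation by 2 halves the norm, which turns 1/(2 pi) into 1/(4 pi).\<close>
    also have "\<dots> = L2_norm (?P t) / (4 * pi)"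
      unfolding L2_norm_cmult in_L2_double(2)[OF PL2] by (simp add: norm_divide)
    finally show ?thesis .
  qed
  then have ev: "\<forall>\<^sub>F t in at_top. L2_norm (?P t) / (4 * pi) = free_defect ((4 * L)\<^sup>2 / of_real (2 * pi)) (indicator (box a b)) t"
    by (rule eventually_mono[OF eventually_gt_at_top[of "0::real"] sym])
  have "((\<lambda>t. L2_norm (?P t) / (4 * pi)) \<longlongrightarrow> 0 / (4 * pi)) at_top"
    by (intro tendsto_divide chirp_product_tendsto assms tendsto_const) simp
  from Lim_transform_eventually[OF this ev] show ?thesis by simp
qed

text \<open>One constant serves all profiles: each coordinate contributes a limit factor 4L and the
  normalisation of the transform 1/(2 pi).\<close>

lemma free_defect_tendsto:
  obtains \<kappa> where "\<And>w. in_L2 w \<Longrightarrow> (free_defect \<kappa> w \<longlongrightarrow> 0) at_top"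
proof -
  obtain L where L: "(fresnel \<longlongrightarrow> L) at_top" "(fresnel \<longlongrightarrow> - L) at_bot" using fresnel_limit by blast
  define \<kappa> where "\<kappa> = (4 * L)\<^sup>2 / of_real (2 * pi)"
  have nonneg: "free_defect \<kappa> w t \<ge> 0" for w t by (simp add: free_defect_def)
  have step: "(free_defect \<kappa> s \<longlongrightarrow> 0) at_top" if "box_step s" for s
    using that
  proof (induction rule: box_step.induct)
    case zero
    have "\<forall>\<^sub>F t in at_top. 0 = free_defect \<kappa> (\<lambda>x. 0) t"
      using eventually_gt_at_top[of "0::real"]
    proof eventually_elim
      case (elim t)
      then show ?case using free_defect_bound[OF in_L2_zero elim, of \<kappa>] nonneg[of "\<lambda>x. 0" t] by simp
    qed
    then show ?case by (rule Lim_transform_eventually[OF tendsto_const])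
  next
    case (add s a b c)
    have "((\<lambda>t. free_defect \<kappa> s t + cmod c * free_defect \<kappa> (indicator (box a b)) t) \<longlongrightarrow> 0 + cmod c * 0) at_top"
      using free_defect_box[OF add(2,3) L] unfolding \<kappa>_def[symmetric] by (intro tendsto_intros add)
    then have lim: "((\<lambda>t. free_defect \<kappa> s t + cmod c * free_defect \<kappa> (indicator (box a b)) t) \<longlongrightarrow> 0) at_top" by simp
    have "\<forall>\<^sub>F t in at_top. norm (free_defect \<kappa> (\<lambda>x. s x + c * indicator (box a b) x) t) \<le>
        free_defect \<kappa> s t + cmod c * free_defect \<kappa> (indicator (box a b)) t"
      using eventually_gt_at_top[of "0::real"]
      by eventually_elim (simp add: nonneg free_defect_add box_step_in_L2[OF add(1)] in_L2_box)
    then show ?case by (rule Lim_null_comparison[OF _ lim])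
  qed
  have "(free_defect \<kappa> w \<longlongrightarrow> 0) at_top" if w: "in_L2 w" for w
  proof (rule tendstoI)
    fix e :: real assume e: "e > 0"
    \<comment> \<open>By the uniform bound, an approximation error below e' contributes less than
      e/2 to the defect at every t > 0.\<close>
    define e' where "e' = e / 2 / (1 + cmod \<kappa>)"
    have pos: "1 + cmod \<kappa> > 0" by (simp add: add_pos_nonneg)
    have "e' > 0" using e pos by (simp add: e'_def)
    then obtain s where s: "box_step s" "L2_norm (\<lambda>x. w x - s x) < e'" using L2_box_step_dense[OF w] by blast
    have "\<forall>\<^sub>F t in at_top. free_defect \<kappa> s t < e / 2"
      using order_tendstoD(2)[OF step[OF s(1)], of "e/2"] e by simp
    then show "\<forall>\<^sub>F t in at_top. dist (free_defect \<kappa> w t) 0 < e"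
      using eventually_gt_at_top[of "0::real"]
    proof eventually_elim
      case (elim t)
      have ws: "in_L2 (\<lambda>x. w x - s x)" by (intro in_L2_diff w box_step_in_L2 s)
      have "free_defect \<kappa> w t = free_defect \<kappa> (\<lambda>x. (w x - s x) + 1 * s x) t" by simp
      also have "\<dots> \<le> free_defect \<kappa> (\<lambda>x. w x - s x) t + cmod 1 * free_defect \<kappa> s t"
        by (rule free_defect_add[OF ws box_step_in_L2[OF s(1)] elim(2)])
      also have "free_defect \<kappa> (\<lambda>x. w x - s x) t \<le> (1 + cmod \<kappa>) * L2_norm (\<lambda>x. w x - s x)"
        by (rule free_defect_bound[OF ws elim(2)])
      also have "\<dots> < (1 + cmod \<kappa>) * e'" using s(2) pos by (rule mult_strict_left_mono)
      also have "(1 + cmod \<kappa>) * e' = e / 2"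
      proof -
        have "c * (x / c) = x" if "c > 0" for c x :: real using that by simp
        then show ?thesis unfolding e'_def using pos by blast
      qed
      finally show ?case using elim nonneg[of w t] by simp
    qed
  qed
  then show ?thesis using that by blast
qed

text \<open>The datum is the inverse transform of \<open>\<kappa> * w (2 * \<xi>)\<close>. Dilation
  by a positive factor keeps the angular dependence of w, and surjectivity respects it.\<close>

theorem pc_dilate_asymptotically_free:
  assumes w: "L2_equiv l w"
  obtains \<phi> where "L2_equiv l \<phi>" "((\<lambda>t. L2_norm (\<lambda>x. pc_dilate t w x - free_evol t \<phi> x)) \<longlongrightarrow> 0) at_top"
proof -
  have wL2: "in_L2 w" and weq: "equivariant l w" using w unfolding L2_equiv_def by auto
  obtain \<kappa> where \<kappa>: "\<And>w. in_L2 w \<Longrightarrow> (free_defect \<kappa> w \<longlongrightarrow> 0) at_top" using free_defect_tendsto by blast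
  have G: "in_L2 (\<lambda>\<xi>. \<kappa> * w (2 * \<xi>))" by (intro in_L2_cmult in_L2_double wL2)
  have Geq: "equivariant l (\<lambda>\<xi>. \<kappa> * w (2 * \<xi>))"
  proof -
    obtain g where g: "\<And>x. x \<noteq> 0 \<Longrightarrow> w x = g (cmod x) * ang l x" using weq unfolding equivariant_def by blast
    have "ang l (2 * x) = ang l x" for x
    proof -
      have "sgn (2 :: complex) = 1" by (simp add: sgn_eq)
      then show ?thesis by (simp add: ang_def sgn_mult)
    qed
    then have "\<kappa> * w (2 * x) = (\<kappa> * g (2 * cmod x)) * ang l x" if "x \<noteq> 0" for x
      using that by (simp add: g norm_mult)
    then show ?thesis unfolding equivariant_def by (intro exI[of _ "\<lambda>r. \<kappa> * g (2 * r)"]) simp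
  qed
  obtain \<phi> where \<phi>: "has_fourier \<phi> (\<lambda>\<xi>. \<kappa> * w (2 * \<xi>))" "equivariant l \<phi>"
    using fourier_surj[OF G] Geq by blast
  have "L2_equiv l \<phi>" using \<phi> has_fourier_in_L2 unfolding L2_equiv_def by blast
  moreover have "\<forall>\<^sub>F t in at_top. free_defect \<kappa> w t = L2_norm (\<lambda>x. pc_dilate t w x - free_evol t \<phi> x)"
    using eventually_gt_at_top[of "0::real"]
  proof eventually_elim
    case (elim t)
    show ?case unfolding free_defect_def
      by (rule L2_norm_minus_free_evol[OF has_fourier_fourier[OF pc_dilate_L2(1)[OF wL2 elim]] \<phi>(1), symmetric])
  qed
  then have "((\<lambda>t. L2_norm (\<lambda>x. pc_dilate t w x - free_evol t \<phi> x)) \<longlongrightarrow> 0) at_top"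
    by (rule Lim_transform_eventually[OF \<kappa>[OF wL2]])
  ultimately show ?thesis using that by blast
qed

section \<open>Scattering\<close>

lemma pseudoconf_eq: "pseudoconf v t = pc_dilate t (v (- 1 / t))"
  by (simp add: fun_eq_iff pseudoconf_def pc_dilate_def)

lemma L2_equiv_pc_dilate:
  assumes "L2_equiv l w" "t > 0" shows "L2_equiv l (pc_dilate t w)"
proof -
  obtain g where g: "\<And>x. x \<noteq> 0 \<Longrightarrow> w x = g (cmod x) * ang l x"
    using assms unfolding L2_equiv_def equivariant_def by blast
  have "equivariant l (pc_dilate t w)"
    unfolding equivariant_def
  proof (intro exI[of _ "\<lambda>r. of_real (1 / t) * cis (r\<^sup>2 / (4 * t)) * g (r / t)"] allI impI)
    fix x :: complex assume x: "x \<noteq> 0"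
    have "sgn (complex_of_real t) = 1" using assms(2) by simp
    then have "ang l (x / of_real t) = ang l x" by (simp add: ang_def sgn_divide)
    then have "w (x / of_real t) = g (cmod x / t) * ang l x"
      using g[of "x / of_real t"] x assms(2) by (simp add: norm_divide)
    then show "pc_dilate t w x = of_real (1 / t) * cis ((cmod x)\<^sup>2 / (4 * t)) * g (cmod x / t) * ang l x"
      by (simp add: pc_dilate_def)
  qed
  then show ?thesis using pc_dilate_L2 assms unfolding L2_equiv_def by blast
qed

lemma filterlim_minus_inverse_at_left: "filterlim (\<lambda>t::real. - 1 / t) (at_left 0) at_top"
proof (rule filterlim_at_withinI)
  show "((\<lambda>t::real. - 1 / t) \<longlongrightarrow> 0) at_top"
    by (intro tendsto_divide_0[OF tendsto_const] filterlim_at_top_imp_at_infinity filterlim_ident)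
  show "\<forall>\<^sub>F t::real in at_top. - 1 / t \<in> {..<0} - {0}"
    using eventually_gt_at_top[of "0::real"] by eventually_elim auto
qed

text \<open>Here h is a curve continuous up to s = 0 from the left with value w there, and v is
  asymptotic to its transform. The isometry carries the convergence of h to w over to the
  transforms, so v inherits the free wave attached to w.\<close>

lemma scatters_pseudoconf:
  assumes w: "L2_equiv l w" and h: "\<forall>\<^sub>F s in at_left 0. L2_equiv l (h s)"
    and hw: "((\<lambda>s. L2_norm (\<lambda>x. h s x - w x)) \<longlongrightarrow> 0) (at_left 0)"
    and v: "\<forall>\<^sub>F t in at_top. L2_equiv l (v t)"
    and vh: "((\<lambda>t. L2_norm (\<lambda>x. v t x - pseudoconf h t x)) \<longlongrightarrow> 0) at_top"
  shows "scatters_forward l v"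
proof -
  obtain \<phi> where \<phi>: "L2_equiv l \<phi>" "((\<lambda>t. L2_norm (\<lambda>x. pc_dilate t w x - free_evol t \<phi> x)) \<longlongrightarrow> 0) at_top"
    using pc_dilate_asymptotically_free[OF w] by blast
  let ?b = "\<lambda>t. L2_norm (\<lambda>x. v t x - pseudoconf h t x) +
      (L2_norm (\<lambda>x. h (- 1 / t) x - w x) + L2_norm (\<lambda>x. pc_dilate t w x - free_evol t \<phi> x))"
  have "(?b \<longlongrightarrow> 0 + (0 + 0)) at_top"
    by (intro tendsto_add vh \<phi>(2) filterlim_compose[OF hw filterlim_minus_inverse_at_left])
  then have b: "(?b \<longlongrightarrow> 0) at_top" by simp
  have "\<forall>\<^sub>F t in at_top. L2_equiv l (h (- 1 / t))"
    by (rule eventually_compose_filterlim[OF h filterlim_minus_inverse_at_left])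
  with v eventually_gt_at_top[of "0::real"]
  have "\<forall>\<^sub>F t in at_top. norm (L2_norm (\<lambda>x. v t x - free_evol t \<phi> x)) \<le> ?b t"
  proof eventually_elim
    case (elim t)
    have L2: "in_L2 (v t)" "in_L2 (h (- 1 / t))" "in_L2 w" "in_L2 (free_evol t \<phi>)"
      using elim w \<phi>(1) free_evol(1) unfolding L2_equiv_def by auto
    note pc = pc_dilate_L2(1)[OF L2(2) elim(2)] pc_dilate_L2(1)[OF L2(3) elim(2)]
    have "L2_norm (\<lambda>x. v t x - free_evol t \<phi> x) \<le> L2_norm (\<lambda>x. v t x - pseudoconf h t x) +
      (L2_norm (\<lambda>x. pseudoconf h t x - pc_dilate t w x) + L2_norm (\<lambda>x. pc_dilate t w x - free_evol t \<phi> x))"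
      unfolding pseudoconf_eq
      using L2_norm_triangle_diff[OF L2(1) pc(1) L2(4)] L2_norm_triangle_diff[OF pc(1,2) L2(4)] by linarith
    also have "L2_norm (\<lambda>x. pseudoconf h t x - pc_dilate t w x) = L2_norm (\<lambda>x. h (- 1 / t) x - w x)"
      unfolding pseudoconf_eq pc_dilate_diff by (rule pc_dilate_L2(2)[OF in_L2_diff[OF L2(2,3)] elim(2)])
    finally show ?case by simp
  qed
  from Lim_null_comparison[OF this b] show ?thesis
    unfolding scatters_def using v \<phi>(1) by blast
qed

section \<open>The soliton as an equivariant L^2 function\<close>

lemma borel_measurable_ang [measurable]: "ang l \<in> borel_measurable borel"
  unfolding ang_def[abs_def] power_int_def sgn_div_norm by measurable

text \<open>The profile decays at least like 1/(1 + r^2), which is at most the tensor majorant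
  already known to be square integrable.\<close>

lemma in_L2_Q: "in_L2 (Q m)"
proof (rule in_L2_dominated)
  show "in_L2 (\<lambda>z. of_real (1 / sqrt (1 + (Re z)\<^sup>2) * (1 / sqrt (1 + (Im z)\<^sup>2))))" by (rule in_L2_chirp_majorant)
  show "Q m \<in> borel_measurable borel" unfolding Q_def extend_def[abs_def] Q_rad_def by measurable
  let ?B = "sqrt 8 * (real m + 1) * 2"
  show "AE z in lborel. cmod (Q m z) \<le> ?B * cmod (of_real (1 / sqrt (1 + (Re z)\<^sup>2) * (1 / sqrt (1 + (Im z)\<^sup>2))))"
    using AE_lborel_singleton[of "0::complex"]
  proof eventually_elim
    case (elim z)
    define r where "r = cmod z"
    have r: "r > 0" using elim by (simp add: r_def)
    have arith: "p \<le> 1 \<Longrightarrow> q \<le> 1 \<Longrightarrow> 0 \<le> s \<Longrightarrow> p + q \<le> 2 * (1 + s)" "p \<le> s \<Longrightarrow> q \<le> s \<Longrightarrow> p + q \<le> 2 * (1 + s)"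
      for p q s :: real by (simp_all add: distrib_left)
    \<comment> \<open>Both exponents lie between 0 and 2(m + 1), so each power is bounded by 1 for r
      \<le> 1 and by the top power for r > 1.\<close>
    have "r ^ m + r ^ (m + 2) \<le> 2 * (1 + r ^ (2 * (m + 1)))"
    proof (cases "r \<le> 1")
      case True
      then have "r ^ m \<le> 1" "r ^ (m + 2) \<le> 1" using r by (intro power_le_one; simp)+
      moreover have "r ^ (2 * (m + 1)) \<ge> 0" using r by simp
      ultimately show ?thesis by (rule arith(1))
    next
      case False
      then have "r ^ m \<le> r ^ (2 * (m + 1))" "r ^ (m + 2) \<le> r ^ (2 * (m + 1))" by (intro power_increasing; simp)+
      then show ?thesis by (rule arith(2))
    qed
    then have "r ^ m * (1 + r\<^sup>2) \<le> 2 * (1 + r ^ (2 * (m + 1)))" by (simp only: distrib_left mult_1_right power_add)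
    then have 1: "r ^ m / (1 + r ^ (2 * (m + 1))) \<le> 2 / (1 + r\<^sup>2)"
      using r by (subst divide_le_eq, simp add: add_pos_nonneg) (simp add: pos_le_divide_eq add_pos_nonneg mult.commute)
    have 2: "sqrt (1 + (Re z)\<^sup>2) * sqrt (1 + (Im z)\<^sup>2) \<le> 1 + r\<^sup>2"
    proof -
      have "(1 + (Re z)\<^sup>2) * (1 + (Im z)\<^sup>2) \<le> (1 + r\<^sup>2)\<^sup>2"
      proof -
        have "(1 + p) * (1 + q) \<le> (1 + (p + q))\<^sup>2" if "p \<ge> 0" "q \<ge> 0" for p q :: real
        proof -
          have "0 \<le> p * q" "0 \<le> p * p" "0 \<le> q * q" using that by auto
          then show ?thesis using that by (simp add: power2_eq_square algebra_simps)
        qed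
        from this[of "(Re z)\<^sup>2" "(Im z)\<^sup>2"] show ?thesis by (simp add: r_def cmod_power2)
      qed
      then show ?thesis unfolding real_sqrt_mult[symmetric] by (intro real_le_lsqrt) auto
    qed
    have "cmod (Q m z) = sqrt 8 * (real m + 1) * (r ^ m / (1 + r ^ (2 * (m + 1))))"
    proof -
      have "Q_rad m r \<ge> 0" using r by (simp add: Q_rad_def)
      then have "cmod (Q m z) = Q_rad m r"
        unfolding Q_def extend_def norm_mult norm_of_real cmod_ang[OF elim] r_def by simp
      then show ?thesis unfolding Q_rad_def .
    qed
    also have "\<dots> \<le> sqrt 8 * (real m + 1) * (2 / (1 + r\<^sup>2))" by (intro mult_left_mono 1) auto
    also have "\<dots> \<le> sqrt 8 * (real m + 1) * (2 / (sqrt (1 + (Re z)\<^sup>2) * sqrt (1 + (Im z)\<^sup>2)))"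
      by (intro mult_left_mono divide_left_mono 2) (auto intro!: mult_pos_pos add_pos_nonneg)
    also have "\<dots> = ?B * cmod (of_real (1 / sqrt (1 + (Re z)\<^sup>2) * (1 / sqrt (1 + (Im z)\<^sup>2))))"
      unfolding norm_of_real by simp
    finally show ?case .
  qed
qed

lemma L2_equiv_Q: "L2_equiv (int m) (Q m)"
  unfolding L2_equiv_def equivariant_def using in_L2_Q by (auto simp: Q_def extend_def)

section \<open>From Sobolev continuity to L^2 continuity of solutions\<close>

lemma equivariant_diff: "equivariant l f \<Longrightarrow> equivariant l g \<Longrightarrow> equivariant l (\<lambda>x. f x - g x)"
  unfolding equivariant_iff by (metis left_diff_distrib)

lemma L2_equiv_diff: "L2_equiv l f \<Longrightarrow> L2_equiv l g \<Longrightarrow> L2_equiv l (\<lambda>x. f x - g x)"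
  unfolding L2_equiv_def by (auto intro: in_L2_diff equivariant_diff)

text \<open>\<open>Hs_norm\<close> has the default value 0 when its integral diverges, so smallness
  of the norm of a difference is informative only once the difference is known to lie in the
  space.\<close>

lemma in_Hs_diff:
  assumes "in_Hs s f" "in_Hs s g" shows "in_Hs s (\<lambda>x. f x - g x)"
proof -
  have L2: "in_L2 f" "in_L2 g" using assms by (auto simp: in_Hs_def)
  note [measurable] = in_L2_measurable[OF in_L2_fourier[OF L2(1)]] in_L2_measurable[OF in_L2_fourier[OF L2(2)]]
    in_L2_measurable[OF in_L2_fourier[OF in_L2_diff[OF L2]]]
  let ?p = "\<lambda>\<xi>::complex. (1 + (cmod \<xi>)\<^sup>2) powr s"
  have "integrable lborel (\<lambda>\<xi>. ?p \<xi> * (cmod (fourier (\<lambda>x. f x - g x) \<xi>))\<^sup>2)"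
  proof (rule Bochner_Integration.integrable_bound)
    show "integrable lborel (\<lambda>\<xi>. 2 * (?p \<xi> * (cmod (fourier f \<xi>))\<^sup>2) + 2 * (?p \<xi> * (cmod (fourier g \<xi>))\<^sup>2))"
      using assms unfolding in_Hs_def by (intro Bochner_Integration.integrable_add integrable_mult_right) auto
    show "AE \<xi> in lborel. norm (?p \<xi> * (cmod (fourier (\<lambda>x. f x - g x) \<xi>))\<^sup>2) \<le>
       norm (2 * (?p \<xi> * (cmod (fourier f \<xi>))\<^sup>2) + 2 * (?p \<xi> * (cmod (fourier g \<xi>))\<^sup>2))"
      using fourier_AE[OF has_fourier_diff[OF has_fourier_fourier[OF L2(1)] has_fourier_fourier[OF L2(2)]]]
    proof eventually_elim
      case (elim \<xi>)
      have "(cmod (fourier f \<xi> - fourier g \<xi>))\<^sup>2 \<le> (cmod (fourier f \<xi>) + cmod (fourier g \<xi>))\<^sup>2"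
        by (intro power_mono norm_triangle_ineq4) auto
      also have "\<dots> \<le> 2 * (cmod (fourier f \<xi>))\<^sup>2 + 2 * (cmod (fourier g \<xi>))\<^sup>2"
        using sum_squares_bound[of "cmod (fourier f \<xi>)" "cmod (fourier g \<xi>)"] by (simp add: power2_sum)
      finally have "?p \<xi> * (cmod (fourier f \<xi> - fourier g \<xi>))\<^sup>2 \<le> ?p \<xi> * (2 * (cmod (fourier f \<xi>))\<^sup>2 + 2 * (cmod (fourier g \<xi>))\<^sup>2)"
        by (rule mult_left_mono) simp
      then show ?case unfolding elim by (simp add: algebra_simps)
    qed
  qed measurable
  then show ?thesis using L2 in_L2_diff unfolding in_Hs_def by blast
qed

text \<open>The Fourier weight is at least 1, and the transform is an isometry.\<close>

lemma L2_norm_le_H1_norm: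
  assumes "in_Hs 1 f" shows "L2_norm f \<le> Hs_norm 1 f"
proof -
  have L2: "in_L2 f" using assms by (simp add: in_Hs_def)
  have "L2_norm f = L2_norm (fourier f)" by (rule L2_norm_fourier[OF L2, symmetric])
  also have "\<dots> \<le> Hs_norm 1 f"
    unfolding L2_norm_def Hs_norm_def
  proof (intro real_sqrt_le_mono integral_mono)
    show "integrable lborel (\<lambda>\<xi>. (cmod (fourier f \<xi>))\<^sup>2)" by (rule in_L2_integrable[OF in_L2_fourier[OF L2]])
    show "integrable lborel (\<lambda>\<xi>. (1 + (cmod \<xi>)\<^sup>2) powr 1 * (cmod (fourier f \<xi>))\<^sup>2)" using assms by (simp add: in_Hs_def)
    fix \<xi> :: complex
    have "1 * (cmod (fourier f \<xi>))\<^sup>2 \<le> (1 + (cmod \<xi>)\<^sup>2) powr 1 * (cmod (fourier f \<xi>))\<^sup>2"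
      by (intro mult_right_mono) auto
    then show "(cmod (fourier f \<xi>))\<^sup>2 \<le> (1 + (cmod \<xi>)\<^sup>2) powr 1 * (cmod (fourier f \<xi>))\<^sup>2" by simp
  qed
  finally show ?thesis .
qed

lemma CSS_solution_L2_equiv: "CSS_solution l I u \<Longrightarrow> t \<in> I \<Longrightarrow> L2_equiv l (u t)"
  by (auto simp: CSS_solution_def Hs_equiv_def L2_equiv_def in_Hs_def)

lemma CSS_solution_L2_tendsto:
  assumes "CSS_solution l UNIV u"
  shows "((\<lambda>t. L2_norm (\<lambda>x. u t x - u t\<^sub>0 x)) \<longlongrightarrow> 0) (at t\<^sub>0)"
proof (rule Lim_null_comparison)
  show "((\<lambda>t. Hs_norm 1 (\<lambda>x. u t x - u t\<^sub>0 x)) \<longlongrightarrow> 0) (at t\<^sub>0)"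
    using assms by (simp add: CSS_solution_def)
  have "in_Hs 1 (u t)" for t using assms by (simp add: CSS_solution_def Hs_equiv_def)
  then show "\<forall>\<^sub>F t in at t\<^sub>0. norm (L2_norm (\<lambda>x. u t x - u t\<^sub>0 x)) \<le> Hs_norm 1 (\<lambda>x. u t x - u t\<^sub>0 x)"
    by (simp add: L2_norm_le_H1_norm in_Hs_diff)
qed

text \<open>If \<open>f\<close> is not integrable to the left of \<open>0\<close>, the integral has the junk value \<open>0\<close>.\<close>

lemma interval_integral_tendsto_0:
  fixes f :: "real \<Rightarrow> real"
  shows "((\<lambda>t. LBINT s=ereal 0..ereal t. f s) \<longlongrightarrow> 0) (at_left 0)"
proof (cases "\<exists>t<0. set_integrable lborel {t<..<0} f")
  case True
  then obtain b where b: "b < 0" "set_integrable lborel {b<..<0} f" by blast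
  show ?thesis
  proof (rule tendsto_at_left_sequentially[OF b(1)])
    fix S :: "nat \<Rightarrow> real" assume S: "\<And>n. S n < 0" "\<And>n. b < S n" "S \<longlonglongrightarrow> 0"
    have m: "(\<lambda>s. indicator {b<..<0} s *\<^sub>R f s) \<in> borel_measurable lborel"
      using b(2) unfolding set_integrable_def by (rule borel_measurable_integrable)
    have eq: "indicator {S n<..<0} s *\<^sub>R f s = indicator {S n<..<0} s *\<^sub>R (indicator {b<..<0} s *\<^sub>R f s)" for n s
      using S(2)[of n] by (auto simp: indicator_def)
    have "(\<lambda>n. LINT s|lborel. indicator {S n<..<0} s *\<^sub>R f s) \<longlonglongrightarrow> (LINT s::real|lborel. 0)"
    proof (rule integral_dominated_convergence)
      show "integrable lborel (\<lambda>s. norm (indicator {b<..<0} s *\<^sub>R f s))"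
        using b(2) unfolding set_integrable_def by (rule integrable_norm)
      show "AE s in lborel. (\<lambda>n. indicator {S n<..<0} s *\<^sub>R f s) \<longlonglongrightarrow> 0"
      proof (rule AE_I2, rule tendsto_eventually)
        fix s :: real
        show "\<forall>\<^sub>F n in sequentially. indicator {S n<..<0} s *\<^sub>R f s = 0"
        proof (cases "s < 0")
          case True
          from order_tendstoD(1)[OF S(3) True] show ?thesis by eventually_elim (auto simp: indicator_def)
        qed simp
      qed
      show "AE s in lborel. norm (indicator {S n<..<0} s *\<^sub>R f s) \<le> norm (indicator {b<..<0} s *\<^sub>R f s)" for n
        using S(2)[of n] by (intro AE_I2) (auto simp: indicator_def)
      show "(\<lambda>s. indicator {S n<..<0} s *\<^sub>R f s) \<in> borel_measurable lborel" for n
        unfolding eq by (intro borel_measurable_scaleR m) simp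
    qed simp
    \<comment> \<open>Since the endpoint S n lies to the left of 0, the oriented integral from 0 to
      S n is minus the integral over the interval.\<close>
    then have "(\<lambda>n. - (LINT s|lborel. indicator {S n<..<0} s *\<^sub>R f s)) \<longlonglongrightarrow> - 0"
      by (intro tendsto_minus) simp
    then show "(\<lambda>n. LBINT s=ereal 0..ereal (S n). f s) \<longlonglongrightarrow> 0"
      using S(1)[THEN linorder_not_le[THEN iffD2]] by (simp add: interval_lebesgue_integral_def set_lebesgue_integral_def)
  qed
next
  case False
  then have "(LINT s|lborel. indicator {t<..<0} s *\<^sub>R f s) = 0" if "t < 0" for t
    using that by (intro not_integrable_integral_eq) (auto simp: set_integrable_def)
  then have "\<forall>\<^sub>F t in at_left 0. 0 = (LBINT s=ereal 0..ereal t. f s)"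
    by (auto simp: eventually_at_filter interval_lebesgue_integral_def set_lebesgue_integral_def)
  then show ?thesis by (rule Lim_transform_eventually[OF tendsto_const])
qed

section \<open>The transformed bubble and the two scattering claims\<close>

lemma gamma_cor_tendsto_0: "(gamma_cor m z \<longlongrightarrow> 0) (at_left 0)"
  using tendsto_minus[OF interval_integral_tendsto_0] unfolding gamma_cor_def by simp

text \<open>At time -1/t the bubble has scale 1/t and quadratic phase parameter 1/t; the dilation
  and the phase of the transformation undo both exactly, so only
  \<open>cis (gamma_cor m z (- 1 / t))\<close> distinguishes its image from
  \<open>Q m\<close>.\<close>

lemma pseudoconf_blowup:
  assumes t: "t > 0"
  shows "pseudoconf u t x - Q m x - pseudoconf z t x =
     pc_dilate t (blowup_remainder m z u (- 1 / t)) x + (cis (gamma_cor m z (- 1 / t)) - 1) * Q m x"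
proof -
  let ?c = "cis (gamma_cor m z (- 1 / t))"
  have abs: "\<bar>- 1 / t\<bar> = 1 / t" using t by simp
  have arg: "x / of_real t / of_real (1 / t) = x" using t by simp
  have "cis ((cmod x)\<^sup>2 / (4 * t)) * cis (- (1 / t) * (cmod x)\<^sup>2 / 4) = 1"
    unfolding cis_mult by simp
  then have ph: "of_real (1 / t) * cis ((cmod x)\<^sup>2 / (4 * t)) * (of_real t * pc_phase (1 / t) (Q m) x * ?c) = Q m x * ?c"
    using t unfolding pc_phase_def by (simp add: field_simps)
  have "u (- 1 / t) y = blowup_remainder m z u (- 1 / t) y +
      of_real t * pc_phase (1 / t) (Q m) (y / of_real (1 / t)) * ?c + z (- 1 / t) y" for y
    unfolding blowup_remainder_def abs by simp
  then have "pseudoconf u t x = pc_dilate t (blowup_remainder m z u (- 1 / t)) x +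
      of_real (1 / t) * cis ((cmod x)\<^sup>2 / (4 * t)) * (of_real t * pc_phase (1 / t) (Q m) (x / of_real t / of_real (1 / t)) * ?c)
      + pseudoconf z t x"
    unfolding pseudoconf_eq pc_dilate_def by (simp only: distrib_left)
  then show ?thesis unfolding arg ph by (simp add: algebra_simps)
qed

lemma ang_add: "x \<noteq> 0 \<Longrightarrow> ang k x * ang l x = ang (k + l) x"
  by (simp add: ang_def power_int_add sgn_zero_iff)

text \<open>With k = 2m + 2 this carries the -(m+2)-equivariant solution to the m-equivariant
  z.\<close>

lemma L2_equiv_ang_mult:
  assumes "L2_equiv l f" shows "L2_equiv (k + l) (\<lambda>x. ang k x * f x)"
proof -
  have f: "in_L2 f" "equivariant l f" using assms by (auto simp: L2_equiv_def)
  obtain g where "\<And>x. x \<noteq> 0 \<Longrightarrow> f x = g (cmod x) * ang l x" using f(2) unfolding equivariant_def by blast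
  then have "ang k x * f x = g (cmod x) * ang (k + l) x" if "x \<noteq> 0" for x
    using that by (simp flip: ang_add)
  moreover have "in_L2 (\<lambda>x. ang k x * f x)"
  proof (rule in_L2_dominated[OF f(1), where B = 1])
    show "(\<lambda>x. ang k x * f x) \<in> borel_measurable borel" using in_L2_measurable[OF f(1)] by measurable
    show "AE x in lborel. cmod (ang k x * f x) \<le> 1 * cmod (f x)"
      using AE_lborel_singleton[of "0::complex"] by eventually_elim (simp add: norm_mult cmod_ang)
  qed
  ultimately show ?thesis unfolding L2_equiv_def equivariant_def by blast
qed

lemma L2_norm_ang_mult: "f \<in> borel_measurable borel \<Longrightarrow> L2_norm (\<lambda>x. ang k x * f x) = L2_norm f"
  by (rule L2_norm_cong_AE)
    (use AE_lborel_singleton[of "0::complex"] in \<open>auto elim!: eventually_mono simp: norm_mult cmod_ang\<close>)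

theorem corollary1p4:
  fixes m :: nat and k C :: real
  assumes "m \<ge> 1" and "k > real m + 3" and "C > 0"
  shows "\<exists>\<alpha>\<^sub>0>0. \<forall>\<alpha> \<eta>s :: real.
    \<forall>zs zts :: complex \<Rightarrow> complex.
    \<forall>zt z :: real \<Rightarrow> complex \<Rightarrow> complex.
    \<forall>u :: real \<Rightarrow> real \<Rightarrow> complex \<Rightarrow> complex.
      0 < \<alpha> \<and> \<alpha> < \<alpha>\<^sub>0 \<and> 0 < \<eta>s \<and>
      equivariant (int m) zs \<and>
      zts = (\<lambda>x. ang (- (2 * int m + 2)) x * zs x) \<and>
      Hs_equiv k (- (int m + 2)) zts \<and> Hs_norm k zts < \<alpha> \<and>
      CSS_solution (- (int m + 2)) UNIV zt \<and> (AE x in lborel. zt 0 x = zts x) \<and>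
      z = (\<lambda>t x. ang (2 * int m + 2) x * zt t x) \<and>
      CSS_family m C \<alpha> \<eta>s z u
      \<longrightarrow>
      scatters_forward (int m) (\<lambda>t x. pseudoconf (u 0) t x - Q m x) \<and>
      (\<forall>\<eta>\<in>{0<..\<eta>s}. scatters_forward (int m) (pseudoconf (u \<eta>)))"
\<comment> \<open>For each fixed \<alpha> the remainder bound
  \<open>C * \<alpha> * \<bar>t\<bar> ^ (m + 1)\<close> already tends to 0, so the threshold 1
  serves.\<close>
proof (rule exI[of _ 1], intro conjI[OF zero_less_one] allI impI, elim conjE, intro conjI ballI)
  fix \<alpha> \<eta>s :: real and zs zts :: "complex \<Rightarrow> complex" and zt z :: "real \<Rightarrow> complex \<Rightarrow> complex"
    and u :: "real \<Rightarrow> real \<Rightarrow> complex \<Rightarrow> complex"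
  assume zt: "CSS_solution (- (int m + 2)) UNIV zt"
    and z: "z = (\<lambda>t x. ang (2 * int m + 2) x * zt t x)"
    and fam: "CSS_family m C \<alpha> \<eta>s z u"
  have ztL2: "L2_equiv (- (int m + 2)) (zt t)" for t by (rule CSS_solution_L2_equiv[OF zt]) simp
  have zL2: "L2_equiv (int m) (z t)" for t
    using L2_equiv_ang_mult[OF ztL2[of t], of "2 * int m + 2"] by (simp add: z)
  have "L2_norm (\<lambda>x. z t x - z 0 x) = L2_norm (\<lambda>x. zt t x - zt 0 x)" for t
    using L2_norm_ang_mult[OF in_L2_measurable, OF in_L2_diff, of "zt t" "zt 0" "2 * int m + 2"] ztL2
    by (simp add: z L2_equiv_def right_diff_distrib)
  then have z0: "((\<lambda>t. L2_norm (\<lambda>x. z t x - z 0 x)) \<longlongrightarrow> 0) (at_left 0)"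
    using tendsto_mono[OF at_le[OF subset_UNIV] CSS_solution_L2_tendsto[OF zt, of 0]] by simp
  have u0: "CSS_solution (int m) {..<0} (u 0)"
    and rem: "\<forall>\<^sub>F t in at_left 0. L2_equiv (int m) (blowup_remainder m z (u 0) t) \<and>
        L2_norm (blowup_remainder m z (u 0) t) \<le> C * \<alpha> * \<bar>t\<bar> ^ (m + 1)"
    using fam unfolding CSS_family_def by (auto elim: eventually_mono)
  show "scatters_forward (int m) (\<lambda>t x. pseudoconf (u 0) t x - Q m x)"
  \<comment> \<open>The comparison curve is z with limiting profile z 0: after removal of the
    soliton, the transform of the blow-up solution follows that of z.\<close>
  proof (rule scatters_pseudoconf[OF zL2[of 0] always_eventually z0])
    show "\<forall>s. L2_equiv (int m) (z s)" using zL2 by blast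
    show "\<forall>\<^sub>F t in at_top. L2_equiv (int m) (\<lambda>x. pseudoconf (u 0) t x - Q m x)"
      using eventually_gt_at_top[of "0::real"]
    proof eventually_elim
      case (elim t)
      show ?case unfolding pseudoconf_eq
        by (intro L2_equiv_diff L2_equiv_Q L2_equiv_pc_dilate CSS_solution_L2_equiv[OF u0]) (use elim in auto)
    qed
    \<comment> \<open>The first term bounds the transformed remainder, whose norm is unchanged; the
      second measures the rotation of \<open>Q m\<close> by \<open>gamma_cor\<close>, which fades as
      the phase tends to 0.\<close>
    let ?b = "\<lambda>t. C * \<alpha> * \<bar>- 1 / t\<bar> ^ (m + 1) + cmod (cis (gamma_cor m z (- 1 / t)) - 1) * L2_norm (Q m)"
    have inv: "((\<lambda>t::real. - 1 / t) \<longlongrightarrow> 0) at_top"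
      using filterlim_minus_inverse_at_left by (simp add: filterlim_at)
    have "(?b \<longlongrightarrow> C * \<alpha> * \<bar>0\<bar> ^ (m + 1) + cmod (cis 0 - 1) * L2_norm (Q m)) at_top"
      by (intro tendsto_intros inv tendsto_cis filterlim_compose[OF gamma_cor_tendsto_0 filterlim_minus_inverse_at_left])
    then have b: "(?b \<longlongrightarrow> 0) at_top" by simp
    have "\<forall>\<^sub>F t in at_top. norm (L2_norm (\<lambda>x. pseudoconf (u 0) t x - Q m x - pseudoconf z t x)) \<le> ?b t"
      using eventually_compose_filterlim[OF rem filterlim_minus_inverse_at_left] eventually_gt_at_top[of "0::real"]
    proof eventually_elim
      case (elim t)
      let ?r = "blowup_remainder m z (u 0) (- 1 / t)"
      have r: "in_L2 ?r" using elim by (simp add: L2_equiv_def)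
      have "L2_norm (\<lambda>x. pseudoconf (u 0) t x - Q m x - pseudoconf z t x) \<le>
          L2_norm (pc_dilate t ?r) + L2_norm (\<lambda>x. (cis (gamma_cor m z (- 1 / t)) - 1) * Q m x)"
        unfolding pseudoconf_blowup[OF elim(2)]
        by (intro L2_norm_triangle pc_dilate_L2 r in_L2_cmult in_L2_Q elim)
      then show ?case using elim by (simp only: L2_norm_cmult pc_dilate_L2(2)[OF r elim(2)]) simp
    qed
    then show "((\<lambda>t. L2_norm (\<lambda>x. pseudoconf (u 0) t x - Q m x - pseudoconf z t x)) \<longlongrightarrow> 0) at_top"
      by (rule Lim_null_comparison[OF _ b])
  qed
  fix \<eta> assume "\<eta> \<in> {0<..\<eta>s}"
  then have u: "CSS_solution (int m) UNIV (u \<eta>)" using fam unfolding CSS_family_def by blast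
  then have uL2: "L2_equiv (int m) (u \<eta> t)" for t by (rule CSS_solution_L2_equiv) simp
  show "scatters_forward (int m) (pseudoconf (u \<eta>))"
  \<comment> \<open>Here the solution is its own comparison curve, continuous through s = 0 with
    profile u \<eta> 0, and the difference to its transform is identically 0.\<close>
  proof (rule scatters_pseudoconf[OF uL2[of 0]])
    show "\<forall>\<^sub>F s in at_left 0. L2_equiv (int m) (u \<eta> s)" using uL2 by simp
    show "((\<lambda>s. L2_norm (\<lambda>x. u \<eta> s x - u \<eta> 0 x)) \<longlongrightarrow> 0) (at_left 0)"
      by (rule tendsto_mono[OF at_le[OF subset_UNIV] CSS_solution_L2_tendsto[OF u]])
    show "\<forall>\<^sub>F t in at_top. L2_equiv (int m) (pseudoconf (u \<eta>) t)"
      using eventually_gt_at_top[of "0::real"]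
      by eventually_elim (simp only: pseudoconf_eq L2_equiv_pc_dilate uL2)
  qed simp
qed

end
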